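(* Let $k$ be a field of characteristic zero, let $S_r$ be any semigroup with $\mathfrak S_r\subseteq S_r\subseteq\bar\tau_r$, and let $B$ be either $B_L$ or $B_R$, the left or right generalized Schur algebra of $S_r$ over $k$. Let $\nu=1^{(r)}\in\Lambda^+$ be the smallest partition ($\nu_i=1$ for $1\le i\le r$, $\nu_i=0$ for $i>r$). Then $C^\nu\cong k[S_r]$ (the monoid algebra of $S_r$ over $k$), while $C^\lambda=0$ for $\lambda\in\Lambda^+$, $\lambda\ne\nu$. The irreducible left $B$-modules are all at level $\nu$ and correspond to irreducible left $k[S_r]$-modules. (The irreducible left $k[S_r]$-modules in turn correspond to irreducible left $k[\mathfrak S_i]$-modules for various $i\le r$.)
   Context: Fix integers $r\ge 1$ and $n\ge r$. $\bar\tau_r$ is the monoid, under composition $(\alpha\beta)(x)=\alpha(\beta(x))$, of all maps $\alpha:\{0,1,\dots,r\}\to\{0,1,\dots,r\}$ with $\alpha(0)=0$. $\mathfrak S_i$ denotes the symmetric group on $i$ letters; the symmetric group $\mathfrak S_r$ on $\{1,\dots,r\}$ is regarded as a submonoid of $\bar\tau_r$ by extending each map by $0\mapsto 0$. $\Lambda$ is the set of compositions $\lambda=(\lambda_1,\dots,\lambda_n)$ of $r$ ($\lambda_i\ge 0$ integers, $\sum\lambda_i=r$); $\Lambda^+\subseteq\Lambda$ is the set of partitions (weakly decreasing compositions). The $\lambda$-blocks are $b_i^\lambda=\{k:\lambda_1+\dots+\lambda_{i-1}<k\le\lambda_1+\dots+\lambda_i\}$, and $G_\lambda=\mathfrak S_\lambda\subseteq\mathfrak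 S_r$ is the Young subgroup of all permutations mapping each $\lambda$-block to itself. ${}_\lambda M_\mu$ is the set of double cosets $G_\lambda\alpha G_\mu$, $\alpha\in S_r$. For $\alpha\in S_r$ put $G_L(\lambda,\alpha,\mu)=\{\pi\in G_\mu:\exists\sigma\in G_\lambda,\ \alpha\pi=\sigma\alpha\}$ and $G_R(\lambda,\alpha,\mu)=\{\sigma\in G_\lambda:\exists\pi\in G_\mu,\ \sigma\alpha=\alpha\pi\}$; their orders $n_L(\lambda,\alpha,\mu)$, $n_R(\lambda,\alpha,\mu)$ depend only on $D=G_\lambda\alpha G_\mu$ and are also written $n_L(D)$, $n_R(D)$. For $D_\alpha=G_\lambda\alpha G_\nu$, $D_\beta=G_\nu\beta G_\mu$, $D\in{}_\lambda M_\mu$ let $N(D_\alpha,D_\beta,D)=\#\{\rho\in G_\nu:\alpha\rho\beta\in D\}$ (independent of representatives). For $X\in\{L,R\}$, $B_X$ is the $k$-algebra with $k$-basis $\{f(\lambda,D,\mu):\lambda,\mu\in\Lambda,\ D\in{}_\lambda M_\mu\}$, writing $f(\lambda,\alpha,\mu)=f(\lambda,G_\lambda\alpha G_\mu,\mu)$, and product given by $f(\lambda,\alpha,\nu)*_X f(\omega,\beta,\mu)=0$ if $\nu\ne\omega$ and $$f(\lambda,\alpha,\nu)*_X f(\nu,\beta,\mu)=\sum_{D\in{}_\lambda M_\mu}\frac{n_X(D)\,N(D_\alpha,D_\beta,D)}{n_X(\lambda,\alpha,\nu)\,n_X(\nu,\beta,\mu)}f(\lambda,D,\mu);$$ the coefficients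 are nonnegative integers, read in $k$. This is an associative algebra; the elements $1_\lambda=f(\lambda,1,\lambda)$, $\lambda\in\Lambda$, are orthogonal idempotents with sum the identity. For $\lambda\in\Lambda$ let $\lambda^+\in\Lambda^+$ be its weakly decreasing rearrangement. Write $\lambda\sim\mu$ if $\lambda^+=\mu^+$, and $\mu<\lambda$ if $\mu^+$ is lexicographically smaller than $\lambda^+$ (at the first index where they differ, the part of $\mu^+$ is smaller). For $\lambda\in\Lambda^+$ put $e_\lambda=\sum_{\mu\in\Lambda,\mu<\lambda}1_\mu$ (so $e_\lambda=0$ for the smallest partition) and $\bar e_\lambda=e_\lambda+\sum_{\mu\in\Lambda,\mu\sim\lambda}1_\mu$. An irreducible left $B$-module $I$ is at level $\lambda$ if $\bar e_\lambda I\ne 0$ and $e_\lambda I=0$. Finally $C^\lambda=1_\lambda B1_\lambda/(1_\lambda B1_\lambda\cap Be_\lambda B)$, a $k$-algebra with unit the class of $1_\lambda$. *)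

theory Defs
  imports
    "HOL-Algebra.Module"
    "HOL-Algebra.QuotRing"
    "HOL-Combinatorics.Permutations"
begin

section \<open>Left modules over a non-commutative ring\<close>

text \<open>The axioms of the library locale \<^locale>\<open>module\<close>, with the ring not required to be
  commutative.  As in the library, the multiplicative fields of the module record are ignored.
  For a module over a unital \<open>k\<close>-algebra the \<open>k\<close>-structure is the one given by the
  multiples of the unit.\<close>

locale left_module = R?: ring + M?: abelian_group M for M (structure) +
  assumes smult_closed [simp, intro]:
      "\<lbrakk>a \<in> carrier R; x \<in> carrier M\<rbrakk> \<Longrightarrow> a \<odot>\<^bsub>M\<^esub> x \<in> carrier M"
    and smult_l_distr:
      "\<lbrakk>a \<in> carrier R; b \<in> carrier R; x \<in> carrier M\<rbrakk> \<Longrightarrow>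
        (a \<oplus> b) \<odot>\<^bsub>M\<^esub> x = a \<odot>\<^bsub>M\<^esub> x \<oplus>\<^bsub>M\<^esub> b \<odot>\<^bsub>M\<^esub> x"
    and smult_r_distr:
      "\<lbrakk>a \<in> carrier R; x \<in> carrier M; y \<in> carrier M\<rbrakk> \<Longrightarrow>
        a \<odot>\<^bsub>M\<^esub> (x \<oplus>\<^bsub>M\<^esub> y) = a \<odot>\<^bsub>M\<^esub> x \<oplus>\<^bsub>M\<^esub> a \<odot>\<^bsub>M\<^esub> y"
    and smult_assoc1:
      "\<lbrakk>a \<in> carrier R; b \<in> carrier R; x \<in> carrier M\<rbrakk> \<Longrightarrow>
        (a \<otimes> b) \<odot>\<^bsub>M\<^esub> x = a \<odot>\<^bsub>M\<^esub> (b \<odot>\<^bsub>M\<^esub> x)"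
    and smult_one [simp]: "x \<in> carrier M \<Longrightarrow> \<one> \<odot>\<^bsub>M\<^esub> x = x"

definition irreducible_module :: "('a, 'm) ring_scheme \<Rightarrow> ('a, 'v) module \<Rightarrow> bool" where
  "irreducible_module R M \<longleftrightarrow>
     left_module R M \<and> carrier M \<noteq> {\<zero>\<^bsub>M\<^esub>} \<and>
     (\<forall>H. submodule H R M \<longrightarrow> H = {\<zero>\<^bsub>M\<^esub>} \<or> H = carrier M)"

definition module_isomorphic ::
    "('a, 'm) ring_scheme \<Rightarrow> ('a, 'v) module \<Rightarrow> ('a, 'w) module \<Rightarrow> bool" where
  "module_isomorphic R M N \<longleftrightarrow>
     (\<exists>h. bij_betw h (carrier M) (carrier N) \<and>
        (\<forall>x\<in>carrier M. \<forall>y\<in>carrier M. h (x \<oplus>\<^bsub>M\<^esub> y) = h x \<oplus>\<^bsub>N\<^esub> h y) \<and>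
        (\<forall>a\<in>carrier R. \<forall>x\<in>carrier M. h (a \<odot>\<^bsub>M\<^esub> x) = a \<odot>\<^bsub>N\<^esub> h x))"

definition algebra_iso :: "('k, 'a) module \<Rightarrow> ('k, 'b) module \<Rightarrow> ('a \<Rightarrow> 'b) set" where
  "algebra_iso A C =
     {\<phi> \<in> ring_iso A C. \<forall>c. \<forall>x\<in>carrier A. \<phi> (c \<odot>\<^bsub>A\<^esub> x) = c \<odot>\<^bsub>C\<^esub> \<phi> x}"

text \<open>The additive subgroup \<open>V\<close> of a module, with a possibly different ring acting on it.\<close>

definition with_action ::
    "('a, 'v) module \<Rightarrow> 'v set \<Rightarrow> ('b \<Rightarrow> 'v \<Rightarrow> 'v) \<Rightarrow> ('b, 'v) module" where
  "with_action M V act =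
     \<lparr>carrier = V, monoid.mult = monoid.mult M, one = \<one>\<^bsub>M\<^esub>,
      zero = \<zero>\<^bsub>M\<^esub>, add = add M, smult = act\<rparr>"

definition pullback :: "('b \<Rightarrow> 'a) \<Rightarrow> ('a, 'v) module \<Rightarrow> ('b, 'v) module" where
  "pullback \<phi> M = with_action M (carrier M) (\<lambda>b. smult M (\<phi> b))"


section \<open>Transformation monoids and their algebras\<close>

text \<open>A map of \<open>{0..r}\<close> into itself is extended by the identity to all of \<open>nat\<close>, as is
  done for permutations by \<^const>\<open>permutes\<close>.  Then composition is \<^const>\<open>comp\<close>, the unit is
  \<^const>\<open>id\<close>, and the symmetric group on \<open>i \<le> r\<close> letters is literally contained in the one
  on \<open>r\<close> letters, which is literally contained in \<open>tau_bar r\<close>.\<close>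

definition tau_bar :: "nat \<Rightarrow> (nat \<Rightarrow> nat) set" where
  "tau_bar r = {\<alpha>. \<alpha> 0 = 0 \<and> (\<forall>x\<le>r. \<alpha> x \<le> r) \<and> (\<forall>x>r. \<alpha> x = x)}"

definition sym_maps :: "nat \<Rightarrow> (nat \<Rightarrow> nat) set" where
  "sym_maps i = {\<sigma>. \<sigma> permutes {1..i}}"

definition rank :: "nat \<Rightarrow> (nat \<Rightarrow> nat) \<Rightarrow> nat" where
  "rank r \<alpha> = card (\<alpha> ` {0..r} - {0})"

type_synonym 'k monalg = "(nat \<Rightarrow> nat) \<Rightarrow> 'k"

text \<open>\<open>k[S]\<close> for a finite monoid \<open>S\<close> of maps; an element is its coefficient function.\<close>

definition monoid_algebra :: "(nat \<Rightarrow> nat) set \<Rightarrow> ('k::field, 'k monalg) module" where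
  "monoid_algebra S =
     \<lparr>carrier = {a. \<forall>\<alpha>. \<alpha> \<notin> S \<longrightarrow> a \<alpha> = 0},
      monoid.mult = (\<lambda>a b \<gamma>. \<Sum>(\<alpha>, \<beta>) \<in> {(\<alpha>, \<beta>) \<in> S \<times> S. \<alpha> \<circ> \<beta> = \<gamma>}. a \<alpha> * b \<beta>),
      one = (\<lambda>\<gamma>. if \<gamma> = id then 1 else 0),
      zero = (\<lambda>\<gamma>. 0),
      add = (\<lambda>a b \<gamma>. a \<gamma> + b \<gamma>),
      smult = (\<lambda>c a \<gamma>. c * a \<gamma>)\<rparr>"

definition basis_map :: "(nat \<Rightarrow> nat) \<Rightarrow> 'k::field monalg" where
  "basis_map \<alpha> = (\<lambda>\<gamma>. if \<gamma> = \<alpha> then 1 else 0)"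

text \<open>The correspondence between irreducible \<open>k[S]\<close>-modules \<open>N\<close> and irreducible modules \<open>W\<close>
  over the group algebras of the symmetric groups on \<open>i\<close> letters: \<open>i\<close> is the least rank of an
  element of \<open>S\<close> not annihilating \<open>N\<close>, and \<open>W\<close> is \<open>e N\<close> for an idempotent \<open>e \<in> S\<close> with image
  \<open>{0..i}\<close>.  Permutations of \<open>{1..i}\<close> map \<open>e N\<close> to itself, since \<open>e \<circ> \<sigma> \<circ> e = \<sigma> \<circ> e\<close>; so
  \<open>e N\<close> carries the restricted action.\<close>

definition apex_corresponds ::
    "nat \<Rightarrow> (nat \<Rightarrow> nat) set \<Rightarrow> ('k::field monalg, 'v) module \<Rightarrow>
     nat \<Rightarrow> ('k monalg, 'w) module \<Rightarrow> bool" where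
  "apex_corresponds r S N i W \<longleftrightarrow>
     (\<forall>\<alpha>\<in>S. rank r \<alpha> < i \<longrightarrow> (\<forall>x\<in>carrier N. basis_map \<alpha> \<odot>\<^bsub>N\<^esub> x = \<zero>\<^bsub>N\<^esub>)) \<and>
     (\<exists>e\<in>S. e \<circ> e = e \<and> e ` {0..r} = {0..i} \<and>
        (\<exists>x\<in>carrier N. basis_map e \<odot>\<^bsub>N\<^esub> x \<noteq> \<zero>\<^bsub>N\<^esub>) \<and>
        module_isomorphic (monoid_algebra (sym_maps i) :: ('k, 'k monalg) module)
          (with_action N ((\<lambda>x. basis_map e \<odot>\<^bsub>N\<^esub> x) ` carrier N) (smult N)) W)"


section \<open>Generalized Schur algebras\<close>

text \<open>Compositions are lists, so parts and blocks are indexed from 0.\<close>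

definition compositions :: "nat \<Rightarrow> nat \<Rightarrow> nat list set" where
  "compositions n r = {l. length l = n \<and> sum_list l = r}"

definition partitions :: "nat \<Rightarrow> nat \<Rightarrow> nat list set" where
  "partitions n r = {l \<in> compositions n r. sorted_wrt (\<ge>) l}"

definition block :: "nat list \<Rightarrow> nat \<Rightarrow> nat set" where
  "block l i = {sum_list (take i l) <.. sum_list (take (Suc i) l)}"

definition young :: "nat list \<Rightarrow> (nat \<Rightarrow> nat) set" where
  "young l = {\<sigma> \<in> sym_maps (sum_list l). \<forall>i<length l. \<sigma> ` block l i = block l i}"

definition dcoset :: "nat list \<Rightarrow> (nat \<Rightarrow> nat) \<Rightarrow> nat list \<Rightarrow> (nat \<Rightarrow> nat) set" where
  "dcoset l \<alpha> m = {\<sigma> \<circ> \<alpha> \<circ> \<pi> | \<sigma> \<pi>. \<sigma> \<in> young l \<and> \<pi> \<in> young m}"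

definition dcosets :: "(nat \<Rightarrow> nat) set \<Rightarrow> nat list \<Rightarrow> nat list \<Rightarrow> (nat \<Rightarrow> nat) set set" where
  "dcosets S l m = (\<lambda>\<alpha>. dcoset l \<alpha> m) ` S"

datatype side = LeftSide | RightSide

fun stab :: "side \<Rightarrow> nat list \<Rightarrow> (nat \<Rightarrow> nat) \<Rightarrow> nat list \<Rightarrow> (nat \<Rightarrow> nat) set" where
  "stab LeftSide l \<alpha> m = {\<pi> \<in> young m. \<exists>\<sigma>\<in>young l. \<alpha> \<circ> \<pi> = \<sigma> \<circ> \<alpha>}"
| "stab RightSide l \<alpha> m = {\<sigma> \<in> young l. \<exists>\<pi>\<in>young m. \<sigma> \<circ> \<alpha> = \<alpha> \<circ> \<pi>}"

text \<open>The two numbers below do not depend on the representatives of the double cosets.\<close>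

definition rep :: "(nat \<Rightarrow> nat) set \<Rightarrow> nat \<Rightarrow> nat" where
  "rep D = (SOME \<alpha>. \<alpha> \<in> D)"

definition stab_num :: "side \<Rightarrow> nat list \<Rightarrow> (nat \<Rightarrow> nat) set \<Rightarrow> nat list \<Rightarrow> nat" where
  "stab_num X l D m = card (stab X l (rep D) m)"

definition prod_num ::
    "nat list \<Rightarrow> (nat \<Rightarrow> nat) set \<Rightarrow> (nat \<Rightarrow> nat) set \<Rightarrow> (nat \<Rightarrow> nat) set \<Rightarrow> nat" where
  "prod_num v D1 D2 D = card {\<rho> \<in> young v. rep D1 \<circ> \<rho> \<circ> rep D2 \<in> D}"

text \<open>The structure constants are nonnegative integers; in characteristic zero the quotient may
  be formed in the field.\<close>

definition struct_const ::
    "side \<Rightarrow> nat list \<Rightarrow> nat list \<Rightarrow> nat list \<Rightarrow>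
     (nat \<Rightarrow> nat) set \<Rightarrow> (nat \<Rightarrow> nat) set \<Rightarrow> (nat \<Rightarrow> nat) set \<Rightarrow> 'k::field_char_0" where
  "struct_const X l v m D1 D2 D =
     of_nat (stab_num X l D m * prod_num v D1 D2 D) /
     of_nat (stab_num X l D1 v * stab_num X v D2 m)"

type_synonym schur_index = "nat list \<times> (nat \<Rightarrow> nat) set \<times> nat list"
type_synonym 'k schur = "schur_index \<Rightarrow> 'k"

definition schur_basis :: "nat \<Rightarrow> nat \<Rightarrow> (nat \<Rightarrow> nat) set \<Rightarrow> schur_index set" where
  "schur_basis n r S =
     {(l, D, m). l \<in> compositions n r \<and> m \<in> compositions n r \<and> D \<in> dcosets S l m}"

text \<open>An element is its coefficient function with respect to the basis \<open>f(l, D, m)\<close>, and the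
  product is the bilinear extension of the product of basis elements.\<close>

definition gen_schur ::
    "side \<Rightarrow> nat \<Rightarrow> nat \<Rightarrow> (nat \<Rightarrow> nat) set \<Rightarrow> ('k::field_char_0, 'k schur) module" where
  "gen_schur X n r S =
     \<lparr>carrier = {a. \<forall>x. x \<notin> schur_basis n r S \<longrightarrow> a x = 0},
      monoid.mult = (\<lambda>a b (l, D, m).
        if (l, D, m) \<in> schur_basis n r S
        then \<Sum>v\<in>compositions n r. \<Sum>D1\<in>dcosets S l v. \<Sum>D2\<in>dcosets S v m.
               a (l, D1, v) * b (v, D2, m) * struct_const X l v m D1 D2 D
        else 0),
      one = (\<lambda>x. \<Sum>l\<in>compositions n r. if x = (l, dcoset l id l, l) then 1 else 0),
      zero = (\<lambda>x. 0),
      add = (\<lambda>a b x. a x + b x),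
      smult = (\<lambda>c a x. c * a x)\<rparr>"

definition idem :: "nat list \<Rightarrow> 'k::field_char_0 schur" where
  "idem l = (\<lambda>x. if x = (l, dcoset l id l, l) then 1 else 0)"


section \<open>Levels\<close>

definition plus_part :: "nat list \<Rightarrow> nat list" where
  "plus_part l = rev (sort l)"

definition comp_equiv :: "nat list \<Rightarrow> nat list \<Rightarrow> bool" where
  "comp_equiv m l \<longleftrightarrow> plus_part m = plus_part l"

text \<open>\<^const>\<open>lex\<close> compares lists of equal length at the first position where they differ.\<close>

definition comp_less :: "nat list \<Rightarrow> nat list \<Rightarrow> bool" where
  "comp_less m l \<longleftrightarrow> (plus_part m, plus_part l) \<in> lex less_than"

definition e_below :: "nat \<Rightarrow> nat \<Rightarrow> nat list \<Rightarrow> 'k::field_char_0 schur" where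
  "e_below n r l = (\<lambda>x. \<Sum>m\<in>{m \<in> compositions n r. comp_less m l}. idem m x)"

definition e_upto :: "nat \<Rightarrow> nat \<Rightarrow> nat list \<Rightarrow> 'k::field_char_0 schur" where
  "e_upto n r l =
     (\<lambda>x. e_below n r l x + (\<Sum>m\<in>{m \<in> compositions n r. comp_equiv m l}. idem m x))"

definition at_level ::
    "nat \<Rightarrow> nat \<Rightarrow> nat list \<Rightarrow> ('k::field_char_0 schur, 'v) module \<Rightarrow> bool" where
  "at_level n r l I \<longleftrightarrow>
     (\<exists>x\<in>carrier I. e_upto n r l \<odot>\<^bsub>I\<^esub> x \<noteq> \<zero>\<^bsub>I\<^esub>) \<and>
     (\<forall>x\<in>carrier I. e_below n r l \<odot>\<^bsub>I\<^esub> x = \<zero>\<^bsub>I\<^esub>)"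

definition corner :: "('k, 'b) module \<Rightarrow> 'b \<Rightarrow> ('k, 'b) module" where
  "corner B e = B\<lparr>carrier := {e \<otimes>\<^bsub>B\<^esub> b \<otimes>\<^bsub>B\<^esub> e | b. b \<in> carrier B}, one := e\<rparr>"

text \<open>The library quotient ring \<^const>\<open>FactRing\<close> has no scalar multiplication; it is added in
  the style of \<^const>\<open>rcoset_mult\<close>.\<close>

definition quot_algebra :: "('k, 'b) module \<Rightarrow> 'b set \<Rightarrow> ('k, 'b set) module" where
  "quot_algebra A J =
     \<lparr>carrier = carrier (A Quot J), monoid.mult = monoid.mult (A Quot J),
      one = \<one>\<^bsub>A Quot J\<^esub>, zero = \<zero>\<^bsub>A Quot J\<^esub>, add = add (A Quot J),
      smult = (\<lambda>c Y. \<Union>y\<in>Y. J +>\<^bsub>A\<^esub> (c \<odot>\<^bsub>A\<^esub> y))\<rparr>"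

text \<open>The algebra \<open>C\<^sup>l\<close>; the two-sided ideal generated by \<open>e\<close> is \<open>B e B\<close>.\<close>

definition level_algebra ::
    "('k::field_char_0, 'k schur) module \<Rightarrow> nat \<Rightarrow> nat \<Rightarrow> nat list \<Rightarrow> ('k, 'k schur set) module" where
  "level_algebra B n r l =
     quot_algebra (corner B (idem l))
       (carrier (corner B (idem l)) \<inter> Idl\<^bsub>B\<^esub> {e_below n r l})"

text \<open>For \<open>I\<close> at level \<open>l\<close>, the \<open>C\<^sup>l\<close>-module \<open>1\<^sub>l I\<close>, on which a residue class acts through any
  of its elements.\<close>

definition level_module :: "nat list \<Rightarrow> ('k::field_char_0 schur, 'v) module \<Rightarrow>
    ('k schur set, 'v) module" where
  "level_module l I =
     with_action I ((\<lambda>x. idem l \<odot>\<^bsub>I\<^esub> x) ` carrier I)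
       (\<lambda>Y x. (SOME c. c \<in> Y) \<odot>\<^bsub>I\<^esub> x)"

end

theory Submission
  imports Defs
begin

text \<open>Let \<open>R\<close> be a ring, \<open>e\<close> an idempotent of \<open>R\<close> and \<open>R'\<close> a ring which is a retract of \<open>e R e\<close>.
  Then \<open>M \<mapsto> e M\<close> is a bijection from the isomorphism classes of irreducible \<open>R\<close>-modules with
  \<open>e M \<noteq> 0\<close> on which the kernel of \<open>e R e \<rightarrow> R'\<close> acts trivially to those of irreducible
  \<open>R'\<close>-modules.  This applies twice.

  For the generalized Schur algebra take \<open>e = 1\<^sub>\<nu>\<close>.  In characteristic zero \<open>B\<close> embeds, after
  rescaling its basis, as the bi-invariant matrices over \<open>k[S]\<close> indexed by compositions.  The
  Young subgroup of \<open>\<nu>\<close> is trivial, so \<open>e B e\<close> is \<open>k[S]\<close>, and every \<open>1\<^sub>l\<close> factors through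
  \<open>\<nu>\<close>, so \<open>B e B = B\<close>.  Hence no irreducible module is killed by \<open>e\<close>, and the higher levels
  vanish.

  For \<open>k[S]\<close> take for \<open>e\<close> an idempotent map with image \<open>{0..i}\<close>.  The elements of rank \<open>i\<close> of
  \<open>e S e\<close> are the \<open>\<sigma> e\<close> with \<open>\<sigma>\<close> a permutation of \<open>{1..i}\<close>, so \<open>e k[S] e\<close> retracts onto the
  group algebra, with kernel spanned by the elements of smaller rank.\<close>

section \<open>Irreducible modules and idempotents\<close>

text \<open>The algebra \<open>gen_schur\<close> is given by structure constants alone, so that not
  even associativity is available at the start. After rescaling the basis by
  \<open>|G_m| / (n_X(D) |D|)\<close> these constants count factorizations
  \<open>\<gamma> = \<alpha> \<circ> \<beta>\<close> with factors in prescribed double cosets, for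
  both sides \<open>X\<close>; the ring laws of \<open>B\<close> are then inherited from composition
  of maps. Characteristic zero enters through division by the weights and by the orders of Young
  subgroups.

  For \<open>k[S]\<close> the corner is in general larger than the group algebra, hence a retraction
  instead of an isomorphism, and the side condition \<open>admissible\<close> on modules.

  A module is recovered from its corner without tensor products: an irreducible module is the ring
  modulo the annihilator of any nonzero vector, and for a vector of \<open>e M\<close> this
  annihilator can be read off from the corner.

  Since \<open>S\<close> contains all permutations, every rank \<open>i\<close> occurring in
  \<open>S\<close> is the rank of an idempotent of \<open>S\<close> with image
  \<open>{0..i}\<close>, and all such idempotents cut the same subspace out of a given
  \<open>k[S]\<close>-module; this makes the minimal rank a sufficient label.\<close>

context left_module
begin

lemma smult_l_null [simp]:
  assumes x: "x \<in> carrier M"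
  shows "\<zero> \<odot>\<^bsub>M\<^esub> x = \<zero>\<^bsub>M\<^esub>"
proof -
  have "\<zero> \<odot>\<^bsub>M\<^esub> x \<oplus>\<^bsub>M\<^esub> \<zero> \<odot>\<^bsub>M\<^esub> x = \<zero> \<odot>\<^bsub>M\<^esub> x"
    using smult_l_distr[of \<zero> \<zero> x] x by simp
  then show ?thesis
    using x by (metis M.add.r_cancel_one' R.zero_closed smult_closed)
qed

lemma smult_r_null [simp]:
  assumes a: "a \<in> carrier R"
  shows "a \<odot>\<^bsub>M\<^esub> \<zero>\<^bsub>M\<^esub> = \<zero>\<^bsub>M\<^esub>"
proof -
  have "a \<odot>\<^bsub>M\<^esub> \<zero>\<^bsub>M\<^esub> \<oplus>\<^bsub>M\<^esub> a \<odot>\<^bsub>M\<^esub> \<zero>\<^bsub>M\<^esub> = a \<odot>\<^bsub>M\<^esub> \<zero>\<^bsub>M\<^esub>"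
    using smult_r_distr[of a "\<zero>\<^bsub>M\<^esub>" "\<zero>\<^bsub>M\<^esub>"] a by simp
  then show ?thesis
    using a by (metis M.add.r_cancel_one' M.zero_closed smult_closed)
qed

lemma smult_l_minus:
  assumes "a \<in> carrier R" "x \<in> carrier M"
  shows "(\<ominus> a) \<odot>\<^bsub>M\<^esub> x = \<ominus>\<^bsub>M\<^esub> (a \<odot>\<^bsub>M\<^esub> x)"
proof -
  have "(\<ominus> a) \<odot>\<^bsub>M\<^esub> x \<oplus>\<^bsub>M\<^esub> a \<odot>\<^bsub>M\<^esub> x = \<zero>\<^bsub>M\<^esub>"
    using smult_l_distr[of "\<ominus> a" a x] assms by (simp add: R.l_neg)
  then show ?thesis
    using assms by (simp add: M.minus_equality)
qed

lemma minus_smult_eq_zero_iff: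
  assumes "a \<in> carrier R" "b \<in> carrier R" "x \<in> carrier M"
  shows "(a \<ominus> b) \<odot>\<^bsub>M\<^esub> x = \<zero>\<^bsub>M\<^esub> \<longleftrightarrow> a \<odot>\<^bsub>M\<^esub> x = b \<odot>\<^bsub>M\<^esub> x"
proof -
  have "(a \<ominus> b) \<odot>\<^bsub>M\<^esub> x = a \<odot>\<^bsub>M\<^esub> x \<oplus>\<^bsub>M\<^esub> \<ominus>\<^bsub>M\<^esub> (b \<odot>\<^bsub>M\<^esub> x)"
    using assms by (simp add: a_minus_def smult_l_distr smult_l_minus)
  moreover have "u \<oplus>\<^bsub>M\<^esub> \<ominus>\<^bsub>M\<^esub> v = \<zero>\<^bsub>M\<^esub> \<longleftrightarrow> u = v"
    if "u \<in> carrier M" "v \<in> carrier M" for u v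
    using that M.minus_equality[of u "\<ominus>\<^bsub>M\<^esub> v"] by (auto simp: M.r_neg)
  ultimately show ?thesis using assms by simp
qed

lemma smult_r_minus:
  assumes "a \<in> carrier R" "x \<in> carrier M"
  shows "a \<odot>\<^bsub>M\<^esub> (\<ominus>\<^bsub>M\<^esub> x) = \<ominus>\<^bsub>M\<^esub> (a \<odot>\<^bsub>M\<^esub> x)"
proof -
  have "a \<odot>\<^bsub>M\<^esub> (\<ominus>\<^bsub>M\<^esub> x) \<oplus>\<^bsub>M\<^esub> a \<odot>\<^bsub>M\<^esub> x = \<zero>\<^bsub>M\<^esub>"
    using smult_r_distr[of a "\<ominus>\<^bsub>M\<^esub> x" x] assms by (simp add: M.l_neg)
  then show ?thesis
    using assms by (simp add: M.minus_equality)
qed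

lemma cyclic_submodule:
  assumes x: "x \<in> carrier M"
  shows "submodule ((\<lambda>a. a \<odot>\<^bsub>M\<^esub> x) ` carrier R) R M"
proof (rule submodule.intro)
  show "submodule_axioms ((\<lambda>a. a \<odot>\<^bsub>M\<^esub> x) ` carrier R) R M"
  proof
    fix a y assume "a \<in> carrier R" "y \<in> (\<lambda>a. a \<odot>\<^bsub>M\<^esub> x) ` carrier R"
    then show "a \<odot>\<^bsub>M\<^esub> y \<in> (\<lambda>a. a \<odot>\<^bsub>M\<^esub> x) ` carrier R"
      using x by (auto simp: smult_assoc1[symmetric])
  qed
  show "subgroup ((\<lambda>a. a \<odot>\<^bsub>M\<^esub> x) ` carrier R) (add_monoid M)"
  proof (rule M.add.subgroupI)
  fix u assume u: "u \<in> (\<lambda>a. a \<odot>\<^bsub>M\<^esub> x) ` carrier R"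
  then obtain a where a: "a \<in> carrier R" "u = a \<odot>\<^bsub>M\<^esub> x" by auto
  have "\<ominus>\<^bsub>M\<^esub> u = (\<ominus> a) \<odot>\<^bsub>M\<^esub> x"
    using a x by (simp add: smult_l_minus)
  then show "\<ominus>\<^bsub>M\<^esub> u \<in> (\<lambda>a. a \<odot>\<^bsub>M\<^esub> x) ` carrier R"
    using a by auto
  fix v assume "v \<in> (\<lambda>a. a \<odot>\<^bsub>M\<^esub> x) ` carrier R"
  then obtain b where b: "b \<in> carrier R" "v = b \<odot>\<^bsub>M\<^esub> x" by auto
  have "u \<oplus>\<^bsub>M\<^esub> v = (a \<oplus> b) \<odot>\<^bsub>M\<^esub> x"
    using a b x by (simp add: smult_l_distr)
  then show "u \<oplus>\<^bsub>M\<^esub> v \<in> (\<lambda>a. a \<odot>\<^bsub>M\<^esub> x) ` carrier R"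
    using a b by auto
  qed (use x in auto)
qed

end

section \<open>Irreducibility as transitivity on nonzero vectors; isomorphism of modules\<close>

lemma irreducible_moduleI:
  assumes lm: "left_module R M" and z: "z \<in> carrier M" "z \<noteq> \<zero>\<^bsub>M\<^esub>"
    and trans: "\<And>x y. x \<in> carrier M \<Longrightarrow> x \<noteq> \<zero>\<^bsub>M\<^esub> \<Longrightarrow> y \<in> carrier M \<Longrightarrow>
      \<exists>a\<in>carrier R. a \<odot>\<^bsub>M\<^esub> x = y"
  shows "irreducible_module R M"
  unfolding irreducible_module_def
proof (intro conjI allI impI)
  show "left_module R M" by fact
  show "carrier M \<noteq> {\<zero>\<^bsub>M\<^esub>}" using z by auto
  fix H assume H: "submodule H R M"
  then have sub: "subgroup H (add_monoid M)" and
    cl: "\<And>a x. a \<in> carrier R \<Longrightarrow> x \<in> H \<Longrightarrow> a \<odot>\<^bsub>M\<^esub> x \<in> H"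
    by (auto simp: submodule_def submodule_axioms_def)
  have 0: "\<zero>\<^bsub>M\<^esub> \<in> H" and HM: "H \<subseteq> carrier M"
    using sub subgroup.one_closed subgroup.subset by fastforce+
  show "H = {\<zero>\<^bsub>M\<^esub>} \<or> H = carrier M"
  proof (cases "H = {\<zero>\<^bsub>M\<^esub>}")
    case False
    with 0 obtain x where x: "x \<in> H" "x \<noteq> \<zero>\<^bsub>M\<^esub>" by auto
    have "carrier M \<subseteq> H"
    proof
      fix y assume "y \<in> carrier M"
      with trans[of x y] x HM obtain a where "a \<in> carrier R" "a \<odot>\<^bsub>M\<^esub> x = y" by blast
      with cl x show "y \<in> H" by blast
    qed
    with HM show ?thesis by auto
  qed simp
qed

lemma irreducible_module_left_module: "irreducible_module R M \<Longrightarrow> left_module R M"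
  by (simp add: irreducible_module_def)

lemma irreducible_module_nonzero:
  assumes "irreducible_module R M"
  obtains z where "z \<in> carrier M" "z \<noteq> \<zero>\<^bsub>M\<^esub>"
proof -
  interpret left_module R M
    using assms by (rule irreducible_module_left_module)
  show ?thesis
    using assms that M.zero_closed unfolding irreducible_module_def by auto
qed

text \<open>The submodule \<open>R x\<close> contains \<open>x\<close>, because \<open>R\<close> has
  a unit, and so is everything. Together with \<open>irreducible_moduleI\<close> this is the working
  form of irreducibility: all later arguments move vectors and never handle submodules.\<close>

lemma irreducible_module_transitive:
  assumes irr: "irreducible_module R M"
    and x: "x \<in> carrier M" "x \<noteq> \<zero>\<^bsub>M\<^esub>" and y: "y \<in> carrier M"
  obtains a where "a \<in> carrier R" "a \<odot>\<^bsub>M\<^esub> x = y"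
proof -
  interpret left_module R M
    using irr by (rule irreducible_module_left_module)
  have "x \<in> (\<lambda>a. a \<odot>\<^bsub>M\<^esub> x) ` carrier R"
    using x by (auto intro: image_eqI[of _ _ "\<one>\<^bsub>R\<^esub>"])
  with x cyclic_submodule[OF x(1)] irr have "(\<lambda>a. a \<odot>\<^bsub>M\<^esub> x) ` carrier R = carrier M"
    unfolding irreducible_module_def by blast
  with y that show ?thesis by (metis image_iff)
qed

lemma module_isomorphic_refl: "module_isomorphic R M M"
  unfolding module_isomorphic_def by (intro exI[of _ id]) auto

lemma module_isomorphic_sym:
  assumes M: "left_module R M" and iso: "module_isomorphic R M N"
  shows "module_isomorphic R N M"
proof -
  interpret left_module R M by fact
  obtain h where bij: "bij_betw h (carrier M) (carrier N)"
    and add: "\<And>x y. x \<in> carrier M \<Longrightarrow> y \<in> carrier M \<Longrightarrow> h (x \<oplus>\<^bsub>M\<^esub> y) = h x \<oplus>\<^bsub>N\<^esub> h y"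
    and smult: "\<And>a x. a \<in> carrier R \<Longrightarrow> x \<in> carrier M \<Longrightarrow> h (a \<odot>\<^bsub>M\<^esub> x) = a \<odot>\<^bsub>N\<^esub> h x"
    using iso unfolding module_isomorphic_def by blast
  define k where "k = inv_into (carrier M) h"
  have k: "k y \<in> carrier M" "h (k y) = y" if "y \<in> carrier N" for y
    using bij that by (auto simp: k_def bij_betw_def inv_into_into f_inv_into_f)
  have kh: "k (h x) = x" if "x \<in> carrier M" for x
    using bij that by (simp add: k_def bij_betw_def)
  have "bij_betw k (carrier N) (carrier M)"
    using bij unfolding k_def by (rule bij_betw_inv_into)
  moreover have "k (x \<oplus>\<^bsub>N\<^esub> y) = k x \<oplus>\<^bsub>M\<^esub> k y" if "x \<in> carrier N" "y \<in> carrier N" for x y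
    using add[of "k x" "k y"] k that kh[of "k x \<oplus>\<^bsub>M\<^esub> k y"] by simp
  moreover have "k (a \<odot>\<^bsub>N\<^esub> x) = a \<odot>\<^bsub>M\<^esub> k x" if "a \<in> carrier R" "x \<in> carrier N" for a x
    using smult[of a "k x"] k that kh[of "a \<odot>\<^bsub>M\<^esub> k x"] by simp
  ultimately show ?thesis
    unfolding module_isomorphic_def by blast
qed

lemma module_isomorphic_trans:
  assumes "module_isomorphic R L M" and "module_isomorphic R M N"
  shows "module_isomorphic R L N"
proof -
  obtain h where h: "bij_betw h (carrier L) (carrier M)"
      "\<forall>x\<in>carrier L. \<forall>y\<in>carrier L. h (x \<oplus>\<^bsub>L\<^esub> y) = h x \<oplus>\<^bsub>M\<^esub> h y"
      "\<forall>a\<in>carrier R. \<forall>x\<in>carrier L. h (a \<odot>\<^bsub>L\<^esub> x) = a \<odot>\<^bsub>M\<^esub> h x"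
    using assms(1) unfolding module_isomorphic_def by blast
  obtain k where k: "bij_betw k (carrier M) (carrier N)"
      "\<forall>x\<in>carrier M. \<forall>y\<in>carrier M. k (x \<oplus>\<^bsub>M\<^esub> y) = k x \<oplus>\<^bsub>N\<^esub> k y"
      "\<forall>a\<in>carrier R. \<forall>x\<in>carrier M. k (a \<odot>\<^bsub>M\<^esub> x) = a \<odot>\<^bsub>N\<^esub> k x"
    using assms(2) unfolding module_isomorphic_def by blast
  have "\<And>x. x \<in> carrier L \<Longrightarrow> h x \<in> carrier M"
    using h(1) by (simp add: bij_betwE)
  then show ?thesis
    unfolding module_isomorphic_def using h k
    by (intro exI[of _ "k \<circ> h"]) (auto intro: bij_betw_trans)
qed

lemma with_action_simps [simp]:
  "carrier (with_action M V act) = V"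
  "zero (with_action M V act) = \<zero>\<^bsub>M\<^esub>"
  "add (with_action M V act) = add M"
  "smult (with_action M V act) = act"
  by (simp_all add: with_action_def)

lemma abelian_group_with_action:
  fixes M :: "('a, 'v) module"
  assumes "abelian_group M" and V: "V \<subseteq> carrier M" and "\<zero>\<^bsub>M\<^esub> \<in> V"
    and "\<And>x y. x \<in> V \<Longrightarrow> y \<in> V \<Longrightarrow> x \<oplus>\<^bsub>M\<^esub> y \<in> V"
    and "\<And>x. x \<in> V \<Longrightarrow> \<ominus>\<^bsub>M\<^esub> x \<in> V"
  shows "abelian_group (with_action M V act)"
proof -
  interpret M: abelian_group M by fact
  have V': "\<And>x. x \<in> V \<Longrightarrow> x \<in> carrier M" using V by blast
  show ?thesis
  proof (rule abelian_groupI)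
    fix x assume "x \<in> carrier (with_action M V act)"
    then show "\<exists>y\<in>carrier (with_action M V act).
        y \<oplus>\<^bsub>with_action M V act\<^esub> x = \<zero>\<^bsub>with_action M V act\<^esub>"
      using assms V' by (auto intro!: bexI[of _ "\<ominus>\<^bsub>M\<^esub> x"] simp: M.l_neg)
    fix y assume "y \<in> carrier (with_action M V act)"
    with \<open>x \<in> carrier (with_action M V act)\<close>
    show "x \<oplus>\<^bsub>with_action M V act\<^esub> y = y \<oplus>\<^bsub>with_action M V act\<^esub> x"
      using V' by (auto simp: M.a_comm)
  qed (use assms V' in \<open>auto simp: M.a_assoc\<close>)
qed

section \<open>The quotient of a ring by a left ideal, as a left module\<close>

locale left_ideal = ring R for R (structure) +
  fixes L
  assumes sub: "L \<subseteq> carrier R" and zero_in: "\<zero> \<in> L"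
    and add_in: "\<And>x y. x \<in> L \<Longrightarrow> y \<in> L \<Longrightarrow> x \<oplus> y \<in> L"
    and mult_in: "\<And>a x. a \<in> carrier R \<Longrightarrow> x \<in> L \<Longrightarrow> a \<otimes> x \<in> L"
begin

text \<open>No representative is chosen: \<open>smult\<close> takes the union over all of them,
  which collapses to a single coset once independence of the representative is known. The
  multiplicative fields carry no meaning for a module.\<close>

definition quot_module :: "('a, 'a set) module" where
  "quot_module =
     \<lparr>carrier = a_rcosets L, monoid.mult = undefined, one = undefined, zero = L,
      add = set_add R, smult = (\<lambda>a Y. \<Union>y\<in>Y. L +> (a \<otimes> y))\<rparr>"

lemma minus_in: "x \<in> L \<Longrightarrow> \<ominus> x \<in> L"
  using mult_in[of "\<ominus> \<one>" x] sub by (simp add: l_minus subset_iff)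

sublocale L: abelian_subgroup L R
proof (rule abelian_subgroupI3)
  show "additive_subgroup L R"
    by (rule additive_subgroupI, rule add.subgroupI)
      (use sub zero_in add_in minus_in in \<open>auto simp: a_inv_def[symmetric]\<close>)
qed (rule is_abelian_group)

lemma rcos_eq_iff:
  assumes "x \<in> carrier R" "y \<in> carrier R"
  shows "L +> x = L +> y \<longleftrightarrow> x \<ominus> y \<in> L"
  using assms L.a_rcos_module_minus[OF ring_axioms, of y x] L.a_repr_independence'[of x y]
    L.a_repr_independenceD[of x y] by (metis (no_types))

lemma rcos_zero: "L +> \<zero> = L"
  using L.a_rcos_const[OF zero_in] .

lemma quot_module_carrier: "carrier quot_module = (\<lambda>x. L +> x) ` carrier R"
  by (auto simp: quot_module_def A_RCOSETS_def')

lemma quot_module_zero: "\<zero>\<^bsub>quot_module\<^esub> = L +> \<zero>"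
  by (simp add: quot_module_def rcos_zero)

lemma quot_module_add:
  "x \<in> carrier R \<Longrightarrow> y \<in> carrier R \<Longrightarrow>
    (L +> x) \<oplus>\<^bsub>quot_module\<^esub> (L +> y) = L +> (x \<oplus> y)"
  by (simp add: quot_module_def L.a_rcos_sum)

text \<open>Two representatives differ by an element of \<open>L\<close>, and left multiplication by
  \<open>a\<close> keeps that difference in \<open>L\<close>; the union therefore runs over a
  constant family.\<close>

lemma quot_module_smult:
  assumes a: "a \<in> carrier R" and x: "x \<in> carrier R"
  shows "a \<odot>\<^bsub>quot_module\<^esub> (L +> x) = L +> (a \<otimes> x)"
proof -
  have *: "L +> (a \<otimes> y) = L +> (a \<otimes> x)" if y: "y \<in> L +> x" for y
  proof -
    have yR: "y \<in> carrier R"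
      using y x L.a_elemrcos_carrier by blast
    have "y \<ominus> x \<in> L"
      using y x yR L.a_rcos_module_minus[OF ring_axioms] by blast
    then have "a \<otimes> (y \<ominus> x) \<in> L" using a by (rule mult_in[rotated])
    then have "a \<otimes> y \<ominus> a \<otimes> x \<in> L"
      using a x yR by (simp add: a_minus_def r_distr r_minus)
    then show ?thesis using rcos_eq_iff a x yR by simp
  qed
  have "x \<in> L +> x" using x by (rule L.a_rcos_self)
  moreover have "a \<odot>\<^bsub>quot_module\<^esub> (L +> x) = (\<Union>y\<in>L +> x. L +> (a \<otimes> y))"
    by (simp add: quot_module_def)
  moreover have "\<dots> = (\<Union>y\<in>L +> x. L +> (a \<otimes> x))"
    by (intro SUP_cong refl *)
  ultimately show ?thesis by auto
qed

lemma quot_module_left_module: "left_module R quot_module"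
proof (intro left_module.intro left_module_axioms.intro)
  show "abelian_group quot_module"
  proof (rule abelian_groupI)
    fix X assume "X \<in> carrier quot_module"
    then obtain x where "x \<in> carrier R" "X = L +> x"
      by (auto simp: quot_module_carrier)
    then show "\<exists>Y\<in>carrier quot_module. Y \<oplus>\<^bsub>quot_module\<^esub> X = \<zero>\<^bsub>quot_module\<^esub>"
      by (intro bexI[of _ "L +> \<ominus> x"])
        (auto simp: quot_module_carrier quot_module_zero quot_module_add l_neg)
    fix Y assume "Y \<in> carrier quot_module"
    then obtain y where "y \<in> carrier R" "Y = L +> y"
      by (auto simp: quot_module_carrier)
    with \<open>x \<in> carrier R\<close> \<open>X = L +> x\<close>
    show "X \<oplus>\<^bsub>quot_module\<^esub> Y = Y \<oplus>\<^bsub>quot_module\<^esub> X"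
      by (simp add: quot_module_add a_comm)
  qed (auto simp: quot_module_carrier quot_module_zero quot_module_add a_assoc)
  show "ring R" by (rule ring_axioms)
  fix a X assume a: "a \<in> carrier R" and "X \<in> carrier quot_module"
  then obtain x where x: "x \<in> carrier R" "X = L +> x"
    by (auto simp: quot_module_carrier)
  with a show "a \<odot>\<^bsub>quot_module\<^esub> X \<in> carrier quot_module"
    by (simp add: quot_module_carrier quot_module_smult)
  fix b assume b: "b \<in> carrier R"
  show "(a \<oplus> b) \<odot>\<^bsub>quot_module\<^esub> X = a \<odot>\<^bsub>quot_module\<^esub> X \<oplus>\<^bsub>quot_module\<^esub> b \<odot>\<^bsub>quot_module\<^esub> X"
    using a b x by (simp add: quot_module_add quot_module_smult l_distr)
  show "(a \<otimes> b) \<odot>\<^bsub>quot_module\<^esub> X = a \<odot>\<^bsub>quot_module\<^esub> (b \<odot>\<^bsub>quot_module\<^esub> X)"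
    using a b x by (simp add: quot_module_smult m_assoc)
next
  fix X assume "X \<in> carrier quot_module"
  then show "\<one> \<odot>\<^bsub>quot_module\<^esub> X = X"
    by (auto simp: quot_module_carrier quot_module_smult)
next
  fix a X Y assume a: "a \<in> carrier R" and "X \<in> carrier quot_module" "Y \<in> carrier quot_module"
  then obtain x y where "x \<in> carrier R" "X = L +> x" "y \<in> carrier R" "Y = L +> y"
    by (auto simp: quot_module_carrier)
  with a show "a \<odot>\<^bsub>quot_module\<^esub> (X \<oplus>\<^bsub>quot_module\<^esub> Y) =
      a \<odot>\<^bsub>quot_module\<^esub> X \<oplus>\<^bsub>quot_module\<^esub> a \<odot>\<^bsub>quot_module\<^esub> Y"
    by (simp add: quot_module_add quot_module_smult r_distr)
qed

end

section \<open>Retracts of a corner ring and corners of modules\<close>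

text \<open>Here \<open>g\<close> embeds \<open>R'\<close> in the corner \<open>e R e\<close> with
  unit \<open>e\<close>, and \<open>p\<close> retracts the corner onto it. The embedding makes
  \<open>R'\<close> act on \<open>e M\<close>; the kernel of \<open>p\<close> says which corner
  elements have to act as zero. The laws of \<open>p\<close> are demanded on the corner only, so
  \<open>p\<close> may be arbitrary elsewhere, as an inverse function is outside its range.\<close>

locale corner_retract = R: ring R + R': ring R'
  for R :: "('a, 'm) ring_scheme" (structure) and R' :: "('b, 'n) ring_scheme" +
  fixes e :: 'a and g :: "'b \<Rightarrow> 'a" and p :: "'a \<Rightarrow> 'b"
  assumes e_closed [simp]: "e \<in> carrier R"
    and e_idem [simp]: "e \<otimes> e = e"
    and g_closed [simp]: "b \<in> carrier R' \<Longrightarrow> g b \<in> carrier R"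
    and g_left [simp]: "b \<in> carrier R' \<Longrightarrow> e \<otimes> g b = g b"
    and g_right [simp]: "b \<in> carrier R' \<Longrightarrow> g b \<otimes> e = g b"
    and g_one: "g \<one>\<^bsub>R'\<^esub> = e"
    and g_add: "b \<in> carrier R' \<Longrightarrow> b' \<in> carrier R' \<Longrightarrow> g (b \<oplus>\<^bsub>R'\<^esub> b') = g b \<oplus> g b'"
    and g_mult: "b \<in> carrier R' \<Longrightarrow> b' \<in> carrier R' \<Longrightarrow> g (b \<otimes>\<^bsub>R'\<^esub> b') = g b \<otimes> g b'"
    and p_closed: "a \<in> carrier R \<Longrightarrow> e \<otimes> a = a \<Longrightarrow> a \<otimes> e = a \<Longrightarrow> p a \<in> carrier R'"
    and p_add: "\<lbrakk>a \<in> carrier R; e \<otimes> a = a; a \<otimes> e = a;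
        a' \<in> carrier R; e \<otimes> a' = a'; a' \<otimes> e = a'\<rbrakk> \<Longrightarrow> p (a \<oplus> a') = p a \<oplus>\<^bsub>R'\<^esub> p a'"
    and p_mult: "\<lbrakk>a \<in> carrier R; e \<otimes> a = a; a \<otimes> e = a;
        a' \<in> carrier R; e \<otimes> a' = a'; a' \<otimes> e = a'\<rbrakk> \<Longrightarrow> p (a \<otimes> a') = p a \<otimes>\<^bsub>R'\<^esub> p a'"
    and p_g [simp]: "b \<in> carrier R' \<Longrightarrow> p (g b) = b"
begin

definition in_corner :: "'a \<Rightarrow> bool" where
  "in_corner a \<longleftrightarrow> a \<in> carrier R \<and> e \<otimes> a = a \<and> a \<otimes> e = a"

definition cut :: "'a \<Rightarrow> 'a" where
  "cut a = e \<otimes> a \<otimes> e"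

definition corner_carrier :: "('a, 'v) module \<Rightarrow> 'v set" where
  "corner_carrier M = (\<lambda>x. e \<odot>\<^bsub>M\<^esub> x) ` carrier M"

text \<open>The action of the corner on \<open>e M\<close> factors through \<open>p\<close>.
  Equivalently a corner element \<open>a\<close> acts on \<open>e M\<close> like
  \<open>g (p a)\<close>, so that the \<open>R'\<close>-module \<open>e M\<close> remembers the
  whole action of the corner.\<close>

definition admissible :: "('a, 'v) module \<Rightarrow> bool" where
  "admissible M \<longleftrightarrow>
     (\<forall>a x. in_corner a \<longrightarrow> p a = \<zero>\<^bsub>R'\<^esub> \<longrightarrow> x \<in> corner_carrier M \<longrightarrow> a \<odot>\<^bsub>M\<^esub> x = \<zero>\<^bsub>M\<^esub>)"

lemma e_e_mult [simp]: "a \<in> carrier R \<Longrightarrow> e \<otimes> (e \<otimes> a) = e \<otimes> a"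
  by (simp add: R.m_assoc[symmetric])

lemma in_corner_cut [simp]: "a \<in> carrier R \<Longrightarrow> in_corner (cut a)"
  by (simp add: in_corner_def cut_def R.m_assoc)

lemma in_corner_g [simp]: "b \<in> carrier R' \<Longrightarrow> in_corner (g b)"
  by (simp add: in_corner_def)

lemma in_corner_e [simp]: "in_corner e"
  by (simp add: in_corner_def)

lemma in_corner_add [simp]: "in_corner a \<Longrightarrow> in_corner c \<Longrightarrow> in_corner (a \<oplus> c)"
  by (simp add: in_corner_def R.l_distr R.r_distr)

lemma in_corner_minus [simp]: "in_corner a \<Longrightarrow> in_corner (\<ominus> a)"
  by (simp add: in_corner_def R.l_minus R.r_minus)

lemma in_corner_zero [simp]: "in_corner \<zero>"
  by (simp add: in_corner_def)

lemma in_corner_carrier [simp]: "in_corner a \<Longrightarrow> a \<in> carrier R"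
  unfolding in_corner_def by blast

lemma in_corner_left [simp]: "in_corner a \<Longrightarrow> e \<otimes> a = a"
  unfolding in_corner_def by blast

lemma in_corner_right [simp]: "in_corner a \<Longrightarrow> a \<otimes> e = a"
  unfolding in_corner_def by blast

lemma cut_corner: "in_corner a \<Longrightarrow> cut a = a"
  by (simp add: cut_def)

lemma cut_add: "a \<in> carrier R \<Longrightarrow> c \<in> carrier R \<Longrightarrow> cut (a \<oplus> c) = cut a \<oplus> cut c"
  by (simp add: cut_def R.l_distr R.r_distr)

lemma p_in [simp]: "in_corner a \<Longrightarrow> p a \<in> carrier R'"
  by (simp add: p_closed)

lemma p_plus: "in_corner a \<Longrightarrow> in_corner c \<Longrightarrow> p (a \<oplus> c) = p a \<oplus>\<^bsub>R'\<^esub> p c"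
  by (simp add: p_add)

lemma p_times: "in_corner a \<Longrightarrow> in_corner c \<Longrightarrow> p (a \<otimes> c) = p a \<otimes>\<^bsub>R'\<^esub> p c"
  by (simp add: p_mult)

lemma p_e: "p e = \<one>\<^bsub>R'\<^esub>"
  using p_g[of "\<one>\<^bsub>R'\<^esub>"] by (simp add: g_one)

lemma p_zero: "p \<zero> = \<zero>\<^bsub>R'\<^esub>"
proof -
  have "p \<zero> \<oplus>\<^bsub>R'\<^esub> p \<zero> = p \<zero>"
    using p_plus[of "\<zero>" "\<zero>"] by simp
  then show ?thesis by (metis R'.add.r_cancel_one' R'.zero_closed p_in in_corner_zero)
qed

lemma p_uminus: "in_corner a \<Longrightarrow> p (\<ominus> a) = \<ominus>\<^bsub>R'\<^esub> p a"
  using p_plus[of "\<ominus> a" a] by (simp add: R.l_neg p_zero R'.minus_equality)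

end

text \<open>The action is a parameter, prescribed only on \<open>R'\<close> and \<open>e M\<close>:
  the modules to be treated come with action fields of their own, namely the unrestricted
  \<open>smult N\<close> in one case and a choice from a residue class in the other.\<close>

locale corner_module = corner_retract R R' e g p + M: left_module R M
  for R :: "('a, 'm) ring_scheme" (structure) and R' :: "('b, 'n) ring_scheme" and e g p
    and M :: "('a, 'v) module" +
  fixes act :: "'b \<Rightarrow> 'v \<Rightarrow> 'v"
  assumes act: "b \<in> carrier R' \<Longrightarrow> x \<in> corner_carrier M \<Longrightarrow> act b x = g b \<odot>\<^bsub>M\<^esub> x"
begin

abbreviation "eM \<equiv> with_action M (corner_carrier M) act"

lemma corner_carrier_iff: "x \<in> corner_carrier M \<longleftrightarrow> x \<in> carrier M \<and> e \<odot>\<^bsub>M\<^esub> x = x"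
  unfolding corner_carrier_def
  by (auto simp: M.smult_assoc1[symmetric] intro: image_eqI[of _ _ x])

lemma in_corner_smult:
  "in_corner a \<Longrightarrow> x \<in> carrier M \<Longrightarrow> a \<odot>\<^bsub>M\<^esub> x \<in> corner_carrier M"
  by (simp add: corner_carrier_iff M.smult_assoc1[symmetric])

lemma corner_left_module: "left_module R' eM"
proof (intro left_module.intro left_module_axioms.intro)
  show "ring R'" by (rule R'.ring_axioms)
  show "abelian_group eM"
    by (rule abelian_group_with_action)
      (auto simp: corner_carrier_iff M.smult_r_distr M.smult_r_minus M.abelian_group_axioms)
next
  fix a x assume "a \<in> carrier R'" "x \<in> carrier eM"
  then show "a \<odot>\<^bsub>eM\<^esub> x \<in> carrier eM"
    using in_corner_smult[of "g a" x] by (simp add: act corner_carrier_iff)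
next
  fix a b x assume *: "a \<in> carrier R'" "b \<in> carrier R'" "x \<in> carrier eM"
  then have x: "x \<in> carrier M" "x \<in> corner_carrier M" by (auto simp: corner_carrier_iff)
  show "(a \<oplus>\<^bsub>R'\<^esub> b) \<odot>\<^bsub>eM\<^esub> x = a \<odot>\<^bsub>eM\<^esub> x \<oplus>\<^bsub>eM\<^esub> b \<odot>\<^bsub>eM\<^esub> x"
    using * x by (simp add: act g_add M.smult_l_distr)
  show "(a \<otimes>\<^bsub>R'\<^esub> b) \<odot>\<^bsub>eM\<^esub> x = a \<odot>\<^bsub>eM\<^esub> (b \<odot>\<^bsub>eM\<^esub> x)"
    using * x by (simp add: act g_mult M.smult_assoc1 in_corner_smult)
next
  fix a x y assume *: "a \<in> carrier R'" "x \<in> carrier eM" "y \<in> carrier eM"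
  then have x: "x \<in> carrier M" "y \<in> carrier M" "x \<oplus>\<^bsub>M\<^esub> y \<in> corner_carrier M"
    by (auto simp: corner_carrier_iff M.smult_r_distr)
  then show "a \<odot>\<^bsub>eM\<^esub> (x \<oplus>\<^bsub>eM\<^esub> y) = a \<odot>\<^bsub>eM\<^esub> x \<oplus>\<^bsub>eM\<^esub> a \<odot>\<^bsub>eM\<^esub> y"
    using * by (simp add: act M.smult_r_distr)
next
  fix x assume "x \<in> carrier eM"
  then show "\<one>\<^bsub>R'\<^esub> \<odot>\<^bsub>eM\<^esub> x = x"
    by (simp add: act g_one corner_carrier_iff)
qed

text \<open>The difference of \<open>cut a\<close> and \<open>g (p (cut a))\<close> lies in the
  corner and is killed by \<open>p\<close>, so it acts as zero. Hence the part in \<open>e M\<close>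
  of any \<open>a x\<close> with \<open>x\<close> in \<open>e M\<close> is computed by
  \<open>R'\<close> alone.\<close>

lemma cut_smult:
  assumes adm: "admissible M" and a: "a \<in> carrier R" and x: "x \<in> corner_carrier M"
  shows "e \<odot>\<^bsub>M\<^esub> (a \<odot>\<^bsub>M\<^esub> x) = p (cut a) \<odot>\<^bsub>eM\<^esub> x"
proof -
  have xM: "x \<in> carrier M" "e \<odot>\<^bsub>M\<^esub> x = x" using x by (auto simp: corner_carrier_iff)
  let ?b = "p (cut a)"
  let ?d = "cut a \<ominus> g ?b"
  have "in_corner ?d" using a by (simp add: a_minus_def)
  moreover have "p ?d = \<zero>\<^bsub>R'\<^esub>"
    using a by (simp add: a_minus_def p_plus p_uminus R'.r_neg)
  ultimately have "?d \<odot>\<^bsub>M\<^esub> x = \<zero>\<^bsub>M\<^esub>"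
    using adm x unfolding admissible_def by blast
  then have "cut a \<odot>\<^bsub>M\<^esub> x = g ?b \<odot>\<^bsub>M\<^esub> x"
    using a xM M.minus_smult_eq_zero_iff[of "cut a" "g ?b" x] by simp
  moreover have "cut a \<odot>\<^bsub>M\<^esub> x = e \<odot>\<^bsub>M\<^esub> (a \<odot>\<^bsub>M\<^esub> x)"
    using a xM by (simp add: cut_def M.smult_assoc1)
  ultimately show ?thesis using a x by (simp add: act)
qed

text \<open>If \<open>a\<close> moves \<open>x\<close> to \<open>y\<close> and both lie in
  \<open>e M\<close>, then so does \<open>e a\<close>, and by \<open>cut_smult\<close> this is the
  action of an element of \<open>R'\<close>.\<close>

lemma corner_irreducible:
  assumes irr: "irreducible_module R M" and adm: "admissible M"
    and nz: "\<exists>x\<in>carrier M. e \<odot>\<^bsub>M\<^esub> x \<noteq> \<zero>\<^bsub>M\<^esub>"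
  shows "irreducible_module R' eM"
proof -
  obtain z where z: "z \<in> carrier M" "e \<odot>\<^bsub>M\<^esub> z \<noteq> \<zero>\<^bsub>M\<^esub>" using nz by blast
  show ?thesis
  proof (rule irreducible_moduleI[OF corner_left_module, of "e \<odot>\<^bsub>M\<^esub> z"])
    show "e \<odot>\<^bsub>M\<^esub> z \<in> carrier eM" using z by (simp add: in_corner_smult)
    show "e \<odot>\<^bsub>M\<^esub> z \<noteq> \<zero>\<^bsub>eM\<^esub>" using z by simp
    fix x y assume *: "x \<in> carrier eM" "x \<noteq> \<zero>\<^bsub>eM\<^esub>" "y \<in> carrier eM"
    then have xy: "x \<in> carrier M" "y \<in> carrier M" "e \<odot>\<^bsub>M\<^esub> y = y" "x \<in> corner_carrier M"
      by (auto simp: corner_carrier_iff)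
    obtain a where a: "a \<in> carrier R" "a \<odot>\<^bsub>M\<^esub> x = y"
      using irreducible_module_transitive[OF irr xy(1) _ xy(2)] * by auto
    then have "p (cut a) \<odot>\<^bsub>eM\<^esub> x = y"
      using cut_smult[OF adm a(1) xy(4)] a xy by simp
    then show "\<exists>b\<in>carrier R'. b \<odot>\<^bsub>eM\<^esub> x = y"
      using a by (intro bexI[of _ "p (cut a)"]) auto
  qed
qed

end

section \<open>Irreducible modules are determined by their corners, and every irreducible corner
  occurs\<close>

context corner_retract
begin

text \<open>If \<open>h\<close> is an isomorphism of the corners and \<open>x\<close> is a nonzero corner element, then
  \<open>a x \<mapsto> a (h x)\<close> is well defined: when \<open>a x = 0\<close>, the corner of the submodule generated by
  \<open>a (h x)\<close> vanishes.\<close>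

lemma corner_annihilator:
  assumes "corner_module R R' e g p M act" and "corner_module R R' e g p M' act'"
    and irr': "irreducible_module R M'" and adm: "admissible M" "admissible M'"
    and nz': "\<exists>x\<in>carrier M'. e \<odot>\<^bsub>M'\<^esub> x \<noteq> \<zero>\<^bsub>M'\<^esub>"
    and h: "\<And>b x. b \<in> carrier R' \<Longrightarrow> x \<in> corner_carrier M \<Longrightarrow> h (act b x) = act' b (h x)"
    and h0: "h \<zero>\<^bsub>M\<^esub> = \<zero>\<^bsub>M'\<^esub>"
    and x: "x \<in> corner_carrier M" and hx: "h x \<in> corner_carrier M'"
    and a: "a \<in> carrier R" and ax: "a \<odot>\<^bsub>M\<^esub> x = \<zero>\<^bsub>M\<^esub>"
  shows "a \<odot>\<^bsub>M'\<^esub> h x = \<zero>\<^bsub>M'\<^esub>"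
proof (rule ccontr)
  interpret M: corner_module R R' e g p M act by fact
  interpret M': corner_module R R' e g p M' act' by fact
  assume na: "a \<odot>\<^bsub>M'\<^esub> h x \<noteq> \<zero>\<^bsub>M'\<^esub>"
  obtain z where z: "z \<in> carrier M'" "e \<odot>\<^bsub>M'\<^esub> z \<noteq> \<zero>\<^bsub>M'\<^esub>" using nz' by blast
  have hx': "h x \<in> carrier M'" and x': "x \<in> carrier M"
    using x hx by (auto simp: M.corner_carrier_iff M'.corner_carrier_iff)
  obtain c where c: "c \<in> carrier R" "c \<odot>\<^bsub>M'\<^esub> (a \<odot>\<^bsub>M'\<^esub> h x) = z"
    using irreducible_module_transitive[OF irr' _ na z(1)] hx' a M'.M.smult_closed by blast
  have "e \<odot>\<^bsub>M\<^esub> ((c \<otimes> a) \<odot>\<^bsub>M\<^esub> x) = \<zero>\<^bsub>M\<^esub>"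
    using a c x' ax by (simp add: M.M.smult_assoc1)
  then have "p (cut (c \<otimes> a)) \<odot>\<^bsub>M.eM\<^esub> x = \<zero>\<^bsub>M\<^esub>"
    using M.cut_smult[OF adm(1), of "c \<otimes> a" x] a c x by simp
  then have "act' (p (cut (c \<otimes> a))) (h x) = \<zero>\<^bsub>M'\<^esub>"
    using h[of "p (cut (c \<otimes> a))" x] h0 a c x by simp
  then have "e \<odot>\<^bsub>M'\<^esub> ((c \<otimes> a) \<odot>\<^bsub>M'\<^esub> h x) = \<zero>\<^bsub>M'\<^esub>"
    using M'.cut_smult[OF adm(2), of "c \<otimes> a" "h x"] a c hx by simp
  then show False
    using a c hx' z by (simp add: M'.M.smult_assoc1)
qed

text \<open>Fix a nonzero \<open>x\<close> in \<open>e M\<close>. Applying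
  \<open>corner_annihilator\<close> to \<open>h\<close> and to its inverse shows that
  \<open>x\<close> and \<open>h x\<close> have the same annihilator in \<open>R\<close>. Both
  vectors generate, so \<open>a x \<mapsto> a (h x)\<close> is an isomorphism of the full
  modules.\<close>

lemma corner_isomorphic_imp_isomorphic:
  assumes cM: "corner_module R R' e g p M act" and cM': "corner_module R R' e g p M' act'"
    and irr: "irreducible_module R M" "irreducible_module R M'"
    and adm: "admissible M" "admissible M'"
    and nz: "\<exists>x\<in>carrier M. e \<odot>\<^bsub>M\<^esub> x \<noteq> \<zero>\<^bsub>M\<^esub>"
    and iso: "module_isomorphic R' (with_action M (corner_carrier M) act)
      (with_action M' (corner_carrier M') act')"
  shows "module_isomorphic R M M'"
proof -
  interpret M: corner_module R R' e g p M act by fact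
  interpret M': corner_module R R' e g p M' act' by fact
  obtain h where bij: "bij_betw h (corner_carrier M) (corner_carrier M')"
    and h_add: "\<And>x y. x \<in> corner_carrier M \<Longrightarrow> y \<in> corner_carrier M \<Longrightarrow>
      h (x \<oplus>\<^bsub>M\<^esub> y) = h x \<oplus>\<^bsub>M'\<^esub> h y"
    and h: "\<And>b x. b \<in> carrier R' \<Longrightarrow> x \<in> corner_carrier M \<Longrightarrow> h (act b x) = act' b (h x)"
    using iso unfolding module_isomorphic_def by auto
  define k where "k = inv_into (corner_carrier M) h"
  have hc: "h x \<in> corner_carrier M'" if "x \<in> corner_carrier M" for x
    using bij that by (rule bij_betwE[rule_format])
  have kh: "k (h x) = x" if "x \<in> corner_carrier M" for x
    using bij that by (simp add: k_def bij_betw_def)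
  have hk: "h (k y) = y" "k y \<in> corner_carrier M" if "y \<in> corner_carrier M'" for y
    using bij that by (auto simp: k_def bij_betw_def inv_into_into f_inv_into_f)
  have 0: "\<zero>\<^bsub>M\<^esub> \<in> corner_carrier M" "\<zero>\<^bsub>M'\<^esub> \<in> corner_carrier M'"
    by (auto simp: M.corner_carrier_iff M'.corner_carrier_iff)
  have h0: "h \<zero>\<^bsub>M\<^esub> = \<zero>\<^bsub>M'\<^esub>"
  proof -
    have "h \<zero>\<^bsub>M\<^esub> \<in> carrier M'" using hc[OF 0(1)] by (simp add: M'.corner_carrier_iff)
    moreover have "h \<zero>\<^bsub>M\<^esub> \<oplus>\<^bsub>M'\<^esub> h \<zero>\<^bsub>M\<^esub> = h \<zero>\<^bsub>M\<^esub>"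
      using h_add[OF 0(1) 0(1)] by simp
    ultimately show ?thesis by (metis M'.M.M.add.r_cancel_one' M'.M.M.zero_closed)
  qed
  have k0: "k \<zero>\<^bsub>M'\<^esub> = \<zero>\<^bsub>M\<^esub>" using kh[OF 0(1)] h0 by simp
  have k: "k (act' b y) = act b (k y)" if "b \<in> carrier R'" "y \<in> corner_carrier M'" for b y
  proof -
    have "act b (k y) \<in> corner_carrier M"
      using that hk[OF that(2)] M.in_corner_smult[of "g b" "k y"]
      by (simp add: M.act M.corner_carrier_iff)
    then show ?thesis using h[OF that(1) hk(2)[OF that(2)]] hk[OF that(2)] kh by metis
  qed
  obtain x where "x \<in> carrier M" "e \<odot>\<^bsub>M\<^esub> x \<noteq> \<zero>\<^bsub>M\<^esub>" using nz by blast
  then obtain x where xc: "x \<in> corner_carrier M" and xn: "x \<noteq> \<zero>\<^bsub>M\<^esub>"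
    using M.in_corner_smult[OF in_corner_e] by blast
  have x: "x \<in> carrier M" "e \<odot>\<^bsub>M\<^esub> x = x" using xc by (auto simp: M.corner_carrier_iff)
  have hx: "h x \<in> carrier M'" "e \<odot>\<^bsub>M'\<^esub> h x = h x"
    using hc[OF xc] by (auto simp: M'.corner_carrier_iff)
  have hxn: "h x \<noteq> \<zero>\<^bsub>M'\<^esub>" using xn kh[OF xc] k0 by metis
  have ann: "a \<odot>\<^bsub>M\<^esub> x = \<zero>\<^bsub>M\<^esub> \<longleftrightarrow> a \<odot>\<^bsub>M'\<^esub> h x = \<zero>\<^bsub>M'\<^esub>" if a: "a \<in> carrier R" for a
  proof
    show "a \<odot>\<^bsub>M'\<^esub> h x = \<zero>\<^bsub>M'\<^esub>" if "a \<odot>\<^bsub>M\<^esub> x = \<zero>\<^bsub>M\<^esub>"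
      by (rule corner_annihilator[OF cM cM' irr(2) adm _ h h0 xc hc[OF xc] a that])
        (use hx hxn in \<open>auto intro!: bexI[of _ "h x"]\<close>)
    have "a \<odot>\<^bsub>M\<^esub> k (h x) = \<zero>\<^bsub>M\<^esub>" if "a \<odot>\<^bsub>M'\<^esub> h x = \<zero>\<^bsub>M'\<^esub>"
      by (rule corner_annihilator[OF cM' cM irr(1) adm(2,1) nz k k0 hc[OF xc] hk(2) a that])
        (use hc xc in auto)
    then show "a \<odot>\<^bsub>M\<^esub> x = \<zero>\<^bsub>M\<^esub>" if "a \<odot>\<^bsub>M'\<^esub> h x = \<zero>\<^bsub>M'\<^esub>"
      using that kh[OF xc] by simp
  qed
  \<comment> \<open>Equality of annihilators, applied to differences: one direction makes
    \<open>f\<close> well defined, the other makes it injective.\<close>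
  have eq: "a \<odot>\<^bsub>M\<^esub> x = b \<odot>\<^bsub>M\<^esub> x \<longleftrightarrow> a \<odot>\<^bsub>M'\<^esub> h x = b \<odot>\<^bsub>M'\<^esub> h x"
    if ab: "a \<in> carrier R" "b \<in> carrier R" for a b
    using ann[of "a \<ominus> b"] ab M.M.minus_smult_eq_zero_iff[OF ab x(1)]
      M'.M.minus_smult_eq_zero_iff[OF ab hx(1)] by simp
  define f where "f y = (SOME a. a \<in> carrier R \<and> a \<odot>\<^bsub>M\<^esub> x = y) \<odot>\<^bsub>M'\<^esub> h x" for y
  have f: "f (a \<odot>\<^bsub>M\<^esub> x) = a \<odot>\<^bsub>M'\<^esub> h x" if a: "a \<in> carrier R" for a
  proof -
    let ?s = "SOME c. c \<in> carrier R \<and> c \<odot>\<^bsub>M\<^esub> x = a \<odot>\<^bsub>M\<^esub> x"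
    have "?s \<in> carrier R \<and> ?s \<odot>\<^bsub>M\<^esub> x = a \<odot>\<^bsub>M\<^esub> x" by (rule someI) (use a in simp)
    then show ?thesis using eq a unfolding f_def by blast
  qed
  have gen: "\<exists>a\<in>carrier R. y = a \<odot>\<^bsub>M\<^esub> x" if "y \<in> carrier M" for y
    using irreducible_module_transitive[OF irr(1) x(1) xn that] by metis
  show ?thesis
    unfolding module_isomorphic_def
  proof (intro exI[of _ f] conjI ballI)
    show "bij_betw f (carrier M) (carrier M')"
      unfolding bij_betw_def
    proof
      show "inj_on f (carrier M)"
      proof (rule inj_onI)
        fix u v assume uv: "u \<in> carrier M" "v \<in> carrier M" and fuv: "f u = f v"
        obtain a b where "a \<in> carrier R" "b \<in> carrier R" "u = a \<odot>\<^bsub>M\<^esub> x" "v = b \<odot>\<^bsub>M\<^esub> x"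
          using gen uv by meson
        with fuv eq f show "u = v" by simp
      qed
      show "f ` carrier M = carrier M'"
      proof safe
        fix u assume "u \<in> carrier M"
        then obtain a where "a \<in> carrier R" "u = a \<odot>\<^bsub>M\<^esub> x" using gen by blast
        with f hx show "f u \<in> carrier M'" by simp
      next
        fix v assume v: "v \<in> carrier M'"
        obtain a where a: "a \<in> carrier R" "a \<odot>\<^bsub>M'\<^esub> h x = v"
          using irreducible_module_transitive[OF irr(2) hx(1) hxn v] .
        then show "v \<in> f ` carrier M" using f x by (metis M.M.smult_closed image_eqI)
      qed
    qed
  next
    fix u v assume uv: "u \<in> carrier M" "v \<in> carrier M"
    obtain a b where ab: "a \<in> carrier R" "b \<in> carrier R" "u = a \<odot>\<^bsub>M\<^esub> x" "v = b \<odot>\<^bsub>M\<^esub> x"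
      using gen uv by meson
    then have "u \<oplus>\<^bsub>M\<^esub> v = (a \<oplus> b) \<odot>\<^bsub>M\<^esub> x" using x by (simp add: M.M.smult_l_distr)
    then show "f (u \<oplus>\<^bsub>M\<^esub> v) = f u \<oplus>\<^bsub>M'\<^esub> f v"
      using ab hx by (simp add: f M'.M.smult_l_distr)
  next
    fix c u assume c: "c \<in> carrier R" and u: "u \<in> carrier M"
    obtain a where a: "a \<in> carrier R" "u = a \<odot>\<^bsub>M\<^esub> x" using gen u by meson
    then have "c \<odot>\<^bsub>M\<^esub> u = (c \<otimes> a) \<odot>\<^bsub>M\<^esub> x" using x c by (simp add: M.M.smult_assoc1)
    then show "f (c \<odot>\<^bsub>M\<^esub> u) = c \<odot>\<^bsub>M'\<^esub> f u"
      using a c hx by (simp add: f M'.M.smult_assoc1)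
  qed
qed

text \<open>A homomorphism commutes with \<open>e\<close> and so restricts to the corners; for
  surjectivity a preimage \<open>x\<close> of a vector fixed by \<open>e\<close> is replaced by
  \<open>e x\<close>.\<close>

lemma isomorphic_imp_corner_isomorphic:
  assumes cM: "corner_module R R' e g p M act" and cM': "corner_module R R' e g p M' act'"
    and iso: "module_isomorphic R M M'"
  shows "module_isomorphic R' (with_action M (corner_carrier M) act)
      (with_action M' (corner_carrier M') act')"
proof -
  interpret M: corner_module R R' e g p M act by fact
  interpret M': corner_module R R' e g p M' act' by fact
  obtain h where bij: "bij_betw h (carrier M) (carrier M')"
    and h_add: "\<And>x y. x \<in> carrier M \<Longrightarrow> y \<in> carrier M \<Longrightarrow> h (x \<oplus>\<^bsub>M\<^esub> y) = h x \<oplus>\<^bsub>M'\<^esub> h y"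
    and h: "\<And>a x. a \<in> carrier R \<Longrightarrow> x \<in> carrier M \<Longrightarrow> h (a \<odot>\<^bsub>M\<^esub> x) = a \<odot>\<^bsub>M'\<^esub> h x"
    using iso unfolding module_isomorphic_def by auto
  have hc: "h x \<in> corner_carrier M'" if "x \<in> corner_carrier M" for x
    using that h[of e x] bij_betwE[OF bij] by (auto simp: M.corner_carrier_iff M'.corner_carrier_iff)
  have onto: "y \<in> h ` corner_carrier M" if y: "y \<in> corner_carrier M'" for y
  proof -
    obtain x where x: "x \<in> carrier M" "h x = y"
      using y bij unfolding M'.corner_carrier_iff bij_betw_def by (metis image_iff)
    have "h (e \<odot>\<^bsub>M\<^esub> x) = y" using h[of e x] x y by (simp add: M'.corner_carrier_iff)
    then show ?thesis using x M.in_corner_smult[OF in_corner_e] by blast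
  qed
  have "inj_on h (corner_carrier M)"
    using bij by (rule inj_on_subset[OF bij_betw_imp_inj_on]) (auto simp: M.corner_carrier_iff)
  with hc onto have "bij_betw h (corner_carrier M) (corner_carrier M')"
    unfolding bij_betw_def by blast
  moreover have "h (act b x) = act' b (h x)" if "b \<in> carrier R'" "x \<in> corner_carrier M" for b x
    using that hc[OF that(2)] h[of "g b" x] by (simp add: M.act M'.act M.corner_carrier_iff)
  ultimately show ?thesis
    unfolding module_isomorphic_def
    by (intro exI[of _ h]) (auto simp: h_add M.corner_carrier_iff)
qed

lemma corner_isomorphic_iff:
  assumes "corner_module R R' e g p M act" and "corner_module R R' e g p M' act'"
    and "irreducible_module R M" "irreducible_module R M'"
    and "admissible M" "admissible M'"
    and "\<exists>x\<in>carrier M. e \<odot>\<^bsub>M\<^esub> x \<noteq> \<zero>\<^bsub>M\<^esub>"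
  shows "module_isomorphic R' (with_action M (corner_carrier M) act)
      (with_action M' (corner_carrier M') act') \<longleftrightarrow> module_isomorphic R M M'"
  using corner_isomorphic_imp_isomorphic[OF assms] isomorphic_imp_corner_isomorphic[OF assms(1,2)]
  by blast

text \<open>The \<open>R\<close>-module attached to \<open>W\<close> is \<open>R\<close> modulo the largest left ideal whose corner, in
  \<open>e R e\<close>, annihilates a fixed nonzero vector \<open>w\<close> of \<open>W\<close>.\<close>

lemma irreducible_module_from_corner:
  fixes W :: "('b, 'w) module"
  assumes irr: "irreducible_module R' W"
  shows "\<exists>N :: ('a, 'a set) module. irreducible_module R N \<and> admissible N \<and>
    (\<exists>x\<in>carrier N. e \<odot>\<^bsub>N\<^esub> x \<noteq> \<zero>\<^bsub>N\<^esub>) \<and>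
    (\<forall>act. (\<forall>b\<in>carrier R'. \<forall>x\<in>corner_carrier N. act b x = g b \<odot>\<^bsub>N\<^esub> x) \<longrightarrow>
       module_isomorphic R' (with_action N (corner_carrier N) act) W)"
proof -
  interpret W: left_module R' W
    using irr by (rule irreducible_module_left_module)
  obtain w where w: "w \<in> carrier W" "w \<noteq> \<zero>\<^bsub>W\<^esub>"
    using irr by (rule irreducible_module_nonzero)
  \<comment> \<open>The additive map \<open>q\<close> compresses \<open>b\<close> to the corner and
    lets the result act on \<open>w\<close>. Eventually \<open>w\<close> corresponds to the class of
    \<open>e\<close>, and \<open>q\<close> induces the isomorphism of the corner with
    \<open>W\<close>.\<close>
  define q where "q b = p (cut b) \<odot>\<^bsub>W\<^esub> w" for b
  have q_closed [simp]: "q b \<in> carrier W" if "b \<in> carrier R" for b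
    using that w by (simp add: q_def)
  have q_add: "q (b \<oplus> c) = q b \<oplus>\<^bsub>W\<^esub> q c" if "b \<in> carrier R" "c \<in> carrier R" for b c
    using that w by (simp add: q_def cut_add p_plus W.smult_l_distr)
  have q_mult: "q (a \<otimes> b) = p a \<odot>\<^bsub>W\<^esub> q b" if a: "in_corner a" and b: "b \<in> carrier R" for a b
  proof -
    have "cut (a \<otimes> b) = a \<otimes> cut b"
      using in_corner_left[OF a] in_corner_right[OF a] in_corner_carrier[OF a] b
      by (metis R.m_assoc R.m_closed cut_def e_closed)
    then show ?thesis
      using a b w by (simp add: q_def p_times W.smult_assoc1)
  qed
  have q_cut_r: "q (b \<otimes> e) = q b" "q (e \<otimes> b) = q b" if "b \<in> carrier R" for b
    using that by (simp_all add: q_def cut_def R.m_assoc)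
  have q0: "q \<zero> = \<zero>\<^bsub>W\<^esub>" using w by (simp add: q_def cut_def p_zero)
  have qe: "q e = w" using w by (simp add: q_def cut_def p_e)
  have q_uminus: "q (\<ominus> b) = \<ominus>\<^bsub>W\<^esub> q b" if "b \<in> carrier R" for b
    using q_add[of "\<ominus> b" b] that by (simp add: R.l_neg q0 W.M.minus_equality)
  define L where "L = {b \<in> carrier R. \<forall>c\<in>carrier R. q (c \<otimes> b) = \<zero>\<^bsub>W\<^esub>}"
  interpret L: left_ideal R L
    by unfold_locales
      (auto simp: L_def q0 R.r_distr q_add R.m_assoc[symmetric])
  define N where "N = L.quot_module"
  have L_q: "q b = \<zero>\<^bsub>W\<^esub>" if "b \<in> L" for b
  proof -
    have "b \<in> carrier R" "q (\<one> \<otimes> b) = \<zero>\<^bsub>W\<^esub>"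
      using that R.one_closed unfolding L_def by blast+
    then show ?thesis by simp
  qed
  have L_I: "b \<in> L" if "b \<in> carrier R" "\<And>c. c \<in> carrier R \<Longrightarrow> q (c \<otimes> b) = \<zero>\<^bsub>W\<^esub>" for b
    using that unfolding L_def by blast
  have lm: "left_module R N"
    unfolding N_def by (rule L.quot_module_left_module)
  interpret N: left_module R N by fact
  have Ncar: "carrier N = (\<lambda>x. L +> x) ` carrier R"
    and N0: "\<zero>\<^bsub>N\<^esub> = L +> \<zero>"
    and Nadd: "\<And>x y. x \<in> carrier R \<Longrightarrow> y \<in> carrier R \<Longrightarrow>
      (L +> x) \<oplus>\<^bsub>N\<^esub> (L +> y) = L +> (x \<oplus> y)"
    and Nsmult: "\<And>a x. a \<in> carrier R \<Longrightarrow> x \<in> carrier R \<Longrightarrow>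
      a \<odot>\<^bsub>N\<^esub> (L +> x) = L +> (a \<otimes> x)"
    unfolding N_def by (simp_all add: L.quot_module_carrier L.quot_module_zero
        L.quot_module_add L.quot_module_smult)
  have eq_iff: "L +> x = L +> y \<longleftrightarrow> x \<ominus> y \<in> L"
    if "x \<in> carrier R" "y \<in> carrier R" for x y
    using that by (rule L.rcos_eq_iff)
  have eq0_iff: "L +> x = \<zero>\<^bsub>N\<^esub> \<longleftrightarrow> x \<in> L" if "x \<in> carrier R" for x
    using that eq_iff[of x "\<zero>"] by (simp add: N0 a_minus_def)
  have e_nz: "L +> e \<noteq> \<zero>\<^bsub>N\<^esub>"
    using L_q[of e] w by (auto simp: eq0_iff qe)
  have irrN: "irreducible_module R N"
  proof (rule irreducible_moduleI[OF lm _ e_nz])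
    show "L +> e \<in> carrier N" by (simp add: Ncar)
    fix x y assume x: "x \<in> carrier N" "x \<noteq> \<zero>\<^bsub>N\<^esub>" and y: "y \<in> carrier N"
    obtain b where b: "b \<in> carrier R" "x = L +> b" using x by (auto simp: Ncar)
    obtain d where d: "d \<in> carrier R" "y = L +> d" using y by (auto simp: Ncar)
    have "b \<notin> L" using x b eq0_iff by blast
    then obtain c where c: "c \<in> carrier R" "q (c \<otimes> b) \<noteq> \<zero>\<^bsub>W\<^esub>"
      using L_I[OF b(1)] by blast
    obtain s where s: "s \<in> carrier R'" "s \<odot>\<^bsub>W\<^esub> q (c \<otimes> b) = w"
      using irreducible_module_transitive[OF irr _ c(2) w(1)] b c by auto
    \<comment> \<open>As \<open>b\<close> is not in \<open>L\<close>, some left multiple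
      \<open>c b\<close> has nonzero \<open>q\<close>-value, which irreducibility of
      \<open>W\<close> returns to \<open>w\<close>. With this \<open>a\<close> the product
      \<open>a b\<close> is congruent to \<open>e\<close> modulo \<open>L\<close>, so the class of
      \<open>b\<close> generates the class of \<open>e\<close>.\<close>
    define a where "a = g s \<otimes> c"
    have a: "a \<in> carrier R" using s c by (simp add: a_def)
    \<comment> \<open>The factor \<open>g s\<close> absorbs an \<open>e\<close> on its left, which
      turns \<open>e a'\<close> into the corner element \<open>cut a'\<close>; what remains is
      \<open>q (g s c b) = s (q (c b)) = w\<close>.\<close>
    have key: "q (a' \<otimes> (a \<otimes> b)) = q a'" if a': "a' \<in> carrier R" for a'
    proof -
      have "q (a' \<otimes> (a \<otimes> b)) = q (e \<otimes> (a' \<otimes> (a \<otimes> b)))"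
        using q_cut_r(2) a a' b by simp
      also have "e \<otimes> (a' \<otimes> (a \<otimes> b)) = e \<otimes> (a' \<otimes> (e \<otimes> (a \<otimes> b)))"
        using s b c by (simp add: a_def R.m_assoc[symmetric])
      also have "\<dots> = cut a' \<otimes> (g s \<otimes> (c \<otimes> b))"
        using a a' b c s by (simp add: a_def cut_def R.m_assoc)
      also have "q \<dots> = p (cut a') \<odot>\<^bsub>W\<^esub> w"
        using a' b c s by (simp add: q_mult)
      finally show ?thesis by (simp add: q_def)
    qed
    have "a \<otimes> b \<ominus> e \<in> L"
    proof (rule L_I)
      fix a' assume a': "a' \<in> carrier R"
      have "a' \<otimes> (a \<otimes> b \<ominus> e) = a' \<otimes> (a \<otimes> b) \<oplus> \<ominus> (a' \<otimes> e)"
        using a a' b by (simp add: a_minus_def R.r_distr R.r_minus)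
      then show "q (a' \<otimes> (a \<otimes> b \<ominus> e)) = \<zero>\<^bsub>W\<^esub>"
        using a a' b by (simp add: q_add q_uminus key q_cut_r W.M.r_neg)
    qed (use a b in auto)
    then have 1: "a \<odot>\<^bsub>N\<^esub> x = L +> e"
      using a b by (simp add: Nsmult eq_iff)
    \<comment> \<open>A right factor \<open>e\<close> is invisible to \<open>q\<close>, so the class
      of \<open>e\<close> generates the whole quotient.\<close>
    have "d \<otimes> e \<ominus> d \<in> L"
    proof (rule L_I)
      fix a' assume a': "a' \<in> carrier R"
      have "a' \<otimes> (d \<otimes> e \<ominus> d) = (a' \<otimes> d) \<otimes> e \<oplus> \<ominus> (a' \<otimes> d)"
        using a' d by (simp add: a_minus_def R.r_distr R.r_minus R.m_assoc)
      then show "q (a' \<otimes> (d \<otimes> e \<ominus> d)) = \<zero>\<^bsub>W\<^esub>"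
        using a' d by (simp add: q_add q_uminus q_cut_r W.M.r_neg)
    qed (use d in auto)
    then have "d \<odot>\<^bsub>N\<^esub> (L +> e) = y"
      using d by (simp add: Nsmult eq_iff)
    with 1 have "(d \<otimes> a) \<odot>\<^bsub>N\<^esub> x = y"
      using a d x by (simp add: N.smult_assoc1)
    then show "\<exists>a\<in>carrier R. a \<odot>\<^bsub>N\<^esub> x = y" using a d by blast
  qed
  define h where "h Y = q (SOME b. b \<in> carrier R \<and> L +> b = Y)" for Y
  have h: "h (L +> b) = q b" if b: "b \<in> carrier R" for b
  proof -
    let ?c = "SOME c. c \<in> carrier R \<and> L +> c = L +> b"
    have c: "?c \<in> carrier R \<and> L +> ?c = L +> b"
      by (rule someI) (use b in simp)
    then have "?c \<ominus> b \<in> L" using eq_iff b by blast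
    then have "q ((?c \<ominus> b) \<oplus> b) = \<zero>\<^bsub>W\<^esub> \<oplus>\<^bsub>W\<^esub> q b"
      using c b by (subst q_add) (auto simp: L_q)
    moreover have "(?c \<ominus> b) \<oplus> b = ?c"
      using c b by (simp add: a_minus_def R.a_assoc R.l_neg)
    ultimately show ?thesis using b by (simp add: h_def)
  qed
  have in_cc: "x \<in> corner_carrier N \<longleftrightarrow> (\<exists>b\<in>carrier R. e \<otimes> b = b \<and> x = L +> b)" for x
  proof
    assume "x \<in> corner_carrier N"
    then obtain b where "b \<in> carrier R" "x = e \<odot>\<^bsub>N\<^esub> (L +> b)"
      by (auto simp: corner_carrier_def Ncar)
    then show "\<exists>b\<in>carrier R. e \<otimes> b = b \<and> x = L +> b"
      by (intro bexI[of _ "e \<otimes> b"]) (auto simp: Nsmult)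
  next
    assume "\<exists>b\<in>carrier R. e \<otimes> b = b \<and> x = L +> b"
    then obtain b where "b \<in> carrier R" "e \<otimes> b = b" "x = L +> b" by blast
    then show "x \<in> corner_carrier N"
      unfolding corner_carrier_def by (intro image_eqI[of _ _ x]) (auto simp: Nsmult Ncar)
  qed
  \<comment> \<open>For \<open>b = e b\<close> the single value \<open>q b\<close> decides
    membership in \<open>L\<close>, since \<open>q (c b)\<close> is \<open>p (cut c)\<close> applied
    to \<open>q b\<close>. This is what makes \<open>h\<close> injective on the corner.\<close>
  have inL: "b \<in> L" if b: "b \<in> carrier R" "e \<otimes> b = b" "q b = \<zero>\<^bsub>W\<^esub>" for b
  proof (rule L_I[OF b(1)])
    fix c assume c: "c \<in> carrier R"
    have "q (c \<otimes> b) = q (e \<otimes> (c \<otimes> (e \<otimes> b)))"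
      using b c by (simp add: q_cut_r)
    also have "e \<otimes> (c \<otimes> (e \<otimes> b)) = cut c \<otimes> b"
      using b(1) c by (simp add: cut_def R.m_assoc)
    also have "q \<dots> = \<zero>\<^bsub>W\<^esub>"
      using b c by (simp add: q_mult)
    finally show "q (c \<otimes> b) = \<zero>\<^bsub>W\<^esub>" .
  qed
  have hsmult: "h (a \<odot>\<^bsub>N\<^esub> x) = p a \<odot>\<^bsub>W\<^esub> h x"
    if "in_corner a" "x \<in> corner_carrier N" for a x
    using that by (auto simp: in_cc Nsmult h q_mult)
  have hadd: "h (x \<oplus>\<^bsub>N\<^esub> y) = h x \<oplus>\<^bsub>W\<^esub> h y"
    if "x \<in> corner_carrier N" "y \<in> corner_carrier N" for x y
    using that by (auto simp: in_cc Nadd h q_add)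
  have h_inj: "x = y" if xy: "x \<in> corner_carrier N" "y \<in> corner_carrier N" "h x = h y" for x y
  proof -
    obtain b c where b: "b \<in> carrier R" "e \<otimes> b = b" "x = L +> b"
      and c: "c \<in> carrier R" "e \<otimes> c = c" "y = L +> c"
      using xy by (auto simp: in_cc)
    have "b \<ominus> c \<in> L"
    proof (rule inL)
      show "e \<otimes> (b \<ominus> c) = b \<ominus> c"
        using b c by (simp add: a_minus_def R.r_distr R.r_minus)
      show "q (b \<ominus> c) = \<zero>\<^bsub>W\<^esub>"
        using b c xy(3) by (simp add: a_minus_def q_add q_uminus h W.M.r_neg)
    qed (use b c in auto)
    then show ?thesis using b c eq_iff by blast
  qed
  have h_zero: "h \<zero>\<^bsub>N\<^esub> = \<zero>\<^bsub>W\<^esub>" using h[of "\<zero>"] by (simp add: N0 q0)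
  have zero_cc: "\<zero>\<^bsub>N\<^esub> \<in> corner_carrier N"
    unfolding in_cc N0 by (intro bexI[of _ "\<zero>"]) auto
  have h_bij: "bij_betw h (corner_carrier N) (carrier W)"
    unfolding bij_betw_def
  proof
    show "inj_on h (corner_carrier N)" by (rule inj_onI) (rule h_inj)
    show "h ` corner_carrier N = carrier W"
    proof safe
      fix x assume "x \<in> corner_carrier N"
      then show "h x \<in> carrier W" by (auto simp: in_cc h)
    next
      fix v assume "v \<in> carrier W"
      then obtain s where s: "s \<in> carrier R'" "s \<odot>\<^bsub>W\<^esub> w = v"
        using irreducible_module_transitive[OF irr w] by blast
      have "h (L +> g s) = v"
        using s by (simp add: h q_def cut_corner)
      moreover have "L +> g s \<in> corner_carrier N"
        using s unfolding in_cc by (intro bexI[of _ "g s"]) auto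
      ultimately show "v \<in> h ` corner_carrier N" by blast
    qed
  qed
  \<comment> \<open>The map \<open>h\<close> takes \<open>a x\<close> to \<open>p a\<close> times
    \<open>h x\<close>, which is zero, and \<open>h\<close> is injective on the corner.\<close>
  have adm: "admissible N"
    unfolding admissible_def
  proof (intro allI impI)
    fix a x assume a: "in_corner a" "p a = \<zero>\<^bsub>R'\<^esub>" and x: "x \<in> corner_carrier N"
    have "x \<in> carrier N" using x by (auto simp: in_cc Ncar)
    then have "e \<odot>\<^bsub>N\<^esub> (a \<odot>\<^bsub>N\<^esub> x) = a \<odot>\<^bsub>N\<^esub> x" "a \<odot>\<^bsub>N\<^esub> x \<in> carrier N"
      using a by (simp_all add: N.smult_assoc1[symmetric])
    then have "a \<odot>\<^bsub>N\<^esub> x \<in> corner_carrier N"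
      unfolding corner_carrier_def by (metis image_eqI)
    moreover have "h (a \<odot>\<^bsub>N\<^esub> x) = h \<zero>\<^bsub>N\<^esub>"
      using hsmult[OF a(1) x] a x bij_betwE[OF h_bij] by (simp add: h_zero)
    ultimately show "a \<odot>\<^bsub>N\<^esub> x = \<zero>\<^bsub>N\<^esub>" using h_inj zero_cc by blast
  qed
  have "module_isomorphic R' (with_action N (corner_carrier N) act) W"
    if "\<forall>b\<in>carrier R'. \<forall>x\<in>corner_carrier N. act b x = g b \<odot>\<^bsub>N\<^esub> x" for act
    unfolding module_isomorphic_def
    using h_bij hadd hsmult[of "g _"] that by (intro exI[of _ h]) simp
  moreover have "e \<odot>\<^bsub>N\<^esub> (L +> e) \<noteq> \<zero>\<^bsub>N\<^esub>"
    using e_nz by (simp add: Nsmult)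
  moreover have "L +> e \<in> carrier N" by (simp add: Ncar)
  ultimately show ?thesis using irrN adm by blast
qed

end

context corner_module
begin

text \<open>If \<open>a M \<noteq> 0\<close> then, \<open>M\<close> being generated by any of its elements, some \<open>e c a b e\<close> does not
  annihilate \<open>e M\<close>.\<close>

lemma annihilates:
  assumes irr: "irreducible_module R M" and adm: "admissible M"
    and nz: "\<exists>x\<in>carrier M. e \<odot>\<^bsub>M\<^esub> x \<noteq> \<zero>\<^bsub>M\<^esub>"
    and a: "a \<in> carrier R"
    and p0: "\<And>b c. b \<in> carrier R \<Longrightarrow> c \<in> carrier R \<Longrightarrow> p (cut (c \<otimes> a \<otimes> b)) = \<zero>\<^bsub>R'\<^esub>"
    and x: "x \<in> carrier M"
  shows "a \<odot>\<^bsub>M\<^esub> x = \<zero>\<^bsub>M\<^esub>"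
proof (rule ccontr)
  assume ax: "a \<odot>\<^bsub>M\<^esub> x \<noteq> \<zero>\<^bsub>M\<^esub>"
  interpret eM: left_module R' eM by (rule corner_left_module)
  obtain y where "y \<in> carrier M" "e \<odot>\<^bsub>M\<^esub> y \<noteq> \<zero>\<^bsub>M\<^esub>" using nz by blast
  then obtain z where zc: "z \<in> corner_carrier M" and zn: "z \<noteq> \<zero>\<^bsub>M\<^esub>"
    using in_corner_smult[OF in_corner_e] by blast
  have z: "z \<in> carrier M" "e \<odot>\<^bsub>M\<^esub> z = z" using zc by (auto simp: corner_carrier_iff)
  obtain b where b: "b \<in> carrier R" "b \<odot>\<^bsub>M\<^esub> z = x"
    using irreducible_module_transitive[OF irr z(1) zn x] .
  obtain c where c: "c \<in> carrier R" "c \<odot>\<^bsub>M\<^esub> (a \<odot>\<^bsub>M\<^esub> x) = z"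
    using irreducible_module_transitive[OF irr _ ax z(1)] a x by auto
  have "(c \<otimes> a \<otimes> b) \<odot>\<^bsub>M\<^esub> z = z"
    using a b c z x by (simp add: M.smult_assoc1)
  then have "z = p (cut (c \<otimes> a \<otimes> b)) \<odot>\<^bsub>eM\<^esub> z"
    using cut_smult[OF adm _ zc, of "c \<otimes> a \<otimes> b"] a b c z by simp
  also have "\<dots> = \<zero>\<^bsub>eM\<^esub>"
    using p0[OF b(1) c(1)] eM.smult_l_null[of z] zc by simp
  finally show False using zn by simp
qed

end

section \<open>Monoid algebras of transformation monoids\<close>

definition conv :: "(nat \<Rightarrow> nat) set \<Rightarrow> 'k::field monalg \<Rightarrow> 'k monalg \<Rightarrow> 'k monalg" where
  "conv S a b = (\<lambda>\<gamma>. \<Sum>(\<alpha>, \<beta>) \<in> {(\<alpha>, \<beta>) \<in> S \<times> S. \<alpha> \<circ> \<beta> = \<gamma>}. a \<alpha> * b \<beta>)"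

lemma monoid_algebra_simps [simp]:
  "carrier (monoid_algebra S) = {a. \<forall>\<alpha>. \<alpha> \<notin> S \<longrightarrow> a \<alpha> = 0}"
  "monoid.mult (monoid_algebra S) = conv S"
  "one (monoid_algebra S) = basis_map id"
  "zero (monoid_algebra S) = (\<lambda>\<gamma>. 0)"
  "add (monoid_algebra S) = (\<lambda>a b \<gamma>. a \<gamma> + b \<gamma>)"
  "smult (monoid_algebra S) = (\<lambda>c a \<gamma>. c * a \<gamma>)"
  by (simp_all add: monoid_algebra_def conv_def[abs_def] basis_map_def)

lemma conv_support:
  assumes "conv S a b \<gamma> \<noteq> 0"
  obtains \<alpha> \<beta> where "\<alpha> \<in> S" "\<beta> \<in> S" "\<gamma> = \<alpha> \<circ> \<beta>" "a \<alpha> \<noteq> 0" "b \<beta> \<noteq> 0"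
proof -
  have "\<exists>x\<in>{(\<alpha>, \<beta>) \<in> S \<times> S. \<alpha> \<circ> \<beta> = \<gamma>}. (case x of (\<alpha>, \<beta>) \<Rightarrow> a \<alpha> * b \<beta>) \<noteq> 0"
    using assms unfolding conv_def by (rule contrapos_np) (auto intro!: sum.neutral)
  then show ?thesis using that by auto
qed

locale finite_map_monoid =
  fixes S :: "(nat \<Rightarrow> nat) set"
  assumes fin: "finite S" and id_in: "id \<in> S"
    and comp_in: "\<alpha> \<in> S \<Longrightarrow> \<beta> \<in> S \<Longrightarrow> \<alpha> \<circ> \<beta> \<in> S"
begin

text \<open>An indicator in place of the restricted set of pairs makes the order of summation
  exchangeable.\<close>

lemma conv_sum:
  "conv S a b \<gamma> = (\<Sum>\<alpha>\<in>S. \<Sum>\<beta>\<in>S. if \<alpha> \<circ> \<beta> = \<gamma> then a \<alpha> * b \<beta> else 0)"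
proof -
  have "conv S a b \<gamma> = (\<Sum>x\<in>S \<times> S. if fst x \<circ> snd x = \<gamma> then a (fst x) * b (snd x) else 0)"
    unfolding conv_def by (rule sum.mono_neutral_cong_left) (auto simp: fin)
  then show ?thesis by (simp add: sum.cartesian_product split_def)
qed

text \<open>Both bracketings are brought to the same sum over triples. The variable
  \<open>\<epsilon>\<close> for the inner product is moved innermost, where it is summed away
  because \<open>S\<close> is closed under composition.\<close>

lemma conv_left:
  "conv S (conv S a b) c \<gamma> =
    (\<Sum>\<alpha>\<in>S. \<Sum>\<beta>\<in>S. \<Sum>\<delta>\<in>S. if \<alpha> \<circ> \<beta> \<circ> \<delta> = \<gamma> then a \<alpha> * b \<beta> * c \<delta> else 0)"
proof -
  let ?F = "\<lambda>\<epsilon> \<delta> \<alpha> \<beta>. if \<alpha> \<circ> \<beta> = \<epsilon> then (if \<epsilon> \<circ> \<delta> = \<gamma> then a \<alpha> * b \<beta> * c \<delta> else 0) else 0"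
  have "conv S (conv S a b) c \<gamma> = (\<Sum>\<epsilon>\<in>S. \<Sum>\<delta>\<in>S. \<Sum>\<alpha>\<in>S. \<Sum>\<beta>\<in>S. ?F \<epsilon> \<delta> \<alpha> \<beta>)"
    unfolding conv_sum by (intro sum.cong refl) (auto simp: sum_distrib_right intro!: sum.cong sum.neutral)
  also have "\<dots> = (\<Sum>\<delta>\<in>S. \<Sum>\<epsilon>\<in>S. \<Sum>\<alpha>\<in>S. \<Sum>\<beta>\<in>S. ?F \<epsilon> \<delta> \<alpha> \<beta>)"
    by (rule sum.swap)
  also have "\<dots> = (\<Sum>\<delta>\<in>S. \<Sum>\<alpha>\<in>S. \<Sum>\<epsilon>\<in>S. \<Sum>\<beta>\<in>S. ?F \<epsilon> \<delta> \<alpha> \<beta>)"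
    by (rule sum.cong[OF refl], rule sum.swap)
  also have "\<dots> = (\<Sum>\<alpha>\<in>S. \<Sum>\<delta>\<in>S. \<Sum>\<epsilon>\<in>S. \<Sum>\<beta>\<in>S. ?F \<epsilon> \<delta> \<alpha> \<beta>)"
    by (rule sum.swap)
  also have "\<dots> = (\<Sum>\<alpha>\<in>S. \<Sum>\<delta>\<in>S. \<Sum>\<beta>\<in>S. \<Sum>\<epsilon>\<in>S. ?F \<epsilon> \<delta> \<alpha> \<beta>)"
    by (rule sum.cong[OF refl], rule sum.cong[OF refl], rule sum.swap)
  also have "\<dots> = (\<Sum>\<alpha>\<in>S. \<Sum>\<beta>\<in>S. \<Sum>\<delta>\<in>S. \<Sum>\<epsilon>\<in>S. ?F \<epsilon> \<delta> \<alpha> \<beta>)"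
    by (rule sum.cong[OF refl], rule sum.swap)
  also have "\<dots> = (\<Sum>\<alpha>\<in>S. \<Sum>\<beta>\<in>S. \<Sum>\<delta>\<in>S. if \<alpha> \<circ> \<beta> \<circ> \<delta> = \<gamma> then a \<alpha> * b \<beta> * c \<delta> else 0)"
    by (intro sum.cong refl) (simp add: fin comp_in)
  finally show ?thesis .
qed

lemma conv_right:
  "conv S a (conv S b c) \<gamma> =
    (\<Sum>\<alpha>\<in>S. \<Sum>\<beta>\<in>S. \<Sum>\<delta>\<in>S. if \<alpha> \<circ> \<beta> \<circ> \<delta> = \<gamma> then a \<alpha> * b \<beta> * c \<delta> else 0)"
proof -
  let ?F = "\<lambda>\<epsilon> \<alpha> \<beta> \<delta>. if \<beta> \<circ> \<delta> = \<epsilon> then (if \<alpha> \<circ> \<epsilon> = \<gamma> then a \<alpha> * b \<beta> * c \<delta> else 0) else 0"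
  have "conv S a (conv S b c) \<gamma> = (\<Sum>\<alpha>\<in>S. \<Sum>\<epsilon>\<in>S. \<Sum>\<beta>\<in>S. \<Sum>\<delta>\<in>S. ?F \<epsilon> \<alpha> \<beta> \<delta>)"
    unfolding conv_sum
    by (intro sum.cong refl) (auto simp: sum_distrib_left mult.assoc intro!: sum.cong sum.neutral)
  also have "\<dots> = (\<Sum>\<alpha>\<in>S. \<Sum>\<beta>\<in>S. \<Sum>\<epsilon>\<in>S. \<Sum>\<delta>\<in>S. ?F \<epsilon> \<alpha> \<beta> \<delta>)"
    by (rule sum.cong[OF refl], rule sum.swap)
  also have "\<dots> = (\<Sum>\<alpha>\<in>S. \<Sum>\<beta>\<in>S. \<Sum>\<delta>\<in>S. \<Sum>\<epsilon>\<in>S. ?F \<epsilon> \<alpha> \<beta> \<delta>)"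
    by (rule sum.cong[OF refl], rule sum.cong[OF refl], rule sum.swap)
  also have "\<dots> = (\<Sum>\<alpha>\<in>S. \<Sum>\<beta>\<in>S. \<Sum>\<delta>\<in>S. if \<alpha> \<circ> \<beta> \<circ> \<delta> = \<gamma> then a \<alpha> * b \<beta> * c \<delta> else 0)"
    by (intro sum.cong refl) (simp add: fin comp_in comp_assoc)
  finally show ?thesis .
qed

lemma conv_assoc: "conv S (conv S a b) c = conv S a (conv S b c)"
  by (rule ext) (simp add: conv_left conv_right)

lemma conv_closed [simp]: "\<gamma> \<notin> S \<Longrightarrow> conv S a b \<gamma> = 0"
  by (auto elim: conv_support dest: comp_in)

lemma conv_add_left: "conv S (\<lambda>\<gamma>. a \<gamma> + b \<gamma>) c = (\<lambda>\<gamma>. conv S a c \<gamma> + conv S b c \<gamma>)"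
  by (rule ext) (simp add: conv_def split_def sum.distrib[symmetric] distrib_right)

lemma conv_add_right: "conv S c (\<lambda>\<gamma>. a \<gamma> + b \<gamma>) = (\<lambda>\<gamma>. conv S c a \<gamma> + conv S c b \<gamma>)"
  by (rule ext) (simp add: conv_def split_def sum.distrib[symmetric] distrib_left)

lemma conv_scale_left: "conv S (\<lambda>\<gamma>. k * a \<gamma>) b = (\<lambda>\<gamma>. k * conv S a b \<gamma>)"
  by (rule ext) (simp add: conv_def split_def sum_distrib_left mult.assoc)

lemma conv_sum_left:
  "conv S (\<lambda>\<gamma>. \<Sum>v\<in>V. f v \<gamma>) b = (\<lambda>\<gamma>. \<Sum>v\<in>V. conv S (f v) b \<gamma>)"
proof
  fix \<gamma>
  show "conv S (\<lambda>\<gamma>. \<Sum>v\<in>V. f v \<gamma>) b \<gamma> = (\<Sum>v\<in>V. conv S (f v) b \<gamma>)"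
    unfolding conv_def split_def sum_distrib_right by (rule sum.swap)
qed

lemma conv_sum_right:
  "conv S b (\<lambda>\<gamma>. \<Sum>v\<in>V. f v \<gamma>) = (\<lambda>\<gamma>. \<Sum>v\<in>V. conv S b (f v) \<gamma>)"
proof
  fix \<gamma>
  show "conv S b (\<lambda>\<gamma>. \<Sum>v\<in>V. f v \<gamma>) \<gamma> = (\<Sum>v\<in>V. conv S b (f v) \<gamma>)"
    unfolding conv_def split_def sum_distrib_left by (rule sum.swap)
qed

lemma conv_zero [simp]: "conv S (\<lambda>\<gamma>. 0) b = (\<lambda>\<gamma>. 0)" "conv S b (\<lambda>\<gamma>. 0) = (\<lambda>\<gamma>. 0)"
  by (simp_all add: conv_def)

lemma conv_basis_left:
  assumes "\<epsilon> \<in> S"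
  shows "conv S (basis_map \<epsilon>) a \<gamma> = (\<Sum>\<beta>\<in>S. if \<epsilon> \<circ> \<beta> = \<gamma> then a \<beta> else 0)"
proof -
  have "conv S (basis_map \<epsilon>) a \<gamma> =
      (\<Sum>\<alpha>\<in>S. if \<alpha> = \<epsilon> then \<Sum>\<beta>\<in>S. if \<epsilon> \<circ> \<beta> = \<gamma> then a \<beta> else 0 else 0)"
    unfolding conv_sum by (rule sum.cong) (auto simp: basis_map_def intro!: sum.cong sum.neutral)
  also have "\<dots> = (\<Sum>\<beta>\<in>S. if \<epsilon> \<circ> \<beta> = \<gamma> then a \<beta> else 0)"
    using assms fin by simp
  finally show ?thesis .
qed

lemma conv_basis_right:
  assumes "\<epsilon> \<in> S"
  shows "conv S a (basis_map \<epsilon>) \<gamma> = (\<Sum>\<alpha>\<in>S. if \<alpha> \<circ> \<epsilon> = \<gamma> then a \<alpha> else 0)"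
  unfolding conv_sum
proof (rule sum.cong)
  fix \<alpha> assume "\<alpha> \<in> S"
  have "(\<Sum>\<beta>\<in>S. if \<alpha> \<circ> \<beta> = \<gamma> then a \<alpha> * basis_map \<epsilon> \<beta> else 0) =
      (\<Sum>\<beta>\<in>S. if \<beta> = \<epsilon> then (if \<alpha> \<circ> \<epsilon> = \<gamma> then a \<alpha> else 0) else 0)"
    by (rule sum.cong) (auto simp: basis_map_def)
  then show "(\<Sum>\<beta>\<in>S. if \<alpha> \<circ> \<beta> = \<gamma> then a \<alpha> * basis_map \<epsilon> \<beta> else 0) =
      (if \<alpha> \<circ> \<epsilon> = \<gamma> then a \<alpha> else 0)"
    using assms fin by simp
qed simp

lemma conv_basis_left_fixed:
  assumes \<epsilon>: "\<epsilon> \<in> S" and supp: "\<And>\<beta>. \<beta> \<notin> S \<Longrightarrow> a \<beta> = 0"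
    and fixed: "\<And>\<beta>. a \<beta> \<noteq> 0 \<Longrightarrow> \<epsilon> \<circ> \<beta> = \<beta>"
  shows "conv S (basis_map \<epsilon>) a = a"
proof
  fix \<gamma>
  have "conv S (basis_map \<epsilon>) a \<gamma> = (\<Sum>\<beta>\<in>S. if \<beta> = \<gamma> then a \<beta> else 0)"
    unfolding conv_basis_left[OF \<epsilon>] by (rule sum.cong) (use fixed in force)+
  also have "\<dots> = a \<gamma>" using supp fin by auto
  finally show "conv S (basis_map \<epsilon>) a \<gamma> = a \<gamma>" .
qed

lemma conv_basis_right_fixed:
  assumes \<epsilon>: "\<epsilon> \<in> S" and supp: "\<And>\<beta>. \<beta> \<notin> S \<Longrightarrow> a \<beta> = 0"
    and fixed: "\<And>\<beta>. a \<beta> \<noteq> 0 \<Longrightarrow> \<beta> \<circ> \<epsilon> = \<beta>"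
  shows "conv S a (basis_map \<epsilon>) = a"
proof
  fix \<gamma>
  have "conv S a (basis_map \<epsilon>) \<gamma> = (\<Sum>\<beta>\<in>S. if \<beta> = \<gamma> then a \<beta> else 0)"
    unfolding conv_basis_right[OF \<epsilon>] by (rule sum.cong) (use fixed in force)+
  also have "\<dots> = a \<gamma>" using supp fin by auto
  finally show "conv S a (basis_map \<epsilon>) \<gamma> = a \<gamma>" .
qed

text \<open>Every map in the support of a product with \<open>basis_map \<epsilon>\<close> on the
  left has the form \<open>\<epsilon> \<circ> \<beta>'\<close>, which idempotence fixes. With the
  right-hand version, the corner of the algebra is spanned by the maps fixed by
  \<open>\<epsilon>\<close> on both sides.\<close>

lemma conv_basis_left_fixedD:
  assumes "\<epsilon> \<in> S" "\<epsilon> \<circ> \<epsilon> = \<epsilon>" "conv S (basis_map \<epsilon>) a = a" "a \<beta> \<noteq> 0"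
  shows "\<epsilon> \<circ> \<beta> = \<beta>"
proof -
  have "conv S (basis_map \<epsilon>) a \<beta> \<noteq> 0" using assms by simp
  then obtain \<beta>' where "\<beta> = \<epsilon> \<circ> \<beta>'"
    by (rule conv_support) (auto simp: basis_map_def split: if_splits)
  then show ?thesis using assms(2) by (metis comp_assoc)
qed

lemma conv_basis_right_fixedD:
  assumes "\<epsilon> \<in> S" "\<epsilon> \<circ> \<epsilon> = \<epsilon>" "conv S a (basis_map \<epsilon>) = a" "a \<beta> \<noteq> 0"
  shows "\<beta> \<circ> \<epsilon> = \<beta>"
proof -
  have "conv S a (basis_map \<epsilon>) \<beta> \<noteq> 0" using assms by simp
  then obtain \<beta>' where "\<beta> = \<beta>' \<circ> \<epsilon>"
    by (rule conv_support) (auto simp: basis_map_def split: if_splits)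
  then show ?thesis using assms(2) by (metis comp_assoc)
qed

lemma conv_basis_basis:
  assumes "\<alpha> \<in> S" "\<beta> \<in> S"
  shows "conv S (basis_map \<alpha>) (basis_map \<beta>) = basis_map (\<alpha> \<circ> \<beta>)"
proof
  fix \<gamma>
  have "conv S (basis_map \<alpha>) (basis_map \<beta>) \<gamma> =
      (\<Sum>\<delta>\<in>S. if \<delta> = \<beta> then (if \<alpha> \<circ> \<beta> = \<gamma> then 1 else 0) else 0)"
    unfolding conv_basis_left[OF assms(1)] by (rule sum.cong) (auto simp: basis_map_def)
  also have "\<dots> = basis_map (\<alpha> \<circ> \<beta>) \<gamma>"
    using assms fin by (simp add: basis_map_def)
  finally show "conv S (basis_map \<alpha>) (basis_map \<beta>) \<gamma> = basis_map (\<alpha> \<circ> \<beta>) \<gamma>" .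
qed

lemma monoid_algebra_ring: "ring (monoid_algebra S :: ('k::field, 'k monalg) module)"
proof (rule ringI)
  show "abelian_group (monoid_algebra S :: ('k, 'k monalg) module)"
  proof (rule abelian_groupI)
    fix a :: "'k monalg" assume "a \<in> carrier (monoid_algebra S)"
    then show "\<exists>b\<in>carrier (monoid_algebra S). b \<oplus>\<^bsub>monoid_algebra S\<^esub> a = \<zero>\<^bsub>monoid_algebra S\<^esub>"
      by (intro bexI[of _ "\<lambda>\<gamma>. - a \<gamma>"]) auto
  qed (auto simp: add.assoc add.commute)
  show "monoid (monoid_algebra S :: ('k, 'k monalg) module)"
  proof (rule monoidI)
    fix a :: "'k monalg" assume a: "a \<in> carrier (monoid_algebra S)"
    show "\<one>\<^bsub>monoid_algebra S\<^esub> \<otimes>\<^bsub>monoid_algebra S\<^esub> a = a"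
      using a by (simp add: conv_basis_left_fixed id_in)
    show "a \<otimes>\<^bsub>monoid_algebra S\<^esub> \<one>\<^bsub>monoid_algebra S\<^esub> = a"
      using a by (simp add: conv_basis_right_fixed id_in)
  qed (use id_in in \<open>auto simp: conv_assoc basis_map_def\<close>)
qed (simp_all add: conv_add_left conv_add_right)

lemma conv_restrict:
  assumes "T \<subseteq> S" "\<And>\<alpha>. \<alpha> \<notin> T \<Longrightarrow> a \<alpha> = 0" "\<And>\<alpha>. \<alpha> \<notin> T \<Longrightarrow> b \<alpha> = 0"
  shows "conv T a b = conv S a b"
proof
  fix \<gamma>
  show "conv T a b \<gamma> = conv S a b \<gamma>"
    unfolding conv_def
  proof (rule sum.mono_neutral_left)
    show "finite {(\<alpha>, \<beta>) \<in> S \<times> S. \<alpha> \<circ> \<beta> = \<gamma>}"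
      by (rule finite_subset[OF _ finite_cartesian_product[OF fin fin]]) auto
    show "\<forall>x\<in>{(\<alpha>, \<beta>) \<in> S \<times> S. \<alpha> \<circ> \<beta> = \<gamma>} - {(\<alpha>, \<beta>) \<in> T \<times> T. \<alpha> \<circ> \<beta> = \<gamma>}.
        (case x of (\<alpha>, \<beta>) \<Rightarrow> a \<alpha> * b \<beta>) = 0"
    proof
      fix x assume x: "x \<in> {(\<alpha>, \<beta>) \<in> S \<times> S. \<alpha> \<circ> \<beta> = \<gamma>} - {(\<alpha>, \<beta>) \<in> T \<times> T. \<alpha> \<circ> \<beta> = \<gamma>}"
      obtain \<alpha> \<beta> where \<alpha>\<beta>: "x = (\<alpha>, \<beta>)" by fastforce
      with x have "\<alpha> \<notin> T \<or> \<beta> \<notin> T" by auto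
      with assms(2,3) \<alpha>\<beta> show "(case x of (\<alpha>, \<beta>) \<Rightarrow> a \<alpha> * b \<beta>) = 0" by auto
    qed
  qed (use assms(1) in auto)
qed

end

section \<open>Ranks, permutations and idempotents in transformation monoids\<close>

text \<open>The complements of \<open>A\<close> and \<open>B\<close> in \<open>U\<close> have equal
  cardinality, and any bijection between them completes \<open>f\<close>.\<close>

lemma extend_to_permutation:
  assumes U: "finite U" and "A \<subseteq> U" "B \<subseteq> U" and f: "bij_betw f A B"
  obtains \<pi> where "\<pi> permutes U" "\<And>x. x \<in> A \<Longrightarrow> \<pi> x = f x"
proof -
  have "card (U - A) = card (U - B)"
    using assms bij_betw_same_card[OF f] by (simp add: card_Diff_subset finite_subset)
  then obtain k where k: "bij_betw k (U - A) (U - B)"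
    using U finite_same_card_bij by (metis finite_Diff)
  define \<pi> where "\<pi> x = (if x \<in> A then f x else if x \<in> U then k x else x)" for x
  have "bij_betw \<pi> (A \<union> (U - A)) (B \<union> (U - B))"
  proof (rule bij_betw_combine)
    show "bij_betw \<pi> A B"
      using f by (rule bij_betw_cong[THEN iffD1, rotated]) (simp add: \<pi>_def)
    show "bij_betw \<pi> (U - A) (U - B)"
      using k by (rule bij_betw_cong[THEN iffD1, rotated]) (simp add: \<pi>_def)
  qed auto
  moreover have "A \<union> (U - A) = U" "B \<union> (U - B) = U" using assms by auto
  ultimately have "\<pi> permutes U"
    using assms by (intro bij_imp_permutes) (auto simp: \<pi>_def)
  moreover have "\<And>x. x \<in> A \<Longrightarrow> \<pi> x = f x" by (simp add: \<pi>_def)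
  ultimately show ?thesis by (rule that)
qed

lemma tau_bar_zero: "\<alpha> \<in> tau_bar r \<Longrightarrow> \<alpha> 0 = 0"
  and tau_bar_le: "\<alpha> \<in> tau_bar r \<Longrightarrow> x \<le> r \<Longrightarrow> \<alpha> x \<le> r"
  and tau_bar_gt: "\<alpha> \<in> tau_bar r \<Longrightarrow> r < x \<Longrightarrow> \<alpha> x = x"
  by (auto simp: tau_bar_def)

text \<open>Beyond \<open>r\<close> the maps are the identity, so the list of values on
  \<open>0..r\<close> determines a map.\<close>

lemma finite_tau_bar: "finite (tau_bar r)"
proof (rule inj_on_finite)
  show "inj_on (\<lambda>\<alpha>. map \<alpha> [0..<Suc r]) (tau_bar r)"
  proof (rule inj_onI, rule ext)
    fix \<alpha> \<beta> x assume *: "\<alpha> \<in> tau_bar r" "\<beta> \<in> tau_bar r" "map \<alpha> [0..<Suc r] = map \<beta> [0..<Suc r]"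
    show "\<alpha> x = \<beta> x"
    proof (cases "x \<le> r")
      case True
      then have "x \<in> set [0..<Suc r]" by auto
      then show ?thesis using *(3) by (meson map_eq_conv)
    qed (use * in \<open>simp add: tau_bar_gt\<close>)
  qed
  show "(\<lambda>\<alpha>. map \<alpha> [0..<Suc r]) ` tau_bar r \<subseteq> {xs. set xs \<subseteq> {0..r} \<and> length xs = Suc r}"
    by (auto simp: tau_bar_def less_Suc_eq_le)
  show "finite {xs. set xs \<subseteq> {0..r} \<and> length xs = Suc r}"
    by (rule finite_lists_length_eq) simp
qed

lemma finite_sym_maps: "finite (sym_maps i)"
  by (simp add: sym_maps_def finite_permutations)

lemma sym_maps_id: "id \<in> sym_maps i"
  by (simp add: sym_maps_def permutes_id)

lemma sym_maps_comp: "\<sigma> \<in> sym_maps i \<Longrightarrow> \<tau> \<in> sym_maps i \<Longrightarrow> \<sigma> \<circ> \<tau> \<in> sym_maps i"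
  by (simp add: sym_maps_def permutes_compose)

lemma sym_maps_inv: "\<sigma> \<in> sym_maps i \<Longrightarrow> Hilbert_Choice.inv \<sigma> \<in> sym_maps i"
  by (simp add: sym_maps_def permutes_inv)

lemma sym_maps_mono: "i \<le> j \<Longrightarrow> sym_maps i \<subseteq> sym_maps j"
  by (auto simp: sym_maps_def intro: permutes_subset)

lemma sym_maps_inv_o: "\<sigma> \<in> sym_maps i \<Longrightarrow> Hilbert_Choice.inv \<sigma> \<circ> \<sigma> = id" "\<sigma> \<in> sym_maps i \<Longrightarrow> \<sigma> \<circ> Hilbert_Choice.inv \<sigma> = id"
  by (auto simp: sym_maps_def permutes_inv_o)

interpretation sym: finite_map_monoid "sym_maps i" for i
  by unfold_locales (auto simp: finite_sym_maps sym_maps_id sym_maps_comp)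

locale symmetric_map_monoid =
  fixes r :: nat and S :: "(nat \<Rightarrow> nat) set"
  assumes sym_sub: "sym_maps r \<subseteq> S" and sub_tau: "S \<subseteq> tau_bar r"
    and closed: "\<alpha> \<in> S \<Longrightarrow> \<beta> \<in> S \<Longrightarrow> \<alpha> \<circ> \<beta> \<in> S"
begin

sublocale finite_map_monoid S
  by unfold_locales (use sym_sub sub_tau closed sym_maps_id finite_tau_bar in \<open>auto intro: finite_subset\<close>)

lemma map_zero: "\<alpha> \<in> S \<Longrightarrow> \<alpha> 0 = 0"
  and map_le: "\<alpha> \<in> S \<Longrightarrow> x \<le> r \<Longrightarrow> \<alpha> x \<le> r"
  and map_gt: "\<alpha> \<in> S \<Longrightarrow> r < x \<Longrightarrow> \<alpha> x = x"
  using sub_tau tau_bar_zero tau_bar_le tau_bar_gt by blast+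

lemma rank_comp_left:
  assumes "\<alpha> \<in> S" "\<beta> \<in> S"
  shows "rank r (\<alpha> \<circ> \<beta>) \<le> rank r \<alpha>"
proof -
  have "(\<alpha> \<circ> \<beta>) ` {0..r} - {0} \<subseteq> \<alpha> ` {0..r} - {0}"
    using map_le[OF assms(2)] by fastforce
  then show ?thesis unfolding rank_def by (intro card_mono) auto
qed

text \<open>As \<open>\<alpha>\<close> fixes 0, a nonzero value of the composite comes from a
  nonzero value of \<open>\<beta>\<close>.\<close>

lemma rank_comp_right:
  assumes "\<alpha> \<in> S" "\<beta> \<in> S"
  shows "rank r (\<alpha> \<circ> \<beta>) \<le> rank r \<beta>"
proof -
  have "(\<alpha> \<circ> \<beta>) ` {0..r} - {0} \<subseteq> \<alpha> ` (\<beta> ` {0..r} - {0})"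
    using map_zero[OF assms(1)] by fastforce
  then have "card ((\<alpha> \<circ> \<beta>) ` {0..r} - {0}) \<le> card (\<alpha> ` (\<beta> ` {0..r} - {0}))"
    by (intro card_mono) auto
  also have "\<dots> \<le> card (\<beta> ` {0..r} - {0})" by (rule card_image_le) simp
  finally show ?thesis by (simp add: rank_def)
qed

lemma image_sub: "\<alpha> \<in> S \<Longrightarrow> \<alpha> ` {0..r} - {0} \<subseteq> {1..r}"
  using map_le by fastforce

lemma rank_le: "\<alpha> \<in> S \<Longrightarrow> rank r \<alpha> \<le> r"
  unfolding rank_def using card_mono[OF _ image_sub] by fastforce

lemma image_eq: "\<alpha> \<in> S \<Longrightarrow> \<alpha> ` {0..r} = insert 0 (\<alpha> ` {0..r} - {0})"
  using map_zero by force

text \<open>Let \<open>A\<close> be the nonzero part of the image and \<open>s\<close> a section of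
  \<open>\<alpha>\<close> over \<open>A\<close>. A permutation \<open>\<rho>\<close> carries
  \<open>{1..i}\<close> onto \<open>s A\<close>, and a permutation \<open>\<pi>\<close> carries
  \<open>A\<close> back so that \<open>\<pi> \<circ> \<alpha> \<circ> \<rho>\<close> is the identity
  on \<open>{1..i}\<close>; its image is \<open>{0..i}\<close>, so it is idempotent.\<close>

lemma ex_idempotent:
  assumes \<alpha>: "\<alpha> \<in> S" and i: "rank r \<alpha> = i"
  shows "\<exists>\<epsilon>\<in>S. \<epsilon> \<circ> \<epsilon> = \<epsilon> \<and> \<epsilon> ` {0..r} = {0..i}"
proof -
  define A where "A = \<alpha> ` {0..r} - {0}"
  have A: "A \<subseteq> {1..r}" "card A = i" "finite A"
    using image_sub[OF \<alpha>] i by (auto simp: A_def rank_def)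
  have "\<forall>a\<in>A. \<exists>x. x \<in> {0..r} \<and> \<alpha> x = a" by (auto simp: A_def)
  then obtain s where s: "\<And>a. a \<in> A \<Longrightarrow> s a \<in> {0..r} \<and> \<alpha> (s a) = a" by metis
  have s_bij: "bij_betw s A (s ` A)"
    by (intro bij_betw_imageI inj_onI) (metis s, simp)
  \<comment> \<open>A preimage of a nonzero value is nonzero, because \<open>\<alpha>\<close> fixes
    0; the permutations of \<open>{1..r}\<close> can therefore reach it.\<close>
  have sA: "s ` A \<subseteq> {1..r}"
  proof safe
    fix a assume "a \<in> A"
    then show "s a \<in> {1..r}"
      using s[of a] map_zero[OF \<alpha>] by (cases "s a") (auto simp: A_def)
  qed
  have i_le: "{1..i} \<subseteq> {1..r}" using rank_le[OF \<alpha>] i by auto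
  have "card (s ` A) = i" using s_bij A bij_betw_same_card by metis
  then obtain f where f: "bij_betw f {1..i} (s ` A)"
    using finite_same_card_bij[of "{1..i}" "s ` A"] A by auto
  obtain \<rho> where \<rho>: "\<rho> permutes {1..r}" "\<And>x. x \<in> {1..i} \<Longrightarrow> \<rho> x = f x"
    using extend_to_permutation[OF _ i_le sA f] by auto
  have g: "bij_betw (inv_into {1..i} f \<circ> s) A {1..i}"
    using bij_betw_trans[OF s_bij bij_betw_inv_into[OF f]] .
  obtain \<pi> where \<pi>: "\<pi> permutes {1..r}" "\<And>x. x \<in> A \<Longrightarrow> \<pi> x = inv_into {1..i} f (s x)"
    using extend_to_permutation[OF _ A(1) i_le g] by auto
  define \<epsilon> where "\<epsilon> = \<pi> \<circ> \<alpha> \<circ> \<rho>"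
  have S: "\<pi> \<in> S" "\<rho> \<in> S" using \<pi> \<rho> sym_sub by (auto simp: sym_maps_def)
  then have \<epsilon>S: "\<epsilon> \<in> S" using \<alpha> by (simp add: \<epsilon>_def closed)
  have fixed: "\<epsilon> x = x" if "x \<in> {1..i}" for x
  proof -
    have "f x \<in> s ` A" using f that by (rule bij_betwE[rule_format])
    then obtain a where a: "a \<in> A" "f x = s a" by blast
    then have "\<epsilon> x = inv_into {1..i} f (f x)"
      using s[of a] \<rho>(2)[OF that] \<pi>(2)[of a] by (simp add: \<epsilon>_def)
    also have "\<dots> = x" using f that by (simp add: bij_betw_def)
    finally show ?thesis .
  qed
  have "\<rho> ` {0..r} = {0..r}"
  proof -
    have "{0..r} = insert 0 {1..r}" by auto
    then show ?thesis using permutes_image[OF \<rho>(1)] map_zero[OF S(2)] by (metis image_insert)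
  qed
  then have "\<epsilon> ` {0..r} = \<pi> ` (\<alpha> ` {0..r})" by (metis \<epsilon>_def image_comp)
  also have "\<dots> = insert 0 (\<pi> ` A)"
    using image_eq[OF \<alpha>] map_zero[OF S(1)] by (metis A_def image_insert)
  also have "\<pi> ` A = (inv_into {1..i} f \<circ> s) ` A" by (rule image_cong) (simp_all add: \<pi>)
  also have "\<dots> = {1..i}" using g by (simp add: bij_betw_def)
  finally have im: "\<epsilon> ` {0..r} = {0..i}" by auto
  have "\<epsilon> (\<epsilon> x) = \<epsilon> x" for x
  proof (cases "x \<le> r")
    case True
    then have "\<epsilon> x \<in> {0..i}" using im by (metis atLeastAtMost_iff image_eqI le0)
    then show ?thesis using fixed[of "\<epsilon> x"] map_zero[OF \<epsilon>S] by (cases "\<epsilon> x = 0") auto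
  qed (simp add: map_gt[OF \<epsilon>S])
  then have "\<epsilon> \<circ> \<epsilon> = \<epsilon>" by (intro ext) simp
  then show ?thesis using \<epsilon>S im by blast
qed

end

locale apex = symmetric_map_monoid +
  fixes i \<epsilon>
  assumes \<epsilon>_in: "\<epsilon> \<in> S" and \<epsilon>_idem: "\<epsilon> \<circ> \<epsilon> = \<epsilon>" and \<epsilon>_image: "\<epsilon> ` {0..r} = {0..i}"
begin

lemma i_le: "i \<le> r"
  using \<epsilon>_image map_le[OF \<epsilon>_in] by (metis atLeastAtMost_iff image_iff le0 order_refl)

lemma \<epsilon>_fixed: "x \<le> i \<Longrightarrow> \<epsilon> x = x"
  using \<epsilon>_image fun_cong[OF \<epsilon>_idem] by (metis atLeastAtMost_iff comp_apply image_iff le0)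

lemma \<epsilon>_le: "x \<le> r \<Longrightarrow> \<epsilon> x \<le> i"
  using \<epsilon>_image by (metis atLeastAtMost_iff image_eqI le0)

lemma \<epsilon>_comp_fixed:
  assumes "\<alpha> \<in> S" and "\<And>x. x \<le> r \<Longrightarrow> \<alpha> x \<le> i"
  shows "\<epsilon> \<circ> \<alpha> = \<alpha>"
proof
  fix x
  show "(\<epsilon> \<circ> \<alpha>) x = \<alpha> x"
    using assms \<epsilon>_fixed map_gt[OF \<epsilon>_in] map_gt[OF assms(1)] by (cases "x \<le> r") auto
qed

text \<open>A permutation \<open>\<pi>\<close> moves the \<open>i\<close> nonzero values of
  \<open>\<alpha>\<close> into \<open>{1..i}\<close>, where \<open>\<epsilon>\<close> is the
  identity; so \<open>\<pi> \<circ> \<alpha>\<close> absorbs \<open>\<epsilon>\<close> on the left.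
  Consequently an \<open>\<epsilon>\<close> that annihilates a module forces all maps of rank
  \<open>i\<close> to annihilate it.\<close>

lemma factor:
  assumes \<alpha>: "\<alpha> \<in> S" and rank: "rank r \<alpha> = i"
  shows "\<exists>\<sigma>\<in>S. \<exists>\<tau>\<in>S. \<alpha> = \<sigma> \<circ> \<epsilon> \<circ> \<tau>"
proof -
  define A where "A = \<alpha> ` {0..r} - {0}"
  have A: "A \<subseteq> {1..r}" "card A = i" "finite A"
    using image_sub[OF \<alpha>] rank by (auto simp: A_def rank_def)
  obtain f where "bij_betw f A {1..i}"
    using finite_same_card_bij[of A "{1..i}"] A by auto
  then obtain \<pi> where \<pi>: "\<pi> permutes {1..r}" "\<And>x. x \<in> A \<Longrightarrow> \<pi> x \<in> {1..i}"
    using extend_to_permutation[of "{1..r}" A "{1..i}" f] A i_le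
    by (metis (no_types, lifting) atLeastatMost_subset_iff bij_betwE finite_atLeastAtMost order_refl)
  have \<pi>S: "\<pi> \<in> S" "Hilbert_Choice.inv \<pi> \<in> S"
    using \<pi>(1) sym_sub permutes_inv[OF \<pi>(1)] by (auto simp: sym_maps_def)
  have "\<epsilon> \<circ> (\<pi> \<circ> \<alpha>) = \<pi> \<circ> \<alpha>"
  proof (rule \<epsilon>_comp_fixed)
    show "\<pi> \<circ> \<alpha> \<in> S" using \<pi>S \<alpha> closed by blast
    fix x assume "x \<le> r"
    then have "\<alpha> x = 0 \<or> \<alpha> x \<in> A" by (auto simp: A_def)
    then show "(\<pi> \<circ> \<alpha>) x \<le> i" using \<pi>(2)[of "\<alpha> x"] map_zero[OF \<pi>S(1)] by auto
  qed
  then have "Hilbert_Choice.inv \<pi> \<circ> \<epsilon> \<circ> (\<pi> \<circ> \<alpha>) = Hilbert_Choice.inv \<pi> \<circ> \<pi> \<circ> \<alpha>" by (simp add: comp_assoc)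
  then have "\<alpha> = Hilbert_Choice.inv \<pi> \<circ> \<epsilon> \<circ> (\<pi> \<circ> \<alpha>)" using permutes_inv_o(2)[OF \<pi>(1)] by simp
  then show ?thesis using \<pi>S \<alpha> closed by blast
qed

lemma sym_i_sub: "sym_maps i \<subseteq> S"
  using sym_maps_mono[OF i_le] sym_sub by blast

lemma sym_\<epsilon>:
  assumes "\<sigma> \<in> sym_maps i"
  shows "\<epsilon> \<circ> (\<sigma> \<circ> \<epsilon>) = \<sigma> \<circ> \<epsilon>"
proof (rule \<epsilon>_comp_fixed)
  show "\<sigma> \<circ> \<epsilon> \<in> S" using assms sym_i_sub \<epsilon>_in closed by blast
  fix x assume "x \<le> r"
  then have "\<epsilon> x \<le> i" by (rule \<epsilon>_le)
  moreover have "\<sigma> y \<le> i" if "y \<le> i" for y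
    using assms that permutes_in_image[of \<sigma> "{1..i}" y] permutes_not_in[of \<sigma> "{1..i}" y]
    by (cases "y = 0") (auto simp: sym_maps_def)
  ultimately show "(\<sigma> \<circ> \<epsilon>) x \<le> i" by simp
qed

lemma sym_\<epsilon>_inj:
  assumes "\<sigma> \<in> sym_maps i" "\<tau> \<in> sym_maps i" "\<sigma> \<circ> \<epsilon> = \<tau> \<circ> \<epsilon>"
  shows "\<sigma> = \<tau>"
proof
  fix x
  show "\<sigma> x = \<tau> x"
  proof (cases "x \<in> {1..i}")
    case True
    then show ?thesis using fun_cong[OF assms(3), of x] \<epsilon>_fixed[of x] by simp
  next
    case False
    then show ?thesis using assms permutes_not_in by (metis mem_Collect_eq sym_maps_def)
  qed
qed

lemma rank_sym_\<epsilon>: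
  assumes "\<sigma> \<in> sym_maps i"
  shows "rank r (\<sigma> \<circ> \<epsilon>) = i"
proof -
  have \<sigma>: "\<sigma> permutes {1..i}" using assms by (simp add: sym_maps_def)
  have "{0..i} = insert 0 {1..i}" by auto
  then have "\<sigma> ` {0..i} = {0..i}"
    using permutes_image[OF \<sigma>] permutes_not_in[OF \<sigma>, of 0] by (metis atLeastAtMost_iff image_insert not_one_le_zero)
  then have "(\<sigma> \<circ> \<epsilon>) ` {0..r} = {0..i}" by (metis \<epsilon>_image image_comp)
  moreover have "{0..i} - {0} = {1..i}" by auto
  ultimately show ?thesis by (simp add: rank_def)
qed

lemma rank_\<epsilon>: "rank r \<epsilon> = i"
  using rank_sym_\<epsilon>[OF sym_maps_id] by simp

text \<open>Such an \<open>\<alpha>\<close> takes values in \<open>{0..i}\<close> and is determined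
  by its restriction to \<open>{0..i}\<close>. Rank at least \<open>i\<close> makes it hit all of
  \<open>{1..i}\<close> from \<open>{1..i}\<close>, so by counting it permutes that set. These maps
  form the unit group of the monoid of maps in \<open>S\<close> fixed by \<open>\<epsilon>\<close>
  on both sides.\<close>

lemma corner_units:
  assumes \<alpha>: "\<alpha> \<in> S" "\<epsilon> \<circ> \<alpha> = \<alpha>" "\<alpha> \<circ> \<epsilon> = \<alpha>" and rank: "i \<le> rank r \<alpha>"
  shows "\<exists>\<sigma>\<in>sym_maps i. \<alpha> = \<sigma> \<circ> \<epsilon>"
proof -
  have le: "\<alpha> x \<le> i" if "x \<le> r" for x
    using fun_cong[OF \<alpha>(2), of x] \<epsilon>_le[OF map_le[OF \<alpha>(1) that]] by simp
  have "\<alpha> ` {0..r} \<subseteq> \<alpha> ` {0..i}"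
  proof safe
    fix x assume "x \<in> {0..r}"
    then show "\<alpha> x \<in> \<alpha> ` {0..i}"
      using fun_cong[OF \<alpha>(3), of x] \<epsilon>_le[of x] by (metis atLeastAtMost_iff comp_apply image_eqI le0)
  qed
  have sub: "\<alpha> ` {0..r} - {0} \<subseteq> \<alpha> ` {1..i}"
  proof
    fix z assume "z \<in> \<alpha> ` {0..r} - {0}"
    with \<open>\<alpha> ` {0..r} \<subseteq> \<alpha> ` {0..i}\<close> obtain y where y: "y \<le> i" "z = \<alpha> y" "z \<noteq> 0"
      by force
    with map_zero[OF \<alpha>(1)] have "y \<noteq> 0" by metis
    with y show "z \<in> \<alpha> ` {1..i}" by auto
  qed
  have sub2: "\<alpha> ` {0..r} - {0} \<subseteq> {1..i}" using le by fastforce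
  have "\<alpha> ` {0..r} - {0} = {1..i}"
    using rank by (intro card_subset_eq sub2) (use card_mono[OF _ sub2] in \<open>auto simp: rank_def\<close>)
  with sub have sup: "{1..i} \<subseteq> \<alpha> ` {1..i}" by simp
  have inj: "inj_on \<alpha> {1..i}"
    using card_mono[OF _ sup] card_image_le[of "{1..i}" \<alpha>] by (intro eq_card_imp_inj_on) auto
  have "\<alpha> ` {1..i} = {1..i}"
    using sup inj by (intro card_subset_eq[symmetric]) (auto simp: card_image)
  with inj have bij: "bij_betw \<alpha> {1..i} {1..i}" by (simp add: bij_betw_def)
  define \<sigma> where "\<sigma> x = (if x \<in> {1..i} then \<alpha> x else x)" for x
  have "\<sigma> permutes {1..i}"
  proof (rule bij_imp_permutes)
    show "bij_betw \<sigma> {1..i} {1..i}"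
      using bij by (rule bij_betw_cong[THEN iffD1, rotated]) (simp add: \<sigma>_def)
  qed (auto simp: \<sigma>_def)
  moreover have "\<alpha> = \<sigma> \<circ> \<epsilon>"
  proof
    fix x
    show "\<alpha> x = (\<sigma> \<circ> \<epsilon>) x"
    proof (cases "x \<le> r")
      case True
      have "\<sigma> y = \<alpha> y" if "y \<le> i" for y
        using that map_zero[OF \<alpha>(1)] by (cases "y = 0") (auto simp: \<sigma>_def)
      then show ?thesis using fun_cong[OF \<alpha>(3), of x] \<epsilon>_le[OF True] by simp
    next
      case False
      then show ?thesis
        using map_gt[OF \<alpha>(1), of x] map_gt[OF \<epsilon>_in, of x] i_le by (simp add: \<sigma>_def)
    qed
  qed
  ultimately show ?thesis by (auto simp: sym_maps_def)
qed

end

context finite_map_monoid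
begin

text \<open>Induction on a finite set containing the support, splitting off one term at a
  time.\<close>

lemma annihilated_by_support:
  fixes N :: "('k::field monalg, 'v) module"
  assumes N: "left_module (monoid_algebra S) N" and x: "x \<in> carrier N"
    and a: "a \<in> carrier (monoid_algebra S)"
    and zero: "\<And>\<alpha>. \<alpha> \<in> S \<Longrightarrow> a \<alpha> \<noteq> 0 \<Longrightarrow> basis_map \<alpha> \<odot>\<^bsub>N\<^esub> x = \<zero>\<^bsub>N\<^esub>"
  shows "a \<odot>\<^bsub>N\<^esub> x = \<zero>\<^bsub>N\<^esub>"
proof -
  interpret N: left_module "monoid_algebra S" N by fact
  have "a \<odot>\<^bsub>N\<^esub> x = \<zero>\<^bsub>N\<^esub>"
    if "F \<subseteq> S" "a \<in> carrier (monoid_algebra S)" "\<And>\<alpha>. a \<alpha> \<noteq> 0 \<Longrightarrow> \<alpha> \<in> F"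
      "\<And>\<alpha>. \<alpha> \<in> S \<Longrightarrow> a \<alpha> \<noteq> 0 \<Longrightarrow> basis_map \<alpha> \<odot>\<^bsub>N\<^esub> x = \<zero>\<^bsub>N\<^esub>" for F a
    using finite_subset[OF that(1) fin] that
  proof (induction F arbitrary: a rule: finite_induct)
    case empty
    then have "a = \<zero>\<^bsub>monoid_algebra S\<^esub>" by auto
    then show ?case using N.smult_l_null[OF x] by simp
  next
    case (insert \<alpha> F)
    define b where "b = a(\<alpha> := 0)"
    \<comment> \<open>Only the ring acts on \<open>N\<close>, so the scalar
      \<open>a \<alpha>\<close> has to be applied as a multiple of the unit.\<close>
    define c where "c = (\<lambda>\<gamma>. a \<alpha> * basis_map id \<gamma>)"
    have \<alpha>: "\<alpha> \<in> S" using insert by auto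
    have bc: "b \<in> carrier (monoid_algebra S)" "c \<in> carrier (monoid_algebra S)"
        "basis_map \<alpha> \<in> carrier (monoid_algebra S)"
      using insert.prems(2) \<alpha> id_in by (auto simp: b_def c_def basis_map_def)
    have bx: "b \<odot>\<^bsub>N\<^esub> x = \<zero>\<^bsub>N\<^esub>"
    proof (rule insert.IH)
      show "F \<subseteq> S" using insert.prems(1) by auto
      show "b \<in> carrier (monoid_algebra S)" by fact
      show "\<And>\<alpha>'. b \<alpha>' \<noteq> 0 \<Longrightarrow> \<alpha>' \<in> F"
        using insert.prems(3) by (auto simp: b_def split: if_splits)
      show "\<And>\<alpha>'. \<alpha>' \<in> S \<Longrightarrow> b \<alpha>' \<noteq> 0 \<Longrightarrow> basis_map \<alpha>' \<odot>\<^bsub>N\<^esub> x = \<zero>\<^bsub>N\<^esub>"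
        using insert.prems(4) by (auto simp: b_def split: if_splits)
    qed
    have "conv S c (basis_map \<alpha>) = (\<lambda>\<gamma>. a \<alpha> * basis_map \<alpha> \<gamma>)"
      unfolding c_def conv_scale_left by (simp add: conv_basis_basis[OF id_in \<alpha>])
    then have "a = b \<oplus>\<^bsub>monoid_algebra S\<^esub> (c \<otimes>\<^bsub>monoid_algebra S\<^esub> basis_map \<alpha>)"
      by (auto simp: b_def basis_map_def)
    then have "a \<odot>\<^bsub>N\<^esub> x = b \<odot>\<^bsub>N\<^esub> x \<oplus>\<^bsub>N\<^esub> c \<odot>\<^bsub>N\<^esub> (basis_map \<alpha> \<odot>\<^bsub>N\<^esub> x)"
      using N.smult_l_distr[OF bc(1) N.R.m_closed[OF bc(2,3)] x] N.smult_assoc1[OF bc(2,3) x]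
      by metis
    moreover have "c \<odot>\<^bsub>N\<^esub> (basis_map \<alpha> \<odot>\<^bsub>N\<^esub> x) = \<zero>\<^bsub>N\<^esub>"
    proof (cases "a \<alpha> = 0")
      case True
      then have "c = \<zero>\<^bsub>monoid_algebra S\<^esub>" by (simp add: c_def)
      then show ?thesis using N.smult_l_null[OF N.smult_closed[OF bc(3) x]] by simp
    next
      case False
      then show ?thesis using insert.prems(4)[OF \<alpha>] N.smult_r_null[OF bc(2)] by simp
    qed
    ultimately show ?case using bx by simp
  qed
  from this[OF order_refl a _ zero] a show ?thesis by auto
qed

end

section \<open>The corner of the monoid algebra at an idempotent map of rank
  \<open>i\<close>\<close>

context apex
begin

text \<open>The product lands in the two-sided corner although \<open>\<epsilon>\<close> is applied
  on the right only, since \<open>\<sigma> \<circ> \<epsilon>\<close> already takes its values on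
  \<open>{0..r}\<close> in \<open>{0..i}\<close>.\<close>

definition to_corner :: "'k::field monalg \<Rightarrow> 'k monalg" where
  "to_corner b = conv S b (basis_map \<epsilon>)"

text \<open>It keeps the coefficients at the units \<open>\<sigma> \<circ> \<epsilon>\<close> and
  forgets the maps of smaller rank. Those span an ideal of the corner, because composition does not
  increase rank.\<close>

definition of_corner :: "'k::field monalg \<Rightarrow> 'k monalg" where
  "of_corner a = (\<lambda>\<sigma>. if \<sigma> \<in> sym_maps i then a (\<sigma> \<circ> \<epsilon>) else 0)"

lemma to_corner_support:
  assumes b: "b \<in> carrier (monoid_algebra (sym_maps i))" and nz: "to_corner b \<gamma> \<noteq> 0"
  shows "\<epsilon> \<circ> \<gamma> = \<gamma>" "\<gamma> \<circ> \<epsilon> = \<gamma>"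
proof -
  obtain \<sigma> \<beta> where "b \<sigma> \<noteq> 0" "basis_map \<epsilon> \<beta> \<noteq> (0::'a)" "\<gamma> = \<sigma> \<circ> \<beta>"
    using nz unfolding to_corner_def by (rule conv_support)
  then have "\<sigma> \<in> sym_maps i" "\<gamma> = \<sigma> \<circ> \<epsilon>"
    using b by (auto simp: basis_map_def split: if_splits)
  then show "\<epsilon> \<circ> \<gamma> = \<gamma>" "\<gamma> \<circ> \<epsilon> = \<gamma>"
    using sym_\<epsilon> \<epsilon>_idem by (simp_all add: comp_assoc)
qed

lemma of_corner_to_corner:
  assumes b: "b \<in> carrier (monoid_algebra (sym_maps i))"
  shows "of_corner (to_corner b) = b"
proof
  fix \<sigma>
  show "of_corner (to_corner b) \<sigma> = b \<sigma>"
  proof (cases "\<sigma> \<in> sym_maps i")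
    case True
    have "to_corner b (\<sigma> \<circ> \<epsilon>) = (\<Sum>\<alpha>\<in>S. if \<alpha> \<circ> \<epsilon> = \<sigma> \<circ> \<epsilon> then b \<alpha> else 0)"
      unfolding to_corner_def by (rule conv_basis_right[OF \<epsilon>_in])
    also have "\<dots> = (\<Sum>\<alpha>\<in>S. if \<alpha> = \<sigma> then b \<alpha> else 0)"
    proof (rule sum.cong)
      fix \<alpha> assume "\<alpha> \<in> S"
      show "(if \<alpha> \<circ> \<epsilon> = \<sigma> \<circ> \<epsilon> then b \<alpha> else 0) = (if \<alpha> = \<sigma> then b \<alpha> else 0)"
        using b sym_\<epsilon>_inj[OF _ True, of \<alpha>] by (cases "\<alpha> \<in> sym_maps i") auto
    qed simp
    also have "\<dots> = b \<sigma>" using True sym_i_sub fin by auto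
    finally show ?thesis using True by (simp add: of_corner_def)
  qed (use b in \<open>simp add: of_corner_def\<close>)
qed

lemma corner_support:
  assumes "conv S (basis_map \<epsilon>) a = a" "conv S a (basis_map \<epsilon>) = a" "a \<alpha> \<noteq> 0"
  shows "\<epsilon> \<circ> \<alpha> = \<alpha>" "\<alpha> \<circ> \<epsilon> = \<alpha>"
  using conv_basis_left_fixedD[OF \<epsilon>_in \<epsilon>_idem] conv_basis_right_fixedD[OF \<epsilon>_in \<epsilon>_idem] assms
  by blast+

text \<open>If \<open>\<alpha> \<circ> \<beta> = \<sigma> \<circ> \<epsilon>\<close> has rank
  \<open>i\<close>, then both factors have rank at least \<open>i\<close>; when they also lie in the
  corner they are units \<open>\<tau> \<circ> \<epsilon>\<close> and
  \<open>\<rho> \<circ> \<epsilon>\<close>. So the factorizations of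
  \<open>\<sigma> \<circ> \<epsilon>\<close> with nonzero coefficients all come from factorizations
  \<open>\<sigma> = \<tau> \<circ> \<rho>\<close> in the symmetric group.\<close>

lemma of_corner_mult:
  assumes a: "conv S (basis_map \<epsilon>) a = a" "conv S a (basis_map \<epsilon>) = a"
    and b: "conv S (basis_map \<epsilon>) b = b" "conv S b (basis_map \<epsilon>) = b"
  shows "of_corner (conv S a b) = conv (sym_maps i) (of_corner a) (of_corner b)"
proof
  fix \<sigma>
  show "of_corner (conv S a b) \<sigma> = conv (sym_maps i) (of_corner a) (of_corner b) \<sigma>"
  proof (cases "\<sigma> \<in> sym_maps i")
    case True
    let ?T = "{(\<alpha>, \<beta>) \<in> S \<times> S. \<alpha> \<circ> \<beta> = \<sigma> \<circ> \<epsilon>}"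
    let ?U = "{(\<tau>, \<rho>) \<in> sym_maps i \<times> sym_maps i. \<tau> \<circ> \<rho> = \<sigma>}"
    let ?h = "\<lambda>(\<tau>, \<rho>). (\<tau> \<circ> \<epsilon>, \<rho> \<circ> \<epsilon>)"
    have mult_\<epsilon>: "(\<tau> \<circ> \<epsilon>) \<circ> (\<rho> \<circ> \<epsilon>) = (\<tau> \<circ> \<rho>) \<circ> \<epsilon>" if "\<rho> \<in> sym_maps i" for \<tau> \<rho>
      using sym_\<epsilon>[OF that] by (simp add: comp_assoc)
    have inj: "inj_on ?h ?U"
      by (rule inj_onI) (auto dest: sym_\<epsilon>_inj)
    have sub: "?h ` ?U \<subseteq> ?T"
    proof
      fix x assume "x \<in> ?h ` ?U"
      then obtain \<tau> \<rho> where "x = (\<tau> \<circ> \<epsilon>, \<rho> \<circ> \<epsilon>)" "\<tau> \<in> sym_maps i" "\<rho> \<in> sym_maps i" "\<tau> \<circ> \<rho> = \<sigma>"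
        by auto
      then show "x \<in> ?T"
        using mult_\<epsilon>[of \<rho> \<tau>] sym_i_sub closed[OF _ \<epsilon>_in] by (simp add: subset_iff)
    qed
    have neutral: "a \<alpha> * b \<beta> = 0" if "(\<alpha>, \<beta>) \<in> ?T - ?h ` ?U" for \<alpha> \<beta>
    proof (rule ccontr)
      assume "a \<alpha> * b \<beta> \<noteq> 0"
      then have nz: "a \<alpha> \<noteq> 0" "b \<beta> \<noteq> 0" by auto
      have S: "\<alpha> \<in> S" "\<beta> \<in> S" "\<alpha> \<circ> \<beta> = \<sigma> \<circ> \<epsilon>" using that by auto
      then have "i \<le> rank r \<alpha>" "i \<le> rank r \<beta>"
        using rank_comp_left[OF S(1,2)] rank_comp_right[OF S(1,2)] rank_sym_\<epsilon>[OF True] by auto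
      then obtain \<tau> \<rho> where \<tau>: "\<tau> \<in> sym_maps i" "\<alpha> = \<tau> \<circ> \<epsilon>" and \<rho>: "\<rho> \<in> sym_maps i" "\<beta> = \<rho> \<circ> \<epsilon>"
        using corner_units[OF S(1) corner_support[OF a nz(1)]]
          corner_units[OF S(2) corner_support[OF b nz(2)]] by blast
      have "\<tau> \<circ> \<rho> = \<sigma>"
        using sym_\<epsilon>_inj[OF sym_maps_comp[OF \<tau>(1) \<rho>(1)] True] S(3)
        unfolding \<tau>(2) \<rho>(2) mult_\<epsilon>[OF \<rho>(1)] .
      with \<tau> \<rho> have "(\<alpha>, \<beta>) \<in> ?h ` ?U" by force
      with that show False by blast
    qed
    have finT: "finite ?T"
      by (rule finite_subset[OF _ finite_cartesian_product[OF fin fin]]) auto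
    have "of_corner (conv S a b) \<sigma> = (\<Sum>(\<alpha>, \<beta>)\<in>?T. a \<alpha> * b \<beta>)"
      using True by (simp add: of_corner_def conv_def)
    also have "\<dots> = (\<Sum>(\<alpha>, \<beta>)\<in>?h ` ?U. a \<alpha> * b \<beta>)"
    proof (rule sum.mono_neutral_right[OF finT sub], rule ballI)
      fix x assume x: "x \<in> ?T - ?h ` ?U"
      obtain \<alpha> \<beta> where \<alpha>\<beta>: "x = (\<alpha>, \<beta>)" by fastforce
      show "(case x of (\<alpha>, \<beta>) \<Rightarrow> a \<alpha> * b \<beta>) = 0"
        using neutral[OF x[unfolded \<alpha>\<beta>]] by (simp add: \<alpha>\<beta>)
    qed
    also have "\<dots> = (\<Sum>x\<in>?U. (\<lambda>(\<alpha>, \<beta>). a \<alpha> * b \<beta>) (?h x))"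
      using sum.reindex[OF inj] by simp
    also have "\<dots> = conv (sym_maps i) (of_corner a) (of_corner b) \<sigma>"
      unfolding conv_def by (rule sum.cong) (auto simp: of_corner_def)
    finally show ?thesis .
  qed (simp add: of_corner_def)
qed

lemma corner_retract_monoid_algebra:
  "corner_retract (monoid_algebra S :: ('k::field, 'k monalg) module)
     (monoid_algebra (sym_maps i) :: ('k, 'k monalg) module) (basis_map \<epsilon>) to_corner of_corner"
proof -
  have sub: "b \<alpha> = 0" if "b \<in> carrier (monoid_algebra (sym_maps i))" "\<alpha> \<notin> S" for b :: "'k monalg" and \<alpha>
    using that sym_i_sub by auto
  have left: "conv S (basis_map \<epsilon>) (to_corner b) = to_corner b"
    if "b \<in> carrier (monoid_algebra (sym_maps i))" for b :: "'k monalg"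
    by (rule conv_basis_left_fixed[OF \<epsilon>_in]) (use to_corner_support[OF that] in \<open>auto simp: to_corner_def\<close>)
  have right: "conv S (to_corner b) (basis_map \<epsilon>) = to_corner b"
    if "b \<in> carrier (monoid_algebra (sym_maps i))" for b :: "'k monalg"
    by (rule conv_basis_right_fixed[OF \<epsilon>_in]) (use to_corner_support[OF that] in \<open>auto simp: to_corner_def\<close>)
  show ?thesis
  proof (intro corner_retract.intro corner_retract_axioms.intro monoid_algebra_ring sym.monoid_algebra_ring)
    fix b c :: "'k monalg"
    assume b: "b \<in> carrier (monoid_algebra (sym_maps i))" and c: "c \<in> carrier (monoid_algebra (sym_maps i))"
    have "to_corner (conv (sym_maps i) b c) = to_corner (conv S b c)"
      using conv_restrict[OF sym_i_sub, of b c] b c by simp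
    also have "\<dots> = conv S b (conv S (basis_map \<epsilon>) (to_corner c))"
      using left[OF c] by (simp add: to_corner_def conv_assoc)
    also have "\<dots> = conv S (to_corner b) (to_corner c)"
      by (simp add: to_corner_def conv_assoc)
    finally show "to_corner (b \<otimes>\<^bsub>monoid_algebra (sym_maps i)\<^esub> c) =
        to_corner b \<otimes>\<^bsub>monoid_algebra S\<^esub> to_corner c" by simp
  next
    show "to_corner \<one>\<^bsub>monoid_algebra (sym_maps i)\<^esub> = (basis_map \<epsilon> :: 'k monalg)"
      by (simp add: to_corner_def conv_basis_basis id_in \<epsilon>_in)
  next
    fix a b :: "'k monalg"
    assume "a \<in> carrier (monoid_algebra S)"
      "basis_map \<epsilon> \<otimes>\<^bsub>monoid_algebra S\<^esub> a = a" "a \<otimes>\<^bsub>monoid_algebra S\<^esub> basis_map \<epsilon> = a"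
      "b \<in> carrier (monoid_algebra S)"
      "basis_map \<epsilon> \<otimes>\<^bsub>monoid_algebra S\<^esub> b = b" "b \<otimes>\<^bsub>monoid_algebra S\<^esub> basis_map \<epsilon> = b"
    then show "of_corner (a \<otimes>\<^bsub>monoid_algebra S\<^esub> b) =
        of_corner a \<otimes>\<^bsub>monoid_algebra (sym_maps i)\<^esub> of_corner b"
      by (simp add: of_corner_mult)
  next
    fix a b :: "'k monalg"
    show "of_corner (a \<oplus>\<^bsub>monoid_algebra S\<^esub> b) =
        of_corner a \<oplus>\<^bsub>monoid_algebra (sym_maps i)\<^esub> of_corner b"
      by (auto simp: of_corner_def)
    show "to_corner (a \<oplus>\<^bsub>monoid_algebra (sym_maps i)\<^esub> b) =
        to_corner a \<oplus>\<^bsub>monoid_algebra S\<^esub> to_corner b"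
      by (simp add: to_corner_def conv_add_left)
    show "to_corner a \<in> carrier (monoid_algebra S)" by (simp add: to_corner_def)
    show "of_corner a \<in> carrier (monoid_algebra (sym_maps i))" by (simp add: of_corner_def)
  next
    show "basis_map \<epsilon> \<in> carrier (monoid_algebra S :: ('k, 'k monalg) module)"
      using \<epsilon>_in by (auto simp: basis_map_def)
  next
    show "basis_map \<epsilon> \<otimes>\<^bsub>monoid_algebra S\<^esub> basis_map \<epsilon> = (basis_map \<epsilon> :: 'k monalg)"
      by (simp add: conv_basis_basis \<epsilon>_in \<epsilon>_idem)
  qed (simp_all add: left right of_corner_to_corner)
qed

abbreviation kS :: "('k::field, 'k monalg) module" where "kS \<equiv> monoid_algebra S"
abbreviation kG :: "('k::field, 'k monalg) module" where "kG \<equiv> monoid_algebra (sym_maps i)"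

text \<open>A vector of the corner is unchanged by \<open>\<epsilon>\<close>, so \<open>b\<close>
  and \<open>to_corner b\<close> act on it alike. The unrestricted action used in
  \<open>apex_corresponds\<close> is thus the action through the embedding.\<close>

lemma corner_module_monoid_algebra:
  fixes N :: "('k::field monalg, 'v) module"
  assumes N: "left_module kS N"
  shows "corner_module kS kG (basis_map \<epsilon>) to_corner of_corner N (smult N)"
proof -
  interpret N: left_module "kS :: ('k, 'k monalg) module" N by fact
  interpret corner_retract "kS :: ('k, 'k monalg) module" kG "basis_map \<epsilon>" to_corner of_corner
    by (rule corner_retract_monoid_algebra)
  show ?thesis
  proof (intro corner_module.intro corner_module_axioms.intro corner_retract_monoid_algebra N)
    fix b :: "'k monalg" and x
    assume b: "b \<in> carrier kG" and "x \<in> corner_carrier N"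
    then obtain y where y: "y \<in> carrier N" "x = basis_map \<epsilon> \<odot>\<^bsub>N\<^esub> y"
      by (auto simp: corner_carrier_def)
    have "b \<in> carrier kS" using b sym_i_sub by auto
    moreover have "to_corner b = b \<otimes>\<^bsub>kS\<^esub> basis_map \<epsilon>" by (simp add: to_corner_def)
    moreover have "to_corner b \<odot>\<^bsub>N\<^esub> x = (to_corner b \<otimes>\<^bsub>kS\<^esub> basis_map \<epsilon>) \<odot>\<^bsub>N\<^esub> y"
      using N.smult_assoc1[OF g_closed[OF b] e_closed y(1)] y(2) by simp
    ultimately show "b \<odot>\<^bsub>N\<^esub> x = to_corner b \<odot>\<^bsub>N\<^esub> x"
      using N.smult_assoc1[OF _ e_closed y(1)] y(2) g_right[OF b] by metis
  qed
qed

text \<open>The first clause of \<open>apex_corresponds\<close>. For an irreducible module not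
  annihilated by \<open>\<epsilon>\<close> it is equivalent to \<open>admissible\<close>, by the
  next two lemmas.\<close>

definition lower_rank_zero :: "('k::field monalg, 'v) module \<Rightarrow> bool" where
  "lower_rank_zero N \<longleftrightarrow>
    (\<forall>\<alpha>\<in>S. rank r \<alpha> < i \<longrightarrow> (\<forall>x\<in>carrier N. basis_map \<alpha> \<odot>\<^bsub>N\<^esub> x = \<zero>\<^bsub>N\<^esub>))"

text \<open>An element of the corner in the kernel of \<open>of_corner\<close> has no coefficient at
  a unit, so by \<open>corner_units\<close> its support has rank below \<open>i\<close>.\<close>

lemma lower_rank_zero_imp_admissible:
  fixes N :: "('k::field monalg, 'v) module"
  assumes N: "left_module kS N" and low: "lower_rank_zero N"
  shows "corner_retract.admissible kS kG (basis_map \<epsilon>) of_corner N"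
proof -
  interpret corner_module "kS :: ('k, 'k monalg) module" kG "basis_map \<epsilon>" to_corner of_corner N "smult N"
    using N by (rule corner_module_monoid_algebra)
  show ?thesis
    unfolding admissible_def
  proof (intro allI impI)
    fix a :: "'k monalg" and x
    assume a: "in_corner a" and pa: "of_corner a = \<zero>\<^bsub>kG\<^esub>" and x: "x \<in> corner_carrier N"
    have xN: "x \<in> carrier N" using x by (simp add: corner_carrier_iff)
    show "a \<odot>\<^bsub>N\<^esub> x = \<zero>\<^bsub>N\<^esub>"
    proof (rule annihilated_by_support[OF N xN])
      show "a \<in> carrier kS" using a by (rule in_corner_carrier)
      fix \<alpha> assume \<alpha>: "\<alpha> \<in> S" "a \<alpha> \<noteq> 0"
      have "conv S (basis_map \<epsilon>) a = a" "conv S a (basis_map \<epsilon>) = a"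
        using in_corner_left[OF a] in_corner_right[OF a] by simp_all
      from corner_support[OF this \<alpha>(2)] have fixed: "\<epsilon> \<circ> \<alpha> = \<alpha>" "\<alpha> \<circ> \<epsilon> = \<alpha>" .
      have "rank r \<alpha> < i"
      proof (rule ccontr)
        assume "\<not> rank r \<alpha> < i"
        then obtain \<sigma> where \<sigma>: "\<sigma> \<in> sym_maps i" "\<alpha> = \<sigma> \<circ> \<epsilon>"
          using corner_units[OF \<alpha>(1) fixed] by auto
        then have "a \<alpha> = of_corner a \<sigma>" by (simp add: of_corner_def)
        with pa \<alpha>(2) show False by simp
      qed
      with low \<alpha>(1) xN show "basis_map \<alpha> \<odot>\<^bsub>N\<^esub> x = \<zero>\<^bsub>N\<^esub>"
        by (simp add: lower_rank_zero_def)
    qed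
  qed
qed

text \<open>Every map in the support of a product with the factor \<open>basis_map \<alpha>\<close>
  has rank at most \<open>rank r \<alpha> < i\<close>. Its coefficients at the units vanish, and
  \<open>annihilates\<close> applies.\<close>

lemma admissible_imp_lower_rank_zero:
  fixes N :: "('k::field monalg, 'v) module"
  assumes irr: "irreducible_module kS N"
    and adm: "corner_retract.admissible kS kG (basis_map \<epsilon>) of_corner N"
    and nz: "\<exists>x\<in>carrier N. basis_map \<epsilon> \<odot>\<^bsub>N\<^esub> x \<noteq> \<zero>\<^bsub>N\<^esub>"
  shows "lower_rank_zero N"
  unfolding lower_rank_zero_def
proof (intro ballI impI)
  interpret corner_module "kS :: ('k, 'k monalg) module" kG "basis_map \<epsilon>" to_corner of_corner N "smult N"
    using irreducible_module_left_module[OF irr] by (rule corner_module_monoid_algebra)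
  fix \<alpha> x assume \<alpha>: "\<alpha> \<in> S" "rank r \<alpha> < i" and x: "x \<in> carrier N"
  show "basis_map \<alpha> \<odot>\<^bsub>N\<^esub> x = \<zero>\<^bsub>N\<^esub>"
  proof (rule annihilates[OF irr adm nz _ _ x])
    show "basis_map \<alpha> \<in> carrier kS" using \<alpha> by (auto simp: basis_map_def)
    fix b c :: "'k monalg"
    assume b: "b \<in> carrier kS" and c: "c \<in> carrier kS"
    let ?d = "conv S (basis_map \<epsilon>) (conv S (conv S (conv S c (basis_map \<alpha>)) b) (basis_map \<epsilon>))"
    have "?d (\<sigma> \<circ> \<epsilon>) = 0" if \<sigma>: "\<sigma> \<in> sym_maps i" for \<sigma>
    proof (rule ccontr)
      assume "?d (\<sigma> \<circ> \<epsilon>) \<noteq> 0"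
      then obtain \<delta>1 \<delta>2 where 1: "\<delta>1 \<in> S" "\<delta>2 \<in> S" "\<sigma> \<circ> \<epsilon> = \<delta>1 \<circ> \<delta>2"
          "conv S (conv S (conv S c (basis_map \<alpha>)) b) (basis_map \<epsilon>) \<delta>2 \<noteq> 0"
        by (rule conv_support)
      from 1(4) obtain \<delta>3 \<delta>4 where 2: "\<delta>3 \<in> S" "\<delta>4 \<in> S" "\<delta>2 = \<delta>3 \<circ> \<delta>4"
          "conv S (conv S c (basis_map \<alpha>)) b \<delta>3 \<noteq> 0"
        by (rule conv_support)
      from 2(4) obtain \<delta>5 \<delta>6 where 3: "\<delta>5 \<in> S" "\<delta>6 \<in> S" "\<delta>3 = \<delta>5 \<circ> \<delta>6"
          "conv S c (basis_map \<alpha>) \<delta>5 \<noteq> 0"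
        by (rule conv_support)
      from 3(4) obtain \<delta>7 \<delta>8 where 4: "\<delta>7 \<in> S" "\<delta>8 \<in> S" "\<delta>5 = \<delta>7 \<circ> \<delta>8" "basis_map \<alpha> \<delta>8 \<noteq> (0::'k)"
        by (rule conv_support)
      then have "\<delta>8 = \<alpha>" by (simp add: basis_map_def split: if_splits)
      have "i = rank r (\<delta>1 \<circ> \<delta>2)" using rank_sym_\<epsilon>[OF \<sigma>] 1(3) by simp
      also have "\<dots> \<le> rank r \<delta>2" using 1 by (intro rank_comp_right)
      also have "\<dots> \<le> rank r \<delta>3" unfolding 2(3) using 2 by (intro rank_comp_left)
      also have "\<dots> \<le> rank r \<delta>5" unfolding 3(3) using 3 by (intro rank_comp_left)
      also have "\<dots> \<le> rank r \<delta>8" unfolding 4(3) using 4 by (intro rank_comp_right)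
      finally show False using \<alpha>(2) \<open>\<delta>8 = \<alpha>\<close> by simp
    qed
    then show "of_corner (cut (c \<otimes>\<^bsub>kS\<^esub> basis_map \<alpha> \<otimes>\<^bsub>kS\<^esub> b)) = \<zero>\<^bsub>kG\<^esub>"
      by (auto simp: of_corner_def cut_def conv_assoc)
  qed
qed

text \<open>The image of \<open>\<epsilon>\<close> on \<open>{0..r}\<close> is fixed by
  \<open>\<epsilon>'\<close>, hence \<open>\<epsilon>' \<circ> \<epsilon> = \<epsilon>\<close>. Used
  in both directions, this shows that the subspace cut out of \<open>N\<close> depends on
  \<open>i\<close> alone.\<close>

lemma image_\<epsilon>_eq:
  fixes N :: "('k::field monalg, 'v) module"
  assumes N: "left_module kS N" and \<epsilon>': "apex r S i \<epsilon>'"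
  shows "(\<lambda>x. basis_map \<epsilon> \<odot>\<^bsub>N\<^esub> x) ` carrier N \<subseteq> (\<lambda>x. basis_map \<epsilon>' \<odot>\<^bsub>N\<^esub> x) ` carrier N"
proof
  interpret E: apex r S i \<epsilon>' by fact
  interpret N: left_module "kS :: ('k, 'k monalg) module" N by fact
  have "\<epsilon>' \<circ> \<epsilon> = \<epsilon>" by (rule E.\<epsilon>_comp_fixed[OF \<epsilon>_in]) (rule \<epsilon>_le)
  then have *: "basis_map \<epsilon>' \<otimes>\<^bsub>kS\<^esub> basis_map \<epsilon> = (basis_map \<epsilon> :: 'k monalg)"
    by (simp add: conv_basis_basis E.\<epsilon>_in \<epsilon>_in)
  have in_kS: "basis_map \<epsilon>' \<in> carrier kS" "(basis_map \<epsilon> :: 'k monalg) \<in> carrier kS"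
    using E.\<epsilon>_in \<epsilon>_in by (auto simp: basis_map_def)
  fix x assume "x \<in> (\<lambda>x. basis_map \<epsilon> \<odot>\<^bsub>N\<^esub> x) ` carrier N"
  then obtain y where y: "y \<in> carrier N" "x = basis_map \<epsilon> \<odot>\<^bsub>N\<^esub> y" by auto
  then have "x = basis_map \<epsilon>' \<odot>\<^bsub>N\<^esub> x" "x \<in> carrier N"
    using N.smult_assoc1[OF in_kS y(1)] * N.smult_closed[OF in_kS(2) y(1)] by auto
  then show "x \<in> (\<lambda>x. basis_map \<epsilon>' \<odot>\<^bsub>N\<^esub> x) ` carrier N" by blast
qed

end

section \<open>Irreducible modules of the monoid algebra and of the symmetric groups\<close>

context symmetric_map_monoid
begin

lemma apex_corresponds_iff:
  "apex_corresponds r S N i W \<longleftrightarrow>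
    (\<forall>\<alpha>\<in>S. rank r \<alpha> < i \<longrightarrow> (\<forall>x\<in>carrier N. basis_map \<alpha> \<odot>\<^bsub>N\<^esub> x = \<zero>\<^bsub>N\<^esub>)) \<and>
     (\<exists>\<epsilon>. apex r S i \<epsilon> \<and> (\<exists>x\<in>carrier N. basis_map \<epsilon> \<odot>\<^bsub>N\<^esub> x \<noteq> \<zero>\<^bsub>N\<^esub>) \<and>
        module_isomorphic (monoid_algebra (sym_maps i) :: ('k::field, 'k monalg) module)
          (with_action N ((\<lambda>x. basis_map \<epsilon> \<odot>\<^bsub>N\<^esub> x) ` carrier N) (smult N)) W)"
  unfolding apex_corresponds_def apex_def apex_axioms_def
  using symmetric_map_monoid_axioms by blast

lemma ex_apex: "\<alpha> \<in> S \<Longrightarrow> \<exists>\<epsilon>. apex r S (rank r \<alpha>) \<epsilon>"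
  using ex_idempotent[of \<alpha> "rank r \<alpha>"] symmetric_map_monoid_axioms
  unfolding apex_def apex_axioms_def by blast

text \<open>Take \<open>i\<close> to be the least rank of a map acting nontrivially; minimality
  gives \<open>lower_rank_zero\<close>. A nontrivially acting \<open>\<alpha>\<close> of rank
  \<open>i\<close> factors through \<open>\<epsilon>\<close>, so \<open>\<epsilon>\<close> acts
  nontrivially as well and the corner is a nonzero irreducible module.\<close>

theorem irreducible_has_apex:
  fixes N :: "('k::field monalg, 'u) module"
  assumes irr: "irreducible_module (monoid_algebra S) N"
  shows "\<exists>i\<in>rank r ` S. i \<le> r \<and> (\<exists>W :: ('k monalg, 'u) module.
    irreducible_module (monoid_algebra (sym_maps i) :: ('k, 'k monalg) module) W \<and>
    apex_corresponds r S N i W)"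
proof -
  interpret N: left_module "monoid_algebra S :: ('k, 'k monalg) module" N
    using irr by (rule irreducible_module_left_module)
  define acts where "acts \<alpha> \<longleftrightarrow> (\<exists>x\<in>carrier N. basis_map \<alpha> \<odot>\<^bsub>N\<^esub> x \<noteq> \<zero>\<^bsub>N\<^esub>)" for \<alpha>
  obtain z where z: "z \<in> carrier N" "z \<noteq> \<zero>\<^bsub>N\<^esub>"
    using irr by (rule irreducible_module_nonzero)
  have "acts id" unfolding acts_def using z N.smult_one[OF z(1)] by (intro bexI[of _ z]) auto
  then have ex: "\<exists>i. \<exists>\<alpha>\<in>S. acts \<alpha> \<and> rank r \<alpha> = i" using id_in by blast
  define i where "i = (LEAST i. \<exists>\<alpha>\<in>S. acts \<alpha> \<and> rank r \<alpha> = i)"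
  obtain \<alpha> where \<alpha>: "\<alpha> \<in> S" "acts \<alpha>" "rank r \<alpha> = i"
    using LeastI_ex[OF ex] unfolding i_def by blast
  have low: "\<not> acts \<beta>" if "\<beta> \<in> S" "rank r \<beta> < i" for \<beta>
    using not_less_Least[of "rank r \<beta>"] that unfolding i_def by blast
  obtain \<epsilon> where "apex r S i \<epsilon>" using ex_apex[OF \<alpha>(1)] \<alpha>(3) by auto
  then interpret apex r S i \<epsilon> .
  have N: "left_module kS N" using irr by (rule irreducible_module_left_module)
  have lrz: "lower_rank_zero N" using low by (auto simp: lower_rank_zero_def acts_def)
  interpret corner_module "kS :: ('k, 'k monalg) module" kG "basis_map \<epsilon>" to_corner of_corner N "smult N"
    using N by (rule corner_module_monoid_algebra)
  have nz: "\<exists>x\<in>carrier N. basis_map \<epsilon> \<odot>\<^bsub>N\<^esub> x \<noteq> \<zero>\<^bsub>N\<^esub>"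
  proof (rule ccontr)
    assume "\<not> ?thesis"
    then have zero: "basis_map \<epsilon> \<odot>\<^bsub>N\<^esub> x = \<zero>\<^bsub>N\<^esub>" if "x \<in> carrier N" for x using that by blast
    obtain \<sigma> \<tau> where st: "\<sigma> \<in> S" "\<tau> \<in> S" "\<alpha> = \<sigma> \<circ> \<epsilon> \<circ> \<tau>"
      using factor[OF \<alpha>(1,3)] by blast
    have bm: "(basis_map \<gamma> :: 'k monalg) \<in> carrier kS" if "\<gamma> \<in> S" for \<gamma>
      using that by (auto simp: basis_map_def)
    have comp: "basis_map (\<gamma> \<circ> \<delta>) \<odot>\<^bsub>N\<^esub> x = basis_map \<gamma> \<odot>\<^bsub>N\<^esub> (basis_map \<delta> \<odot>\<^bsub>N\<^esub> x)"
      if "\<gamma> \<in> S" "\<delta> \<in> S" "x \<in> carrier N" for \<gamma> \<delta> x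
      using N.smult_assoc1[OF bm[OF that(1)] bm[OF that(2)] that(3)]
      by (simp add: conv_basis_basis[OF that(1,2)])
    have "basis_map \<alpha> \<odot>\<^bsub>N\<^esub> x = \<zero>\<^bsub>N\<^esub>" if x: "x \<in> carrier N" for x
    proof -
      have tx: "basis_map \<tau> \<odot>\<^bsub>N\<^esub> x \<in> carrier N"
        by (rule N.smult_closed[OF bm[OF st(2)] x])
      have "basis_map \<alpha> \<odot>\<^bsub>N\<^esub> x = basis_map \<sigma> \<odot>\<^bsub>N\<^esub> (basis_map \<epsilon> \<odot>\<^bsub>N\<^esub> (basis_map \<tau> \<odot>\<^bsub>N\<^esub> x))"
        unfolding st(3) using comp[OF closed[OF st(1) \<epsilon>_in] st(2) x] comp[OF st(1) \<epsilon>_in tx] by simp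
      also have "\<dots> = \<zero>\<^bsub>N\<^esub>"
        using zero[OF tx] N.smult_r_null[OF bm[OF st(1)]] by simp
      finally show ?thesis .
    qed
    with \<alpha>(2) show False by (auto simp: acts_def)
  qed
  have "irreducible_module kG eM"
    using corner_irreducible[OF irr lower_rank_zero_imp_admissible[OF N lrz] nz] .
  moreover have "apex_corresponds r S N i eM"
    unfolding apex_corresponds_iff
    using lrz nz module_isomorphic_refl apex_axioms
    by (auto simp: lower_rank_zero_def corner_carrier_def)
  ultimately show ?thesis
    using \<alpha>(1,3) i_le by blast
qed

theorem ex_irreducible_with_apex:
  fixes W :: "('k::field monalg, 'w) module"
  assumes i: "i \<in> rank r ` S"
    and irr: "irreducible_module (monoid_algebra (sym_maps i) :: ('k, 'k monalg) module) W"
  shows "\<exists>N :: ('k monalg, 'k monalg set) module.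
    irreducible_module (monoid_algebra S :: ('k, 'k monalg) module) N \<and> apex_corresponds r S N i W"
proof -
  obtain \<epsilon> where "apex r S i \<epsilon>" using ex_apex i by auto
  then interpret apex r S i \<epsilon> .
  interpret corner_retract "kS :: ('k, 'k monalg) module" kG "basis_map \<epsilon>" to_corner of_corner
    by (rule corner_retract_monoid_algebra)
  obtain N :: "('k monalg, 'k monalg set) module" where
    N: "irreducible_module kS N" "admissible N"
      "\<exists>x\<in>carrier N. basis_map \<epsilon> \<odot>\<^bsub>N\<^esub> x \<noteq> \<zero>\<^bsub>N\<^esub>"
    and iso: "\<And>act. \<forall>b\<in>carrier kG. \<forall>x\<in>corner_carrier N. act b x = to_corner b \<odot>\<^bsub>N\<^esub> x \<Longrightarrow>
       module_isomorphic kG (with_action N (corner_carrier N) act) W"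
    using irreducible_module_from_corner[OF irr] by blast
  interpret corner_module "kS :: ('k, 'k monalg) module" kG "basis_map \<epsilon>" to_corner of_corner N "smult N"
    using irreducible_module_left_module[OF N(1)] by (rule corner_module_monoid_algebra)
  have "module_isomorphic kG (with_action N (corner_carrier N) (smult N)) W"
    by (rule iso) (simp add: act)
  moreover have "lower_rank_zero N"
    using N by (rule admissible_imp_lower_rank_zero)
  ultimately have "apex_corresponds r S N i W"
    unfolding apex_corresponds_iff lower_rank_zero_def corner_carrier_def
    using N(3) apex_axioms by blast
  with N(1) show ?thesis by blast
qed

text \<open>The number \<open>i\<close> is an isomorphism invariant: an idempotent of rank
  \<open>i\<close> acts nontrivially on one module, and on the other it would act as zero if
  \<open>i < i'\<close>; symmetrically for \<open>i' < i\<close>. For \<open>i = i'\<close> both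
  corners can be taken at the same idempotent, and \<open>corner_isomorphic_iff\<close>
  decides.\<close>

theorem apex_isomorphic_iff:
  fixes N :: "('k::field monalg, 'u) module" and N' :: "('k monalg, 'x) module"
    and W :: "('k monalg, 'w) module" and W' :: "('k monalg, 'y) module"
  assumes irr: "irreducible_module (monoid_algebra S) N" "irreducible_module (monoid_algebra S) N'"
    and ap: "apex_corresponds r S N i W" "apex_corresponds r S N' i' W'"
  shows "module_isomorphic (monoid_algebra S :: ('k, 'k monalg) module) N N' \<longleftrightarrow>
    i = i' \<and> module_isomorphic (monoid_algebra (sym_maps i) :: ('k, 'k monalg) module) W W'"
proof -
  have N: "left_module (monoid_algebra S) N" "left_module (monoid_algebra S) N'"
    using irr by (simp_all add: irreducible_module_left_module)
  obtain \<epsilon> where \<epsilon>: "apex r S i \<epsilon>" "\<exists>x\<in>carrier N. basis_map \<epsilon> \<odot>\<^bsub>N\<^esub> x \<noteq> \<zero>\<^bsub>N\<^esub>"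
    and isoW: "module_isomorphic (monoid_algebra (sym_maps i) :: ('k, 'k monalg) module)
      (with_action N ((\<lambda>x. basis_map \<epsilon> \<odot>\<^bsub>N\<^esub> x) ` carrier N) (smult N)) W"
    and low: "\<forall>\<alpha>\<in>S. rank r \<alpha> < i \<longrightarrow> (\<forall>x\<in>carrier N. basis_map \<alpha> \<odot>\<^bsub>N\<^esub> x = \<zero>\<^bsub>N\<^esub>)"
    using ap(1) unfolding apex_corresponds_iff by blast
  obtain \<epsilon>' where \<epsilon>': "apex r S i' \<epsilon>'" "\<exists>x\<in>carrier N'. basis_map \<epsilon>' \<odot>\<^bsub>N'\<^esub> x \<noteq> \<zero>\<^bsub>N'\<^esub>"
    and isoW': "module_isomorphic (monoid_algebra (sym_maps i') :: ('k, 'k monalg) module)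
      (with_action N' ((\<lambda>x. basis_map \<epsilon>' \<odot>\<^bsub>N'\<^esub> x) ` carrier N') (smult N')) W'"
    and low': "\<forall>\<alpha>\<in>S. rank r \<alpha> < i' \<longrightarrow> (\<forall>x\<in>carrier N'. basis_map \<alpha> \<odot>\<^bsub>N'\<^esub> x = \<zero>\<^bsub>N'\<^esub>)"
    using ap(2) unfolding apex_corresponds_iff by blast
  interpret E: apex r S i \<epsilon> by fact
  interpret E': apex r S i' \<epsilon>' by fact
  have "i = i'" if iso: "module_isomorphic (monoid_algebra S :: ('k, 'k monalg) module) N N'"
  proof -
    interpret N: left_module "monoid_algebra S :: ('k, 'k monalg) module" N by fact
    interpret N': left_module "monoid_algebra S :: ('k, 'k monalg) module" N' by fact
    obtain h where bij: "bij_betw h (carrier N) (carrier N')"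
      and add: "\<forall>x\<in>carrier N. \<forall>y\<in>carrier N. h (x \<oplus>\<^bsub>N\<^esub> y) = h x \<oplus>\<^bsub>N'\<^esub> h y"
      and h: "\<forall>a\<in>carrier (monoid_algebra S). \<forall>x\<in>carrier N. h (a \<odot>\<^bsub>N\<^esub> x) = a \<odot>\<^bsub>N'\<^esub> h x"
      using iso unfolding module_isomorphic_def by blast
    have bm: "(basis_map \<gamma> :: 'k monalg) \<in> carrier (monoid_algebra S)" if "\<gamma> \<in> S" for \<gamma>
      using that by (auto simp: basis_map_def)
    have "h \<zero>\<^bsub>N\<^esub> \<in> carrier N'" using bij by (simp add: bij_betwE)
    moreover have "h \<zero>\<^bsub>N\<^esub> \<oplus>\<^bsub>N'\<^esub> h \<zero>\<^bsub>N\<^esub> = h \<zero>\<^bsub>N\<^esub>" using add by (metis N.M.l_zero N.M.zero_closed)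
    ultimately have h0: "h \<zero>\<^bsub>N\<^esub> = \<zero>\<^bsub>N'\<^esub>" by (metis N'.M.add.r_cancel_one' N'.M.zero_closed)
    have "\<not> i < i'"
    proof
      assume "i < i'"
      obtain x where x: "x \<in> carrier N" "basis_map \<epsilon> \<odot>\<^bsub>N\<^esub> x \<noteq> \<zero>\<^bsub>N\<^esub>" using \<epsilon>(2) by blast
      have "h (basis_map \<epsilon> \<odot>\<^bsub>N\<^esub> x) = h \<zero>\<^bsub>N\<^esub>"
        using h bm[OF E.\<epsilon>_in] x(1) low' E.\<epsilon>_in E.rank_\<epsilon> \<open>i < i'\<close> bij_betwE[OF bij] h0 by metis
      then show False
        using bij x N.smult_closed[OF bm[OF E.\<epsilon>_in] x(1)] N.M.zero_closed
        unfolding bij_betw_def inj_on_def by blast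
    qed
    moreover have "\<not> i' < i"
    proof
      assume "i' < i"
      obtain y where y: "y \<in> carrier N'" "basis_map \<epsilon>' \<odot>\<^bsub>N'\<^esub> y \<noteq> \<zero>\<^bsub>N'\<^esub>" using \<epsilon>'(2) by blast
      obtain x where x: "x \<in> carrier N" "y = h x" using y(1) bij unfolding bij_betw_def by blast
      have "basis_map \<epsilon>' \<odot>\<^bsub>N\<^esub> x = \<zero>\<^bsub>N\<^esub>" using low E'.\<epsilon>_in E'.rank_\<epsilon> \<open>i' < i\<close> x(1) by blast
      then show False using h bm[OF E'.\<epsilon>_in] x y h0 by metis
    qed
    ultimately show "i = i'" by simp
  qed
  moreover have "module_isomorphic (monoid_algebra S :: ('k, 'k monalg) module) N N' \<longleftrightarrow>
    module_isomorphic (monoid_algebra (sym_maps i) :: ('k, 'k monalg) module) W W'" if ii: "i = i'"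
  proof -
    have \<epsilon>'i: "apex r S i \<epsilon>'" using \<epsilon>'(1) ii by simp
    let ?kG = "monoid_algebra (sym_maps i) :: ('k, 'k monalg) module"
    interpret corner_retract "monoid_algebra S :: ('k, 'k monalg) module" ?kG "basis_map \<epsilon>"
      E.to_corner E.of_corner
      by (rule E.corner_retract_monoid_algebra)
    \<comment> \<open>The two correspondences may use different idempotents; the second is replaced
      by the first.\<close>
    have im': "(\<lambda>x. basis_map \<epsilon>' \<odot>\<^bsub>N'\<^esub> x) ` carrier N' = corner_carrier N'"
      unfolding corner_carrier_def
      using E.image_\<epsilon>_eq[OF N(2) \<epsilon>'i] apex.image_\<epsilon>_eq[OF \<epsilon>'i N(2) \<epsilon>(1)] by blast
    let ?V = "with_action N (corner_carrier N) (smult N)"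
    let ?V' = "with_action N' (corner_carrier N') (smult N')"
    have isoV: "module_isomorphic ?kG ?V W"
      using isoW by (simp add: corner_carrier_def)
    have isoV': "module_isomorphic ?kG ?V' W'"
      using isoW' unfolding im' ii .
    have cm: "corner_module (monoid_algebra S) ?kG (basis_map \<epsilon>) E.to_corner E.of_corner N (smult N)"
      "corner_module (monoid_algebra S) ?kG (basis_map \<epsilon>) E.to_corner E.of_corner N' (smult N')"
      by (intro E.corner_module_monoid_algebra N)+
    have "E.lower_rank_zero N" "E.lower_rank_zero N'"
      using low low'[folded ii] by (simp_all only: E.lower_rank_zero_def)
    then have adm: "admissible N" "admissible N'"
      by (simp_all only: E.lower_rank_zero_imp_admissible[OF N(1)] E.lower_rank_zero_imp_admissible[OF N(2)])
    have lm: "left_module ?kG ?V" "left_module ?kG ?V'"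
      by (rule corner_module.corner_left_module[OF cm(1)], rule corner_module.corner_left_module[OF cm(2)])
    have "module_isomorphic (monoid_algebra S :: ('k, 'k monalg) module) N N' \<longleftrightarrow>
        module_isomorphic ?kG ?V ?V'"
      using corner_isomorphic_iff[OF cm irr adm \<epsilon>(2)] by simp
    also have "\<dots> \<longleftrightarrow> module_isomorphic ?kG W W'"
      using module_isomorphic_trans[OF module_isomorphic_trans[OF module_isomorphic_sym[OF lm(1) isoV]] isoV']
        module_isomorphic_trans[OF module_isomorphic_trans[OF isoV] module_isomorphic_sym[OF lm(2) isoV']]
      by blast
    finally show ?thesis .
  qed
  ultimately show ?thesis by blast
qed

end

section \<open>Generalized Schur algebras\<close>

lemma card_filter_sum: "finite A \<Longrightarrow> card {x \<in> A. P x} = (\<Sum>x\<in>A. if P x then 1 else 0)"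
  by (simp add: sum.If_cases Int_def)

locale schur_setting = symmetric_map_monoid r S for r S +
  fixes n :: nat and X :: side
begin

abbreviation (input) \<Lambda> where "\<Lambda> \<equiv> compositions n r"

lemma young_sub: "l \<in> \<Lambda> \<Longrightarrow> young l \<subseteq> sym_maps r"
  by (auto simp: young_def compositions_def)

lemma young_in_S: "l \<in> \<Lambda> \<Longrightarrow> \<sigma> \<in> young l \<Longrightarrow> \<sigma> \<in> S"
  using young_sub sym_sub by blast

lemma young_id [simp]: "id \<in> young l"
  by (simp add: young_def sym_maps_id)

lemma young_comp:
  assumes "\<sigma> \<in> young l" "\<tau> \<in> young l"
  shows "\<sigma> \<circ> \<tau> \<in> young l"
proof -
  have "(\<sigma> \<circ> \<tau>) ` block l i = block l i" if "i < length l" for i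
    unfolding image_comp[symmetric] using assms that by (simp add: young_def)
  then show ?thesis using assms by (simp add: young_def sym_maps_comp)
qed

lemma young_inv:
  assumes "\<sigma> \<in> young l"
  shows "Hilbert_Choice.inv \<sigma> \<in> young l"
proof -
  have \<sigma>: "\<sigma> \<in> sym_maps (sum_list l)" "\<forall>i<length l. \<sigma> ` block l i = block l i"
    using assms by (auto simp: young_def)
  have "Hilbert_Choice.inv \<sigma> ` block l i = block l i" if "i < length l" for i
  proof -
    have "Hilbert_Choice.inv \<sigma> ` (\<sigma> ` block l i) = block l i"
      using sym_maps_inv_o(1)[OF \<sigma>(1)] by (simp only: image_comp) simp
    then show ?thesis using \<sigma>(2) that by simp
  qed
  then show ?thesis using sym_maps_inv[OF \<sigma>(1)] by (simp add: young_def)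
qed

lemma young_inv_o: "\<sigma> \<in> young l \<Longrightarrow> Hilbert_Choice.inv \<sigma> \<circ> \<sigma> = id" "\<sigma> \<in> young l \<Longrightarrow> \<sigma> \<circ> Hilbert_Choice.inv \<sigma> = id"
  by (auto simp: young_def sym_maps_inv_o)

lemma finite_young: "finite (young l)"
  by (rule finite_subset[OF _ finite_sym_maps[of "sum_list l"]]) (auto simp: young_def)

lemma card_young_pos: "card (young l) > 0"
  using finite_young young_id by (metis card_gt_0_iff empty_iff)

lemma young_cancel:
  assumes "\<sigma> \<in> young l"
  shows "Hilbert_Choice.inv \<sigma> \<circ> (\<sigma> \<circ> \<alpha>) = \<alpha>" "\<sigma> \<circ> (Hilbert_Choice.inv \<sigma> \<circ> \<alpha>) = \<alpha>"
    "(\<alpha> \<circ> \<sigma>) \<circ> Hilbert_Choice.inv \<sigma> = \<alpha>" "(\<alpha> \<circ> Hilbert_Choice.inv \<sigma>) \<circ> \<sigma> = \<alpha>"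
  using young_inv_o[OF assms] by (simp_all add: comp_assoc) (simp_all add: comp_assoc[symmetric])

lemma dcosetI: "\<sigma> \<in> young l \<Longrightarrow> \<pi> \<in> young m \<Longrightarrow> \<sigma> \<circ> \<alpha> \<circ> \<pi> \<in> dcoset l \<alpha> m"
  by (auto simp: dcoset_def)

lemma dcosetE:
  assumes "\<beta> \<in> dcoset l \<alpha> m"
  obtains \<sigma> \<pi> where "\<sigma> \<in> young l" "\<pi> \<in> young m" "\<beta> = \<sigma> \<circ> \<alpha> \<circ> \<pi>"
  using assms by (auto simp: dcoset_def)

lemma dcoset_self: "\<alpha> \<in> dcoset l \<alpha> m"
  using dcosetI[of id l id m \<alpha>] by simp

lemma dcoset_trans:
  assumes "\<beta> \<in> dcoset l \<alpha> m" "\<gamma> \<in> dcoset l \<beta> m"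
  shows "\<gamma> \<in> dcoset l \<alpha> m"
proof -
  obtain \<sigma> \<pi> \<sigma>' \<pi>' where *: "\<sigma> \<in> young l" "\<pi> \<in> young m" "\<beta> = \<sigma> \<circ> \<alpha> \<circ> \<pi>"
      "\<sigma>' \<in> young l" "\<pi>' \<in> young m" "\<gamma> = \<sigma>' \<circ> \<beta> \<circ> \<pi>'"
    using assms by (meson dcosetE)
  then have "\<gamma> = (\<sigma>' \<circ> \<sigma>) \<circ> \<alpha> \<circ> (\<pi> \<circ> \<pi>')" by (simp add: comp_assoc)
  with * show ?thesis by (metis dcosetI young_comp)
qed

lemma dcoset_sym:
  assumes "\<beta> \<in> dcoset l \<alpha> m"
  shows "\<alpha> \<in> dcoset l \<beta> m"
proof -
  obtain \<sigma> \<pi> where *: "\<sigma> \<in> young l" "\<pi> \<in> young m" "\<beta> = \<sigma> \<circ> \<alpha> \<circ> \<pi>"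
    using assms by (rule dcosetE)
  then have "Hilbert_Choice.inv \<sigma> \<circ> \<beta> \<circ> Hilbert_Choice.inv \<pi> = \<alpha>"
    using young_cancel(1)[OF *(1), of \<alpha>] young_cancel(3)[OF *(2), of \<alpha>] by (simp add: comp_assoc)
  then show ?thesis using * dcosetI[OF young_inv[OF *(1)] young_inv[OF *(2)], of \<beta>] by simp
qed

lemma dcoset_eq_iff: "dcoset l \<beta> m = dcoset l \<alpha> m \<longleftrightarrow> \<beta> \<in> dcoset l \<alpha> m"
  using dcoset_self dcoset_trans dcoset_sym by blast

lemma dcoset_sub:
  assumes "l \<in> \<Lambda>" "m \<in> \<Lambda>" "\<alpha> \<in> S"
  shows "dcoset l \<alpha> m \<subseteq> S"
  using assms closed young_in_S by (auto simp: dcoset_def)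

lemma dcoset_in: "\<alpha> \<in> S \<Longrightarrow> dcoset l \<alpha> m \<in> dcosets S l m"
  by (auto simp: dcosets_def)

context
  fixes l m D assumes lm: "l \<in> \<Lambda>" "m \<in> \<Lambda>" and D: "D \<in> dcosets S l m"
begin

lemma dcosets_sub: "D \<subseteq> S"
  using D lm dcoset_sub by (auto simp: dcosets_def)

lemma dcosets_finite: "finite D"
  using dcosets_sub fin finite_subset by blast

lemma dcosets_eq:
  assumes "\<alpha> \<in> D"
  shows "dcoset l \<alpha> m = D"
proof -
  obtain \<beta> where "D = dcoset l \<beta> m" using D by (auto simp: dcosets_def)
  with assms show ?thesis using dcoset_eq_iff by simp
qed

lemma dcosets_rep: "rep D \<in> D"
proof -
  obtain \<beta> where "D = dcoset l \<beta> m" using D by (auto simp: dcosets_def)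
  then have "\<beta> \<in> D" using dcoset_self by simp
  then show ?thesis unfolding rep_def by (rule someI[of "\<lambda>\<alpha>. \<alpha> \<in> D"])
qed

lemma dcosets_mult: "\<alpha> \<in> D \<Longrightarrow> \<sigma> \<in> young l \<Longrightarrow> \<pi> \<in> young m \<Longrightarrow> \<sigma> \<circ> \<alpha> \<circ> \<pi> \<in> D"
  using dcosets_eq dcosetI by blast

lemma dcosets_mult_left: "\<alpha> \<in> D \<Longrightarrow> \<sigma> \<in> young l \<Longrightarrow> \<sigma> \<circ> \<alpha> \<in> D"
  using dcosets_mult[of \<alpha> \<sigma> id] by simp

lemma dcosets_mult_right: "\<alpha> \<in> D \<Longrightarrow> \<pi> \<in> young m \<Longrightarrow> \<alpha> \<circ> \<pi> \<in> D"
  using dcosets_mult[of \<alpha> id \<pi>] by simp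

lemma dcosets_card_pos: "card D > 0"
  using dcosets_finite dcosets_rep by (metis card_gt_0_iff empty_iff)

end

lemma stab_num_pos: "stab_num X l D m > 0"
proof -
  have "id \<in> stab X l (rep D) m"
    by (cases X) (auto intro: bexI[of _ id])
  moreover have "finite (stab X l (rep D) m)"
    by (cases X) (auto intro: finite_subset[OF _ finite_young])
  ultimately show ?thesis unfolding stab_num_def by (metis card_gt_0_iff empty_iff)
qed

text \<open>Both sides count the triples \<open>(\<alpha>, \<rho>, \<beta>) \<in> D1 \<times> young v \<times> D2\<close> with
  \<open>\<alpha> \<circ> \<rho> \<circ> \<beta> \<in> dcoset l \<gamma> m\<close>.\<close>

lemma card_factorizations:
  assumes \<Lambda>: "l \<in> \<Lambda>" "v \<in> \<Lambda>" "m \<in> \<Lambda>"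
    and D1: "D1 \<in> dcosets S l v" and D2: "D2 \<in> dcosets S v m" and \<gamma>: "\<gamma> \<in> S"
  shows "card (young v) * (card (dcoset l \<gamma> m) * card {(\<alpha>, \<beta>) \<in> D1 \<times> D2. \<alpha> \<circ> \<beta> = \<gamma>}) =
    prod_num v D1 D2 (dcoset l \<gamma> m) * (card D1 * card D2)"
proof -
  define D where "D = dcoset l \<gamma> m"
  have D: "D \<in> dcosets S l m" using \<gamma> by (simp add: D_def dcoset_in)
  note mult1 = dcosets_mult_left[OF \<Lambda>(1,2) D1] dcosets_mult_right[OF \<Lambda>(1,2) D1]
    and mult2 = dcosets_mult_left[OF \<Lambda>(2,3) D2] dcosets_mult_right[OF \<Lambda>(2,3) D2]
    and multD = dcosets_mult[OF \<Lambda>(1,3) D]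
  have finD: "finite D1" "finite D2" "finite D"
    using dcosets_finite \<Lambda> D1 D2 D by blast+
  then have finP: "finite (D1 \<times> D2)" by simp
  let ?fib = "\<lambda>\<delta>. {x \<in> D1 \<times> D2. fst x \<circ> snd x = \<delta>}"
  \<comment> \<open>The number of factorizations is constant on a double coset:
    \<open>\<sigma>\<close> is absorbed by the left factor and \<open>\<pi>\<close> by the right
    one.\<close>
  have fib: "card (?fib \<delta>) = card (?fib \<gamma>)" if \<delta>: "\<delta> \<in> D" for \<delta>
  proof -
    obtain \<sigma> \<pi> where *: "\<sigma> \<in> young l" "\<pi> \<in> young m" "\<delta> = \<sigma> \<circ> \<gamma> \<circ> \<pi>"
      using \<delta> unfolding D_def by (rule dcosetE)
    let ?s = "Hilbert_Choice.inv \<sigma>" and ?p = "Hilbert_Choice.inv \<pi>"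
    have inv: "?s \<in> young l" "?p \<in> young m" using * young_inv by auto
    have "bij_betw (\<lambda>x. (\<sigma> \<circ> fst x, snd x \<circ> \<pi>)) (?fib \<gamma>) (?fib \<delta>)"
    proof (rule bij_betw_byWitness[where f' = "\<lambda>x. (?s \<circ> fst x, snd x \<circ> ?p)"])
      show "(\<lambda>x. (\<sigma> \<circ> fst x, snd x \<circ> \<pi>)) ` ?fib \<gamma> \<subseteq> ?fib \<delta>"
        using mult1(1)[OF _ *(1)] mult2(2)[OF _ *(2)] by (auto simp: *(3) comp_assoc)
      have "?s \<circ> \<delta> \<circ> ?p = \<gamma>"
        using young_cancel[OF *(1)] young_cancel[OF *(2)] by (simp add: *(3) comp_assoc)
      then show "(\<lambda>x. (?s \<circ> fst x, snd x \<circ> ?p)) ` ?fib \<delta> \<subseteq> ?fib \<gamma>"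
        using mult1(1)[OF _ inv(1)] mult2(2)[OF _ inv(2)] by (auto simp: comp_assoc)
    qed (use young_cancel[OF *(1)] young_cancel[OF *(2)] in auto)
    then show ?thesis by (rule bij_betw_same_card[symmetric])
  qed
  define M where "M = card {x \<in> D1 \<times> D2. fst x \<circ> snd x \<in> D}"
  have "M = (\<Sum>\<delta>\<in>D. card (?fib \<delta>))"
  proof -
    have "M = (\<Sum>x\<in>D1 \<times> D2. \<Sum>\<delta>\<in>D. if fst x \<circ> snd x = \<delta> then 1 else 0)"
      unfolding M_def card_filter_sum[OF finP] using finD by (simp add: eq_commute)
    also have "\<dots> = (\<Sum>\<delta>\<in>D. \<Sum>x\<in>D1 \<times> D2. if fst x \<circ> snd x = \<delta> then 1 else 0)"
      by (rule sum.swap)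
    finally show ?thesis by (simp only: card_filter_sum[OF finP])
  qed
  then have M: "M = card D * card (?fib \<gamma>)" using fib by simp
  \<comment> \<open>A middle factor from \<open>young v\<close> is absorbed by the first component,
    so each \<open>\<rho>\<close> accounts for the same number of triples.\<close>
  have shift: "card {x \<in> D1 \<times> D2. fst x \<circ> \<rho> \<circ> snd x \<in> D} = M" if \<rho>: "\<rho> \<in> young v" for \<rho>
  proof -
    let ?r = "Hilbert_Choice.inv \<rho>"
    have "bij_betw (\<lambda>x. (fst x \<circ> \<rho>, snd x)) {x \<in> D1 \<times> D2. fst x \<circ> \<rho> \<circ> snd x \<in> D}
      {x \<in> D1 \<times> D2. fst x \<circ> snd x \<in> D}"
    proof (rule bij_betw_byWitness[where f' = "\<lambda>x. (fst x \<circ> ?r, snd x)"])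
      show "(\<lambda>x. (fst x \<circ> \<rho>, snd x)) ` {x \<in> D1 \<times> D2. fst x \<circ> \<rho> \<circ> snd x \<in> D}
          \<subseteq> {x \<in> D1 \<times> D2. fst x \<circ> snd x \<in> D}"
        using mult1(2)[OF _ \<rho>] by auto
      show "(\<lambda>x. (fst x \<circ> ?r, snd x)) ` {x \<in> D1 \<times> D2. fst x \<circ> snd x \<in> D}
          \<subseteq> {x \<in> D1 \<times> D2. fst x \<circ> \<rho> \<circ> snd x \<in> D}"
        using mult1(2)[OF _ young_inv[OF \<rho>]] young_cancel[OF \<rho>] by auto
    qed (use young_cancel[OF \<rho>] in auto)
    then show ?thesis unfolding M_def by (rule bij_betw_same_card)
  qed
  \<comment> \<open>Independence of representatives: the inner group elements relating them to
    \<open>rep D1\<close> and \<open>rep D2\<close> are absorbed in \<open>\<rho>\<close>, the outer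
    ones by \<open>D\<close>.\<close>
  have prod: "card {\<rho> \<in> young v. \<alpha> \<circ> \<rho> \<circ> \<beta> \<in> D} = prod_num v D1 D2 D"
    if \<alpha>: "\<alpha> \<in> D1" and \<beta>: "\<beta> \<in> D2" for \<alpha> \<beta>
  proof -
    have "rep D1 \<in> dcoset l \<alpha> v" "rep D2 \<in> dcoset v \<beta> m"
      using dcosets_rep[OF \<Lambda>(1,2) D1] dcosets_rep[OF \<Lambda>(2,3) D2]
        dcosets_eq[OF \<Lambda>(1,2) D1 \<alpha>] dcosets_eq[OF \<Lambda>(2,3) D2 \<beta>] by auto
    then obtain \<sigma> \<rho>1 \<rho>2 \<pi> where *: "\<sigma> \<in> young l" "\<rho>1 \<in> young v" "rep D1 = \<sigma> \<circ> \<alpha> \<circ> \<rho>1"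
        "\<rho>2 \<in> young v" "\<pi> \<in> young m" "rep D2 = \<rho>2 \<circ> \<beta> \<circ> \<pi>"
      by (meson dcosetE)
    let ?s = "Hilbert_Choice.inv \<sigma>" and ?p = "Hilbert_Choice.inv \<pi>"
    let ?r1 = "Hilbert_Choice.inv \<rho>1" and ?r2 = "Hilbert_Choice.inv \<rho>2"
    have iff: "rep D1 \<circ> \<rho> \<circ> rep D2 \<in> D \<longleftrightarrow> \<alpha> \<circ> (\<rho>1 \<circ> \<rho> \<circ> \<rho>2) \<circ> \<beta> \<in> D" for \<rho>
    proof
      assume "rep D1 \<circ> \<rho> \<circ> rep D2 \<in> D"
      then have "?s \<circ> (rep D1 \<circ> \<rho> \<circ> rep D2) \<circ> ?p \<in> D"
        using multD young_inv * by blast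
      also have "?s \<circ> (rep D1 \<circ> \<rho> \<circ> rep D2) \<circ> ?p = \<alpha> \<circ> (\<rho>1 \<circ> \<rho> \<circ> \<rho>2) \<circ> \<beta>"
        using young_cancel[OF *(1)] young_inv_o[OF *(5)] by (simp add: * comp_assoc)
      finally show "\<alpha> \<circ> (\<rho>1 \<circ> \<rho> \<circ> \<rho>2) \<circ> \<beta> \<in> D" .
    next
      assume "\<alpha> \<circ> (\<rho>1 \<circ> \<rho> \<circ> \<rho>2) \<circ> \<beta> \<in> D"
      then have "\<sigma> \<circ> (\<alpha> \<circ> (\<rho>1 \<circ> \<rho> \<circ> \<rho>2) \<circ> \<beta>) \<circ> \<pi> \<in> D" using multD * by blast
      then show "rep D1 \<circ> \<rho> \<circ> rep D2 \<in> D" by (simp add: * comp_assoc)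
    qed
    have "bij_betw (\<lambda>\<rho>. \<rho>1 \<circ> \<rho> \<circ> \<rho>2) {\<rho> \<in> young v. rep D1 \<circ> \<rho> \<circ> rep D2 \<in> D}
      {\<rho> \<in> young v. \<alpha> \<circ> \<rho> \<circ> \<beta> \<in> D}"
    proof (rule bij_betw_byWitness[where f' = "\<lambda>\<rho>. ?r1 \<circ> \<rho> \<circ> ?r2"])
      show "\<forall>\<rho>\<in>{\<rho> \<in> young v. rep D1 \<circ> \<rho> \<circ> rep D2 \<in> D}. ?r1 \<circ> (\<rho>1 \<circ> \<rho> \<circ> \<rho>2) \<circ> ?r2 = \<rho>"
        using young_cancel[OF *(2)] young_inv_o[OF *(4)] by (simp add: comp_assoc)
      show bk: "\<forall>\<rho>\<in>{\<rho> \<in> young v. \<alpha> \<circ> \<rho> \<circ> \<beta> \<in> D}. \<rho>1 \<circ> (?r1 \<circ> \<rho> \<circ> ?r2) \<circ> \<rho>2 = \<rho>"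
        using young_cancel[OF *(2)] young_inv_o[OF *(4)] by (simp add: comp_assoc)
      show "(\<lambda>\<rho>. \<rho>1 \<circ> \<rho> \<circ> \<rho>2) ` {\<rho> \<in> young v. rep D1 \<circ> \<rho> \<circ> rep D2 \<in> D} \<subseteq> {\<rho> \<in> young v. \<alpha> \<circ> \<rho> \<circ> \<beta> \<in> D}"
        using iff young_comp * by auto
      show "(\<lambda>\<rho>. ?r1 \<circ> \<rho> \<circ> ?r2) ` {\<rho> \<in> young v. \<alpha> \<circ> \<rho> \<circ> \<beta> \<in> D} \<subseteq> {\<rho> \<in> young v. rep D1 \<circ> \<rho> \<circ> rep D2 \<in> D}"
        using iff young_comp young_inv[OF *(2)] young_inv[OF *(4)] bk by auto
    qed
    then show ?thesis unfolding prod_num_def by (rule bij_betw_same_card[symmetric])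
  qed
  have "(\<Sum>x\<in>D1 \<times> D2. card {\<rho> \<in> young v. fst x \<circ> \<rho> \<circ> snd x \<in> D}) =
      (\<Sum>\<rho>\<in>young v. card {x \<in> D1 \<times> D2. fst x \<circ> \<rho> \<circ> snd x \<in> D})"
    unfolding card_filter_sum[OF finite_young] card_filter_sum[OF finP] by (rule sum.swap)
  also have "\<dots> = card (young v) * M" using shift by simp
  finally have "card (young v) * M = (\<Sum>x\<in>D1 \<times> D2. card {\<rho> \<in> young v. fst x \<circ> \<rho> \<circ> snd x \<in> D})"
    by simp
  also have "\<dots> = (\<Sum>x\<in>D1 \<times> D2. prod_num v D1 D2 D)"
    by (rule sum.cong[OF refl]) (auto simp: prod)
  also have "\<dots> = prod_num v D1 D2 D * (card D1 * card D2)"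
    by (simp add: card_cartesian_product)
  moreover have "{(\<alpha>, \<beta>) \<in> D1 \<times> D2. \<alpha> \<circ> \<beta> = \<gamma>} = ?fib \<gamma>" by auto
  ultimately show ?thesis using M by (simp add: D_def)
qed

section \<open>The embedding of the Schur algebra into matrices over the monoid algebra\<close>

definition wt :: "nat list \<Rightarrow> (nat \<Rightarrow> nat) set \<Rightarrow> nat list \<Rightarrow> 'k::field_char_0" where
  "wt l D m = of_nat (card (young m)) / (of_nat (stab_num X l D m) * of_nat (card D))"

lemma wt_nonzero:
  "l \<in> \<Lambda> \<Longrightarrow> m \<in> \<Lambda> \<Longrightarrow> D \<in> dcosets S l m \<Longrightarrow> wt l D m \<noteq> (0 :: 'k::field_char_0)"
  using dcosets_card_pos[of l m D] stab_num_pos[of l D m] card_young_pos[of m]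
  by (simp add: wt_def)

text \<open>By \<open>card_factorizations\<close> the number \<open>prod_num v D1 D2 D\<close> is
  \<open>|G_v| |D|\<close> times the number of factorizations, divided by \<open>|D1| |D2|\<close>.
  In \<open>wt\<close> the denominator \<open>n_X(D) |D|\<close> removes the stabilizer and coset
  orders; the numerator, the order of the right-hand Young subgroup, supplies \<open>|G_v|\<close>
  through \<open>wt l D1 v\<close> and \<open>|G_m|\<close> on both sides.\<close>

lemma struct_const_wt:
  assumes \<Lambda>: "l \<in> \<Lambda>" "v \<in> \<Lambda>" "m \<in> \<Lambda>"
    and D1: "D1 \<in> dcosets S l v" and D2: "D2 \<in> dcosets S v m" and \<gamma>: "\<gamma> \<in> S"
  shows "struct_const X l v m D1 D2 (dcoset l \<gamma> m) * wt l (dcoset l \<gamma> m) m =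
    wt l D1 v * wt v D2 m *
      (of_nat (card {(\<alpha>, \<beta>) \<in> D1 \<times> D2. \<alpha> \<circ> \<beta> = \<gamma>}) :: 'k::field_char_0)"
proof -
  define D where "D = dcoset l \<gamma> m"
  define c where "c = card {(\<alpha>, \<beta>) \<in> D1 \<times> D2. \<alpha> \<circ> \<beta> = \<gamma>}"
  have D: "D \<in> dcosets S l m" using \<gamma> by (simp add: D_def dcoset_in)
  have pos: "card D1 > 0" "card D2 > 0" "card D > 0"
    using dcosets_card_pos \<Lambda> D1 D2 D by blast+
  have st: "stab_num X l D m > 0" "stab_num X l D1 v > 0" "stab_num X v D2 m > 0"
    by (rule stab_num_pos)+
  have "of_nat (card (young v) * (card D * c)) = (of_nat (prod_num v D1 D2 D * (card D1 * card D2)) :: 'k)"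
    using card_factorizations[OF assms] by (simp add: D_def c_def)
  then have eq: "of_nat (prod_num v D1 D2 D) * (of_nat (card D1) * of_nat (card D2)) =
      of_nat (card (young v)) * (of_nat (card D) * (of_nat c :: 'k))"
    by simp
  have field: "nd * p / (s1 * s2) * (ym / (nd * d)) = yv / (s1 * d1) * (ym / (s2 * d2)) * c'"
    if "p * (d1 * d2) = yv * (d * c')" "nd \<noteq> 0" "s1 \<noteq> 0" "s2 \<noteq> 0" "d \<noteq> 0" "d1 \<noteq> 0" "d2 \<noteq> 0"
    for nd p s1 s2 ym d yv d1 d2 c' :: 'k
  proof -
    have "nd * p / (s1 * s2) * (ym / (nd * d)) = ym / (s1 * s2) * (p / d)"
      using that by (simp add: field_simps)
    also have "p / d = yv * c' / (d1 * d2)"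
      using that by (simp add: field_simps)
    finally show ?thesis by (simp add: field_simps)
  qed
  show ?thesis
    unfolding struct_const_def wt_def D_def[symmetric] c_def[symmetric] of_nat_mult
    by (rule field[OF eq]) (use pos st in auto)
qed

abbreviation B :: "('k::field_char_0, 'k schur) module" where "B \<equiv> gen_schur X n r S"

lemma B_simps:
  "carrier B = {a. \<forall>x. x \<notin> schur_basis n r S \<longrightarrow> a x = 0}"
  "one B = (\<lambda>x. \<Sum>l\<in>\<Lambda>. if x = (l, dcoset l id l, l) then 1 else 0)"
  "zero B = (\<lambda>x. 0)"
  "add B = (\<lambda>a b x. a x + b x)"
  "smult B = (\<lambda>c a x. c * a x)"
  by (simp_all add: gen_schur_def)

lemma B_outside: "a \<in> carrier B \<Longrightarrow> x \<notin> schur_basis n r S \<Longrightarrow> a x = 0"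
  by (simp only: B_simps) blast

lemma B_mult:
  "(a \<otimes>\<^bsub>B\<^esub> b) (l, D, m) = (if (l, D, m) \<in> schur_basis n r S
    then \<Sum>v\<in>\<Lambda>. \<Sum>D1\<in>dcosets S l v. \<Sum>D2\<in>dcosets S v m.
      a (l, D1, v) * b (v, D2, m) * struct_const X l v m D1 D2 D else 0)"
  by (simp add: gen_schur_def)

lemma finite_compositions: "finite \<Lambda>"
proof (rule finite_subset)
  show "\<Lambda> \<subseteq> {l. set l \<subseteq> {0..r} \<and> length l = n}"
    using member_le_sum_list by (fastforce simp: compositions_def)
  show "finite {l. set l \<subseteq> {0..r} \<and> length l = n}"
    by (rule finite_lists_length_eq) simp
qed

text \<open>\<open>\<Psi>\<close> sends the basis element \<open>f(l, D, m)\<close> to \<open>wt l D m\<close> times the sum of the elements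
  of \<open>D\<close>, placed at the matrix position \<open>(l, m)\<close>.  The image of \<open>B\<close> consists of the matrices
  whose \<open>(l, m)\<close> entries are bi-invariant under \<open>young l\<close> and \<open>young m\<close>.\<close>

definition \<Psi> :: "'k::field_char_0 schur \<Rightarrow> nat list \<Rightarrow> nat list \<Rightarrow> 'k monalg" where
  "\<Psi> a l m = (\<lambda>\<gamma>. if l \<in> \<Lambda> \<and> m \<in> \<Lambda> \<and> \<gamma> \<in> S
     then a (l, dcoset l \<gamma> m, m) * wt l (dcoset l \<gamma> m) m else 0)"

definition matmul :: "(nat list \<Rightarrow> nat list \<Rightarrow> 'k::field monalg) \<Rightarrow>
    (nat list \<Rightarrow> nat list \<Rightarrow> 'k monalg) \<Rightarrow> nat list \<Rightarrow> nat list \<Rightarrow> 'k monalg" where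
  "matmul P Q l m = (\<lambda>\<gamma>. \<Sum>v\<in>\<Lambda>. conv S (P l v) (Q v m) \<gamma>)"

lemma matmul_assoc: "matmul (matmul P Q) T = matmul P (matmul Q T)"
proof (intro ext)
  fix l m \<gamma>
  have "matmul (matmul P Q) T l m \<gamma> =
      (\<Sum>w\<in>\<Lambda>. \<Sum>v\<in>\<Lambda>. conv S (conv S (P l v) (Q v w)) (T w m) \<gamma>)"
    by (simp add: matmul_def conv_sum_left)
  also have "\<dots> = (\<Sum>v\<in>\<Lambda>. \<Sum>w\<in>\<Lambda>. conv S (P l v) (conv S (Q v w) (T w m)) \<gamma>)"
    unfolding conv_assoc by (rule sum.swap)
  also have "\<dots> = matmul P (matmul Q T) l m \<gamma>"
    by (simp add: matmul_def conv_sum_right)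
  finally show "matmul (matmul P Q) T l m \<gamma> = matmul P (matmul Q T) l m \<gamma>" .
qed

lemma sum_dcosets:
  assumes "l \<in> \<Lambda>" "m \<in> \<Lambda>"
  shows "(\<Sum>\<alpha>\<in>S. f \<alpha>) = (\<Sum>D\<in>dcosets S l m. \<Sum>\<alpha>\<in>D. f \<alpha> :: 'k::field)"
proof -
  have "(\<Sum>\<alpha>\<in>S. f \<alpha>) = (\<Sum>D\<in>dcosets S l m. sum f {\<alpha> \<in> S. dcoset l \<alpha> m = D})"
    by (rule sum.group[symmetric]) (auto simp: fin dcosets_def)
  also have "\<dots> = (\<Sum>D\<in>dcosets S l m. \<Sum>\<alpha>\<in>D. f \<alpha>)"
  proof (rule sum.cong[OF refl])
    fix D assume D: "D \<in> dcosets S l m"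
    have "{\<alpha> \<in> S. dcoset l \<alpha> m = D} = D"
      using dcosets_sub[OF assms D] dcosets_eq[OF assms D] dcoset_self by blast
    then show "sum f {\<alpha> \<in> S. dcoset l \<alpha> m = D} = sum f D" by simp
  qed
  finally show ?thesis .
qed

lemma \<Psi>_dcosets:
  assumes "l \<in> \<Lambda>" "m \<in> \<Lambda>" "D \<in> dcosets S l m" "\<alpha> \<in> D"
  shows "\<Psi> a l m \<alpha> = a (l, D, m) * wt l D m"
  using assms dcosets_eq[OF assms(1-3), of \<alpha>] dcosets_sub[OF assms(1-3)] by (auto simp: \<Psi>_def)

text \<open>Splitting the convolution along double cosets, the pair \<open>D1\<close>,
  \<open>D2\<close> contributes a constant times the number of factorizations of
  \<open>\<gamma>\<close> in \<open>D1 \<times> D2\<close>, and \<open>struct_const_wt\<close>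
  identifies this with the rescaled structure constant.\<close>

lemma \<Psi>_mult: "\<Psi> (a \<otimes>\<^bsub>B\<^esub> b) = matmul (\<Psi> a) (\<Psi> b)"
proof (intro ext)
  fix l m \<gamma>
  show "\<Psi> (a \<otimes>\<^bsub>B\<^esub> b) l m \<gamma> = matmul (\<Psi> a) (\<Psi> b) l m \<gamma>"
  proof (cases "l \<in> \<Lambda> \<and> m \<in> \<Lambda> \<and> \<gamma> \<in> S")
    case False
    then have "conv S (\<Psi> a l v) (\<Psi> b v m) \<gamma> = 0" for v
      using conv_closed[of \<gamma>] by (cases "\<gamma> \<in> S") (auto simp: \<Psi>_def cong: if_cong)
    with False show ?thesis by (auto simp: \<Psi>_def matmul_def)
  next
    case True
    then have lm: "l \<in> \<Lambda>" "m \<in> \<Lambda>" and \<gamma>: "\<gamma> \<in> S" by auto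
    let ?D = "dcoset l \<gamma> m"
    have "\<Psi> (a \<otimes>\<^bsub>B\<^esub> b) l m \<gamma> = (\<Sum>v\<in>\<Lambda>. \<Sum>D1\<in>dcosets S l v. \<Sum>D2\<in>dcosets S v m.
        a (l, D1, v) * b (v, D2, m) * (struct_const X l v m D1 D2 ?D * wt l ?D m))"
      using lm \<gamma> by (simp add: \<Psi>_def B_mult schur_basis_def dcoset_in sum_distrib_right mult.assoc)
    also have "\<dots> = (\<Sum>v\<in>\<Lambda>. conv S (\<Psi> a l v) (\<Psi> b v m) \<gamma>)"
    proof (rule sum.cong[OF refl])
      fix v assume v: "v \<in> \<Lambda>"
      have "conv S (\<Psi> a l v) (\<Psi> b v m) \<gamma> = (\<Sum>D1\<in>dcosets S l v. \<Sum>\<alpha>\<in>D1. \<Sum>\<beta>\<in>S.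
          if \<alpha> \<circ> \<beta> = \<gamma> then \<Psi> a l v \<alpha> * \<Psi> b v m \<beta> else 0)"
        unfolding conv_sum by (rule sum_dcosets[OF lm(1) v])
      also have "\<dots> = (\<Sum>D1\<in>dcosets S l v. \<Sum>\<alpha>\<in>D1. \<Sum>D2\<in>dcosets S v m. \<Sum>\<beta>\<in>D2.
          if \<alpha> \<circ> \<beta> = \<gamma> then \<Psi> a l v \<alpha> * \<Psi> b v m \<beta> else 0)"
        by (intro sum.cong refl sum_dcosets[OF v lm(2)])
      also have "\<dots> = (\<Sum>D1\<in>dcosets S l v. \<Sum>D2\<in>dcosets S v m. \<Sum>\<alpha>\<in>D1. \<Sum>\<beta>\<in>D2.
          if \<alpha> \<circ> \<beta> = \<gamma> then \<Psi> a l v \<alpha> * \<Psi> b v m \<beta> else 0)"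
        by (rule sum.cong[OF refl], rule sum.swap)
      also have "\<dots> = (\<Sum>D1\<in>dcosets S l v. \<Sum>D2\<in>dcosets S v m.
        a (l, D1, v) * b (v, D2, m) * (struct_const X l v m D1 D2 ?D * wt l ?D m))"
      proof (intro sum.cong refl)
        fix D1 D2 assume D1: "D1 \<in> dcosets S l v" and D2: "D2 \<in> dcosets S v m"
        let ?F = "{(\<alpha>, \<beta>) \<in> D1 \<times> D2. \<alpha> \<circ> \<beta> = \<gamma>}"
        have finP: "finite (D1 \<times> D2)"
          using dcosets_finite[OF lm(1) v D1] dcosets_finite[OF v lm(2) D2] by simp
        have "(\<Sum>\<alpha>\<in>D1. \<Sum>\<beta>\<in>D2. if \<alpha> \<circ> \<beta> = \<gamma> then \<Psi> a l v \<alpha> * \<Psi> b v m \<beta> else 0) =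
            (\<Sum>\<alpha>\<in>D1. \<Sum>\<beta>\<in>D2. if \<alpha> \<circ> \<beta> = \<gamma> then a (l, D1, v) * wt l D1 v * (b (v, D2, m) * wt v D2 m) else 0)"
          by (intro sum.cong refl) (simp add: \<Psi>_dcosets[OF lm(1) v D1] \<Psi>_dcosets[OF v lm(2) D2])
        also have "\<dots> = (\<Sum>x\<in>D1 \<times> D2. if fst x \<circ> snd x = \<gamma>
            then a (l, D1, v) * wt l D1 v * (b (v, D2, m) * wt v D2 m) else 0)"
          by (simp add: sum.cartesian_product split_def)
        also have "\<dots> = (\<Sum>x\<in>?F. a (l, D1, v) * wt l D1 v * (b (v, D2, m) * wt v D2 m))"
          by (rule sum.mono_neutral_cong_right[OF finP]) auto
        also have "\<dots> = a (l, D1, v) * b (v, D2, m) * (wt l D1 v * wt v D2 m * of_nat (card ?F))"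
          by simp
        finally show "(\<Sum>\<alpha>\<in>D1. \<Sum>\<beta>\<in>D2. if \<alpha> \<circ> \<beta> = \<gamma> then \<Psi> a l v \<alpha> * \<Psi> b v m \<beta> else 0) =
            a (l, D1, v) * b (v, D2, m) * (struct_const X l v m D1 D2 ?D * wt l ?D m)"
          unfolding struct_const_wt[OF lm(1) v lm(2) D1 D2 \<gamma>] .
      qed
      finally show "(\<Sum>D1\<in>dcosets S l v. \<Sum>D2\<in>dcosets S v m.
          a (l, D1, v) * b (v, D2, m) * (struct_const X l v m D1 D2 ?D * wt l ?D m)) =
          conv S (\<Psi> a l v) (\<Psi> b v m) \<gamma>" ..
    qed
    finally show ?thesis by (simp add: matmul_def)
  qed
qed

text \<open>The weights are nonzero, so each coefficient is recovered from the value at a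
  representative. Identities in \<open>B\<close> can therefore be verified on matrices.\<close>

lemma \<Psi>_inj:
  assumes a: "a \<in> carrier B" and b: "b \<in> carrier B" and eq: "\<Psi> a = \<Psi> b"
  shows "a = b"
proof
  fix x
  show "a x = b x"
  proof (cases "x \<in> schur_basis n r S")
    case False
    then show ?thesis using B_outside a b by metis
  next
    case True
    then obtain l D m where x: "x = (l, D, m)" and lm: "l \<in> \<Lambda>" "m \<in> \<Lambda>" "D \<in> dcosets S l m"
      by (auto simp: schur_basis_def)
    from eq have "\<Psi> a l m (rep D) = \<Psi> b l m (rep D)" by simp
    then show ?thesis
      by (simp add: \<Psi>_dcosets[OF lm dcosets_rep[OF lm]] wt_nonzero[OF lm] x)
  qed
qed

lemma \<Psi>_add: "\<Psi> (\<lambda>x. a x + b x) l m = (\<lambda>\<gamma>. \<Psi> a l m \<gamma> + \<Psi> b l m \<gamma>)"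
  by (auto simp: \<Psi>_def distrib_right)

lemma \<Psi>_outside: "\<gamma> \<notin> S \<Longrightarrow> \<Psi> a l m \<gamma> = 0"
  by (simp add: \<Psi>_def)

lemma \<Psi>_biinv:
  assumes "\<sigma> \<in> young l" "\<pi> \<in> young m" "\<gamma> \<in> S"
  shows "\<Psi> a l m (\<sigma> \<circ> \<gamma> \<circ> \<pi>) = \<Psi> a l m \<gamma>"
proof (cases "l \<in> \<Lambda> \<and> m \<in> \<Lambda>")
  case True
  have "dcoset l (\<sigma> \<circ> \<gamma> \<circ> \<pi>) m = dcoset l \<gamma> m"
    using dcosetI[OF assms(1,2)] dcoset_eq_iff by blast
  moreover have "\<sigma> \<circ> \<gamma> \<circ> \<pi> \<in> S" using True assms closed young_in_S by blast
  ultimately show ?thesis using assms by (simp add: \<Psi>_def)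
qed (auto simp: \<Psi>_def)

section \<open>Single matrix entries, averages over Young subgroups, and the ring laws\<close>

definition entry :: "nat list \<Rightarrow> nat list \<Rightarrow> 'k::field_char_0 monalg \<Rightarrow> 'k schur" where
  "entry l m h = (\<lambda>(l', D, m'). if l' = l \<and> m' = m \<and> D \<in> dcosets S l m then h (rep D) / wt l D m else 0)"

definition matrix_unit :: "nat list \<Rightarrow> nat list \<Rightarrow> 'k::field_char_0 monalg \<Rightarrow> nat list \<Rightarrow> nat list \<Rightarrow> 'k monalg" where
  "matrix_unit l m h = (\<lambda>l' m'. if l' = l \<and> m' = m then h else (\<lambda>\<gamma>. 0))"

lemma entry_closed: "l \<in> \<Lambda> \<Longrightarrow> m \<in> \<Lambda> \<Longrightarrow> entry l m h \<in> carrier B"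
  by (auto simp: B_simps entry_def schur_basis_def)

text \<open>A bi-invariant \<open>h\<close> is determined by one value on each double coset, and
  \<open>entry\<close> divides by the weight that \<open>\<Psi>\<close> multiplies back.\<close>

lemma \<Psi>_entry:
  assumes lm: "l \<in> \<Lambda>" "m \<in> \<Lambda>" and supp: "\<And>\<gamma>. \<gamma> \<notin> S \<Longrightarrow> h \<gamma> = 0"
    and inv: "\<And>\<sigma> \<pi> \<gamma>. \<sigma> \<in> young l \<Longrightarrow> \<pi> \<in> young m \<Longrightarrow> \<gamma> \<in> S \<Longrightarrow> h (\<sigma> \<circ> \<gamma> \<circ> \<pi>) = h \<gamma>"
  shows "\<Psi> (entry l m h) = matrix_unit l m h"
proof (intro ext)
  fix l' m' \<gamma>
  show "\<Psi> (entry l m h) l' m' \<gamma> = matrix_unit l m h l' m' \<gamma>"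
  proof (cases "l' = l \<and> m' = m \<and> \<gamma> \<in> S")
    case True
    then have D: "dcoset l \<gamma> m \<in> dcosets S l m" using dcoset_in by blast
    have "rep (dcoset l \<gamma> m) \<in> dcoset l \<gamma> m" by (rule dcosets_rep[OF lm D])
    then have "h (rep (dcoset l \<gamma> m)) = h \<gamma>" using inv True by (metis dcosetE)
    then show ?thesis using True lm D wt_nonzero[OF lm D, where 'k='a]
      by (simp add: \<Psi>_def entry_def matrix_unit_def)
  next
    case False
    then show ?thesis using supp by (auto simp: \<Psi>_def entry_def matrix_unit_def)
  qed
qed

lemma matmul_matrix_unit:
  assumes "v \<in> \<Lambda>"
  shows "matmul (matrix_unit l v h) (matrix_unit v m k) = matrix_unit l m (conv S h k)"
proof (intro ext)
  fix l' m' \<gamma>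
  have "matmul (matrix_unit l v h) (matrix_unit v m k) l' m' \<gamma> =
      (\<Sum>w\<in>\<Lambda>. if w = v then (if l' = l \<and> m' = m then conv S h k \<gamma> else 0) else 0)"
    unfolding matmul_def by (rule sum.cong) (auto simp: matrix_unit_def)
  then show "matmul (matrix_unit l v h) (matrix_unit v m k) l' m' \<gamma> = matrix_unit l m (conv S h k) l' m' \<gamma>"
    using assms finite_compositions by (simp add: matrix_unit_def)
qed

text \<open>For a composition \<open>l\<close> of \<open>r\<close>, the idempotent of the group
  algebra of \<open>young l\<close> belonging to the trivial representation; it is the diagonal
  entry of the image of \<open>1_l\<close> under \<open>\<Psi>\<close>.\<close>

definition avg :: "nat list \<Rightarrow> 'k::field_char_0 monalg" where
  "avg l = (\<lambda>\<sigma>. if \<sigma> \<in> young l then 1 / of_nat (card (young l)) else 0)"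

lemma avg_biinv:
  assumes "\<sigma> \<in> young l" "\<pi> \<in> young l"
  shows "avg l (\<sigma> \<circ> \<gamma> \<circ> \<pi>) = avg l \<gamma>"
proof -
  have "\<gamma> \<in> young l" if "\<sigma> \<circ> \<gamma> \<circ> \<pi> \<in> young l"
  proof -
    have "Hilbert_Choice.inv \<sigma> \<circ> ((\<sigma> \<circ> \<gamma> \<circ> \<pi>) \<circ> Hilbert_Choice.inv \<pi>) \<in> young l"
      by (rule young_comp[OF young_inv[OF assms(1)] young_comp[OF that young_inv[OF assms(2)]]])
    then show ?thesis using young_cancel[OF assms(1)] young_cancel[OF assms(2)] by (simp add: comp_assoc)
  qed
  then show ?thesis using young_comp assms by (auto simp: avg_def)
qed

text \<open>Each \<open>\<alpha>\<close> in \<open>young l\<close> meets exactly one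
  \<open>\<beta>\<close> with \<open>\<alpha> \<circ> \<beta> = \<gamma>\<close>, and invariance
  makes all these contributions equal to \<open>h \<gamma>\<close> divided by the group
  order.\<close>

lemma conv_avg_left:
  assumes l: "l \<in> \<Lambda>" and supp: "\<And>\<gamma>. \<gamma> \<notin> S \<Longrightarrow> h \<gamma> = 0"
    and inv: "\<And>\<sigma> \<gamma>. \<sigma> \<in> young l \<Longrightarrow> \<gamma> \<in> S \<Longrightarrow> h (\<sigma> \<circ> \<gamma>) = h \<gamma>"
  shows "conv S (avg l) h = h"
proof
  fix \<gamma>
  show "conv S (avg l) h \<gamma> = h \<gamma>"
  proof (cases "\<gamma> \<in> S")
    case \<gamma>: True
    let ?c = "1 / of_nat (card (young l)) * h \<gamma>"
    have "conv S (avg l) h \<gamma> = (\<Sum>\<alpha>\<in>S. if \<alpha> \<in> young l then ?c else 0)"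
      unfolding conv_sum
    proof (rule sum.cong[OF refl])
      fix \<alpha> assume "\<alpha> \<in> S"
      show "(\<Sum>\<beta>\<in>S. if \<alpha> \<circ> \<beta> = \<gamma> then avg l \<alpha> * h \<beta> else 0) = (if \<alpha> \<in> young l then ?c else 0)"
      proof (cases "\<alpha> \<in> young l")
        case True
        let ?\<beta> = "Hilbert_Choice.inv \<alpha> \<circ> \<gamma>"
        have "?\<beta> \<in> S" using True young_inv young_in_S[OF l] closed \<gamma> by blast
        have "(\<Sum>\<beta>\<in>S. if \<alpha> \<circ> \<beta> = \<gamma> then avg l \<alpha> * h \<beta> else 0) = (\<Sum>\<beta>\<in>S. if \<beta> = ?\<beta> then ?c else 0)"
        proof (rule sum.cong[OF refl])
          fix \<beta> assume "\<beta> \<in> S"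
          have "\<alpha> \<circ> \<beta> = \<gamma> \<longleftrightarrow> \<beta> = ?\<beta>" using young_cancel(1,2)[OF True] by metis
          then show "(if \<alpha> \<circ> \<beta> = \<gamma> then avg l \<alpha> * h \<beta> else 0) = (if \<beta> = ?\<beta> then ?c else 0)"
            using True inv[OF young_inv[OF True] \<gamma>] by (simp add: avg_def)
        qed
        then show ?thesis using \<open>?\<beta> \<in> S\<close> True fin by simp
      next
        case False
        then have "avg l \<alpha> = (0::'a)" by (simp add: avg_def)
        with False show ?thesis by (simp cong: if_cong)
      qed
    qed
    also have "\<dots> = (\<Sum>\<alpha>\<in>young l. ?c)"
      using young_in_S[OF l] by (intro sum.mono_neutral_cong_right[OF fin]) auto
    also have "\<dots> = h \<gamma>" using card_young_pos[of l] by simp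
    finally show ?thesis .
  qed (simp add: supp)
qed

lemma conv_avg_right:
  assumes l: "l \<in> \<Lambda>" and supp: "\<And>\<gamma>. \<gamma> \<notin> S \<Longrightarrow> h \<gamma> = 0"
    and inv: "\<And>\<sigma> \<gamma>. \<sigma> \<in> young l \<Longrightarrow> \<gamma> \<in> S \<Longrightarrow> h (\<gamma> \<circ> \<sigma>) = h \<gamma>"
  shows "conv S h (avg l) = h"
proof
  fix \<gamma>
  show "conv S h (avg l) \<gamma> = h \<gamma>"
  proof (cases "\<gamma> \<in> S")
    case \<gamma>: True
    let ?c = "h \<gamma> * (1 / of_nat (card (young l)))"
    have "conv S h (avg l) \<gamma> = (\<Sum>\<beta>\<in>S. \<Sum>\<alpha>\<in>S. if \<alpha> \<circ> \<beta> = \<gamma> then h \<alpha> * avg l \<beta> else 0)"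
      unfolding conv_sum by (rule sum.swap)
    also have "\<dots> = (\<Sum>\<beta>\<in>S. if \<beta> \<in> young l then ?c else 0)"
    proof (rule sum.cong[OF refl])
      fix \<beta> assume "\<beta> \<in> S"
      show "(\<Sum>\<alpha>\<in>S. if \<alpha> \<circ> \<beta> = \<gamma> then h \<alpha> * avg l \<beta> else 0) = (if \<beta> \<in> young l then ?c else 0)"
      proof (cases "\<beta> \<in> young l")
        case True
        let ?\<alpha> = "\<gamma> \<circ> Hilbert_Choice.inv \<beta>"
        have "?\<alpha> \<in> S" using True young_inv young_in_S[OF l] closed \<gamma> by blast
        have "(\<Sum>\<alpha>\<in>S. if \<alpha> \<circ> \<beta> = \<gamma> then h \<alpha> * avg l \<beta> else 0) = (\<Sum>\<alpha>\<in>S. if \<alpha> = ?\<alpha> then ?c else 0)"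
        proof (rule sum.cong[OF refl])
          fix \<alpha> assume "\<alpha> \<in> S"
          have "\<alpha> \<circ> \<beta> = \<gamma> \<longleftrightarrow> \<alpha> = ?\<alpha>" using young_cancel(3,4)[OF True] by metis
          then show "(if \<alpha> \<circ> \<beta> = \<gamma> then h \<alpha> * avg l \<beta> else 0) = (if \<alpha> = ?\<alpha> then ?c else 0)"
            using True inv[OF young_inv[OF True] \<gamma>] by (simp add: avg_def)
        qed
        then show ?thesis using \<open>?\<alpha> \<in> S\<close> True fin by simp
      next
        case False
        then have "avg l \<beta> = (0::'a)" by (simp add: avg_def)
        with False show ?thesis by (simp cong: if_cong)
      qed
    qed
    also have "\<dots> = (\<Sum>\<beta>\<in>young l. ?c)"
      using young_in_S[OF l] by (intro sum.mono_neutral_cong_right[OF fin]) auto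
    also have "\<dots> = h \<gamma>" using card_young_pos[of l] by simp
    finally show ?thesis .
  qed (simp add: supp)
qed

text \<open>With suitable sets \<open>F\<close> this covers the unit, the idempotents
  \<open>idem l\<close> and the sums that define levels, so multiplication by all of them is
  computed once.\<close>

definition diag :: "nat list set \<Rightarrow> 'k::field_char_0 schur" where
  "diag F = (\<lambda>x. \<Sum>l\<in>F. idem l x)"

lemma diag_eq:
  assumes "F \<subseteq> \<Lambda>"
  shows "diag F (l, D, m) = (if l \<in> F \<and> m = l \<and> D = dcoset l id l then 1 else 0)"
proof -
  have "finite F" using assms finite_compositions finite_subset by blast
  have "diag F (l, D, m) = (\<Sum>l'\<in>F. if l' = l then (if m = l \<and> D = dcoset l id l then 1 else 0) else 0)"
    unfolding diag_def by (rule sum.cong) (auto simp: idem_def)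
  also have "\<dots> = (if l \<in> F \<and> m = l \<and> D = dcoset l id l then 1 else 0)"
    using \<open>finite F\<close> by (cases "l \<in> F") simp_all
  finally show ?thesis .
qed

lemma diag_closed: "F \<subseteq> \<Lambda> \<Longrightarrow> diag F \<in> carrier B"
  by (auto simp: B_simps diag_eq schur_basis_def id_in dcoset_in)

lemma dcoset_id: "dcoset l id l = young l"
proof
  show "dcoset l id l \<subseteq> young l" using young_comp by (auto simp: dcoset_def)
  show "young l \<subseteq> dcoset l id l" using dcosetI[of _ l id l id] by auto
qed

text \<open>The representative of the class of the identity is an element of the group
  \<open>young l\<close>, so conjugation by it shows that either stabilizer is all of
  \<open>young l\<close>; two of the three group orders cancel.\<close>

lemma wt_id:
  assumes l: "l \<in> \<Lambda>"
  shows "wt l (young l) l = (1 / of_nat (card (young l)) :: 'k::field_char_0)"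
proof -
  have D: "young l \<in> dcosets S l l" using dcoset_in[OF id_in, of l l] by (simp add: dcoset_id)
  have \<rho>: "rep (young l) \<in> young l" by (rule dcosets_rep[OF l l D])
  let ?\<rho> = "rep (young l)" and ?i = "Hilbert_Choice.inv (rep (young l))"
  have i: "?i \<in> young l" using \<rho> by (rule young_inv)
  have 1: "\<exists>\<sigma>\<in>young l. ?\<rho> \<circ> \<pi> = \<sigma> \<circ> ?\<rho>" if "\<pi> \<in> young l" for \<pi>
    using that \<rho> i young_cancel(4)[OF \<rho>, of "?\<rho> \<circ> \<pi>"]
    by (intro bexI[of _ "?\<rho> \<circ> \<pi> \<circ> ?i"]) (auto intro!: young_comp)
  have 2: "\<exists>\<pi>\<in>young l. \<sigma> \<circ> ?\<rho> = ?\<rho> \<circ> \<pi>" if "\<sigma> \<in> young l" for \<sigma>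
    using that \<rho> i young_cancel(2)[OF \<rho>, of "\<sigma> \<circ> ?\<rho>"]
    by (intro bexI[of _ "?i \<circ> (\<sigma> \<circ> ?\<rho>)"]) (auto intro!: young_comp)
  have "stab X l ?\<rho> l = young l"
    using 1 2 by (cases X) auto
  then show ?thesis using card_young_pos[of l] by (simp add: wt_def stab_num_def)
qed

lemma \<Psi>_diag:
  assumes "F \<subseteq> \<Lambda>"
  shows "\<Psi> (diag F) l m = (if l = m \<and> l \<in> F then avg l else (\<lambda>\<gamma>. 0))"
proof
  fix \<gamma>
  show "\<Psi> (diag F) l m \<gamma> = (if l = m \<and> l \<in> F then avg l else (\<lambda>\<gamma>. 0)) \<gamma>"
  proof (cases "l = m \<and> l \<in> F")
    case True
    then have l: "l \<in> \<Lambda>" using assms by auto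
    have iff: "dcoset l \<gamma> l = dcoset l id l \<longleftrightarrow> \<gamma> \<in> young l"
      using dcoset_eq_iff[of l \<gamma> l id] by (simp add: dcoset_id)
    show ?thesis
    proof (cases "\<gamma> \<in> young l")
      case yes: True
      then have "dcoset l \<gamma> l = young l" using iff by (simp add: dcoset_id)
      then show ?thesis
        using True l yes young_in_S[OF l yes] by (simp add: \<Psi>_def diag_eq[OF assms] wt_id avg_def dcoset_id)
    next
      case False
      then show ?thesis using True iff by (simp add: \<Psi>_def diag_eq[OF assms] avg_def)
    qed
  next
    case False
    then show ?thesis by (auto simp: \<Psi>_def diag_eq[OF assms])
  qed
qed

text \<open>On matrices this multiplies row \<open>l\<close> by \<open>avg l\<close> when
  \<open>l\<close> is in \<open>F\<close> and by zero otherwise; bi-invariant entries are fixed by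
  the average.\<close>

lemma diag_left:
  assumes F: "F \<subseteq> \<Lambda>" and a: "a \<in> carrier B"
  shows "diag F \<otimes>\<^bsub>B\<^esub> a = (\<lambda>x. if fst x \<in> F then a x else 0)"
proof (rule \<Psi>_inj)
  show "diag F \<otimes>\<^bsub>B\<^esub> a \<in> carrier B" by (auto simp: B_simps B_mult)
  show "(\<lambda>x. if fst x \<in> F then a x else 0) \<in> carrier B" using a by (auto simp: B_simps)
  show "\<Psi> (diag F \<otimes>\<^bsub>B\<^esub> a) = \<Psi> (\<lambda>x. if fst x \<in> F then a x else 0)"
  proof (intro ext)
    fix l m \<gamma>
    have "\<Psi> (diag F \<otimes>\<^bsub>B\<^esub> a) l m \<gamma> =
        (\<Sum>v\<in>\<Lambda>. if v = l then (if l \<in> F then conv S (avg l) (\<Psi> a l m) \<gamma> else 0) else 0)"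
      unfolding \<Psi>_mult matmul_def by (rule sum.cong) (auto simp: \<Psi>_diag[OF F])
    also have "\<dots> = (if l \<in> F then conv S (avg l) (\<Psi> a l m) \<gamma> else 0)"
      using F finite_compositions by auto
    also have "\<dots> = (if l \<in> F then \<Psi> a l m \<gamma> else 0)"
    proof (cases "l \<in> F")
      case True
      have "conv S (avg l) (\<Psi> a l m) = \<Psi> a l m"
        using True F \<Psi>_biinv[of _ l id m] by (intro conv_avg_left) (auto simp: \<Psi>_outside)
      then show ?thesis by simp
    qed simp
    also have "\<dots> = \<Psi> (\<lambda>x. if fst x \<in> F then a x else 0) l m \<gamma>"
      by (simp add: \<Psi>_def)
    finally show "\<Psi> (diag F \<otimes>\<^bsub>B\<^esub> a) l m \<gamma> = \<Psi> (\<lambda>x. if fst x \<in> F then a x else 0) l m \<gamma>" .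
  qed
qed

lemma diag_right:
  assumes F: "F \<subseteq> \<Lambda>" and a: "a \<in> carrier B"
  shows "a \<otimes>\<^bsub>B\<^esub> diag F = (\<lambda>x. if snd (snd x) \<in> F then a x else 0)"
proof (rule \<Psi>_inj)
  show "a \<otimes>\<^bsub>B\<^esub> diag F \<in> carrier B" by (auto simp: B_simps B_mult)
  show "(\<lambda>x. if snd (snd x) \<in> F then a x else 0) \<in> carrier B" using a by (auto simp: B_simps)
  show "\<Psi> (a \<otimes>\<^bsub>B\<^esub> diag F) = \<Psi> (\<lambda>x. if snd (snd x) \<in> F then a x else 0)"
  proof (intro ext)
    fix l m \<gamma>
    have "\<Psi> (a \<otimes>\<^bsub>B\<^esub> diag F) l m \<gamma> =
        (\<Sum>v\<in>\<Lambda>. if v = m then (if m \<in> F then conv S (\<Psi> a l m) (avg m) \<gamma> else 0) else 0)"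
      unfolding \<Psi>_mult matmul_def by (rule sum.cong) (auto simp: \<Psi>_diag[OF F])
    also have "\<dots> = (if m \<in> F then conv S (\<Psi> a l m) (avg m) \<gamma> else 0)"
      using F finite_compositions by auto
    also have "\<dots> = (if m \<in> F then \<Psi> a l m \<gamma> else 0)"
    proof (cases "m \<in> F")
      case True
      have "conv S (\<Psi> a l m) (avg m) = \<Psi> a l m"
        using True F \<Psi>_biinv[of id l _ m] by (intro conv_avg_right) (auto simp: \<Psi>_outside)
      then show ?thesis by simp
    qed simp
    also have "\<dots> = \<Psi> (\<lambda>x. if snd (snd x) \<in> F then a x else 0) l m \<gamma>"
      by (simp add: \<Psi>_def)
    finally show "\<Psi> (a \<otimes>\<^bsub>B\<^esub> diag F) l m \<gamma> = \<Psi> (\<lambda>x. if snd (snd x) \<in> F then a x else 0) l m \<gamma>" .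
  qed
qed

lemma one_diag: "\<one>\<^bsub>B\<^esub> = diag \<Lambda>"
  by (simp add: B_simps diag_def idem_def[abs_def])

text \<open>Associativity and distributivity are pulled back along the injective
  \<open>\<Psi>\<close>; the unit laws are the case of all compositions in \<open>diag_left\<close>
  and \<open>diag_right\<close>.\<close>

lemma B_ring: "ring (B :: ('k::field_char_0, 'k schur) module)"
proof (rule ringI)
  have mult_closed: "a \<otimes>\<^bsub>B\<^esub> b \<in> carrier B" for a b :: "'k schur"
    by (auto simp: B_simps B_mult)
  show "abelian_group (B :: ('k, 'k schur) module)"
  proof (rule abelian_groupI)
    fix a :: "'k schur" assume "a \<in> carrier B"
    then show "\<exists>b\<in>carrier B. b \<oplus>\<^bsub>B\<^esub> a = \<zero>\<^bsub>B\<^esub>"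
      by (intro bexI[of _ "\<lambda>x. - a x"]) (auto simp: B_simps)
  qed (auto simp: B_simps add.assoc add.commute)
  show "monoid (B :: ('k, 'k schur) module)"
  proof (rule monoidI)
    show "\<one>\<^bsub>B\<^esub> \<in> carrier (B :: ('k, 'k schur) module)"
      by (simp add: one_diag diag_closed)
    fix a b c :: "'k schur"
    show "a \<otimes>\<^bsub>B\<^esub> b \<otimes>\<^bsub>B\<^esub> c = a \<otimes>\<^bsub>B\<^esub> (b \<otimes>\<^bsub>B\<^esub> c)"
      by (rule \<Psi>_inj[OF mult_closed mult_closed]) (simp add: \<Psi>_mult matmul_assoc)
    assume a: "a \<in> carrier B"
    have supp: "a x = 0" if "fst x \<notin> \<Lambda> \<or> snd (snd x) \<notin> \<Lambda>" for x
      by (rule B_outside[OF a]) (use that in \<open>auto simp: schur_basis_def\<close>)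
    show "\<one>\<^bsub>B\<^esub> \<otimes>\<^bsub>B\<^esub> a = a" "a \<otimes>\<^bsub>B\<^esub> \<one>\<^bsub>B\<^esub> = a"
      unfolding one_diag diag_left[OF order_refl a] diag_right[OF order_refl a]
      using supp by auto
  qed (rule mult_closed)
  fix a b c :: "'k schur"
  have add_cl: "x \<in> carrier B \<Longrightarrow> y \<in> carrier B \<Longrightarrow> x \<oplus>\<^bsub>B\<^esub> y \<in> carrier B" for x y :: "'k schur"
    by (auto simp: B_simps)
  show "(a \<oplus>\<^bsub>B\<^esub> b) \<otimes>\<^bsub>B\<^esub> c = a \<otimes>\<^bsub>B\<^esub> c \<oplus>\<^bsub>B\<^esub> b \<otimes>\<^bsub>B\<^esub> c"
    by (rule \<Psi>_inj[OF mult_closed add_cl[OF mult_closed mult_closed]], intro ext)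
      (simp add: \<Psi>_mult B_simps(4) \<Psi>_add matmul_def conv_add_left sum.distrib)
  show "c \<otimes>\<^bsub>B\<^esub> (a \<oplus>\<^bsub>B\<^esub> b) = c \<otimes>\<^bsub>B\<^esub> a \<oplus>\<^bsub>B\<^esub> c \<otimes>\<^bsub>B\<^esub> b"
    by (rule \<Psi>_inj[OF mult_closed add_cl[OF mult_closed mult_closed]], intro ext)
      (simp add: \<Psi>_mult B_simps(4) \<Psi>_add matmul_def conv_add_right sum.distrib)
qed

end

section \<open>The smallest partition, its full idempotent, and its corner\<close>

locale schur_level = schur_setting +
  assumes r_le_n: "r \<le> n"
begin

definition \<nu> :: "nat list" where "\<nu> = replicate r 1 @ replicate (n - r) 0"

abbreviation E :: "'k::field_char_0 schur" where "E \<equiv> idem \<nu>"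

lemma \<nu>_in: "\<nu> \<in> \<Lambda>"
  using r_le_n by (simp add: \<nu>_def compositions_def sum_list_replicate)

lemma E_diag: "E = diag {\<nu>}"
  by (simp add: diag_def)

lemma E_closed: "E \<in> carrier (B :: ('k::field_char_0, 'k schur) module)"
  using diag_closed[of "{\<nu>}"] \<nu>_in by (simp add: E_diag)

lemma E_left: "a \<in> carrier B \<Longrightarrow> E \<otimes>\<^bsub>B\<^esub> a = (\<lambda>x. if fst x = \<nu> then a x else 0)"
  using diag_left[of "{\<nu>}" a] \<nu>_in by (simp add: E_diag)

lemma E_right: "a \<in> carrier B \<Longrightarrow> a \<otimes>\<^bsub>B\<^esub> E = (\<lambda>x. if snd (snd x) = \<nu> then a x else 0)"
  using diag_right[of "{\<nu>}" a] \<nu>_in by (simp add: E_diag)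

lemma E_E: "E \<otimes>\<^bsub>B\<^esub> E = E"
  unfolding E_left[OF E_closed] by (auto simp: idem_def)

lemma E_mult_diag:
  assumes "F \<subseteq> \<Lambda>" "\<nu> \<in> F"
  shows "E \<otimes>\<^bsub>B\<^esub> diag F = E"
  unfolding diag_right[OF assms(1) E_closed] using assms(2) by (auto simp: idem_def)

text \<open>The idempotent \<open>E = 1\<^sub>\<nu>\<close> is full, since the average over \<open>young l\<close> factors through the
  position \<open>(l, \<nu>)\<close>.\<close>

lemma idem_factors:
  assumes l: "l \<in> \<Lambda>" and \<nu>: "young \<nu> = {id}"
  shows "\<exists>u\<in>carrier B. \<exists>v\<in>carrier B. idem l = u \<otimes>\<^bsub>B\<^esub> E \<otimes>\<^bsub>B\<^esub> (v :: 'k::field_char_0 schur)"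
proof -
  interpret B: ring "B :: ('k, 'k schur) module" by (rule B_ring)
  \<comment> \<open>Triviality of \<open>young \<nu>\<close> makes \<open>avg l\<close> bi-invariant
    also at the positions \<open>(l, \<nu>)\<close> and \<open>(\<nu>, l)\<close>. The product of
    the two entries is \<open>avg l\<close> at \<open>(l, l)\<close>, by idempotence of the
    average.\<close>
  let ?u = "entry l \<nu> (avg l) :: 'k schur" and ?v = "entry \<nu> l (avg l) :: 'k schur"
  have supp: "avg l \<gamma> = (0::'k)" if "\<gamma> \<notin> S" for \<gamma>
    using that young_in_S[OF l] by (auto simp: avg_def)
  have u: "?u \<in> carrier B" and v: "?v \<in> carrier B"
    by (simp_all add: entry_closed l \<nu>_in)
  have \<Psi>u: "\<Psi> ?u = matrix_unit l \<nu> (avg l)"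
    by (rule \<Psi>_entry[OF l \<nu>_in supp]) (use avg_biinv[of _ l id] in \<open>auto simp: \<nu>\<close>)
  have \<Psi>v: "\<Psi> ?v = matrix_unit \<nu> l (avg l)"
    by (rule \<Psi>_entry[OF \<nu>_in l supp]) (use avg_biinv[of id l] in \<open>auto simp: \<nu>\<close>)
  have uE: "?u \<otimes>\<^bsub>B\<^esub> E = ?u"
    unfolding E_right[OF u] by (auto simp: entry_def)
  have "idem l = ?u \<otimes>\<^bsub>B\<^esub> ?v"
  proof (rule \<Psi>_inj)
    show "idem l \<in> carrier (B :: ('k, 'k schur) module)"
      using diag_closed[of "{l}"] l by (simp add: diag_def)
    show "?u \<otimes>\<^bsub>B\<^esub> ?v \<in> carrier B" using u v by (rule B.m_closed)
    have "conv S (avg l) (avg l) = (avg l :: 'k monalg)"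
      by (rule conv_avg_left[OF l supp]) (use avg_biinv[of _ l id] in auto)
    then have "\<Psi> (?u \<otimes>\<^bsub>B\<^esub> ?v) = matrix_unit l l (avg l)"
      by (simp add: \<Psi>_mult \<Psi>u \<Psi>v matmul_matrix_unit[OF \<nu>_in])
    moreover have "\<Psi> (idem l :: 'k schur) = matrix_unit l l (avg l)"
    proof -
      have "idem l = (diag {l} :: 'k schur)" by (simp add: diag_def)
      then show ?thesis using l by (intro ext) (auto simp: \<Psi>_diag matrix_unit_def)
    qed
    ultimately show "\<Psi> (idem l) = \<Psi> (?u \<otimes>\<^bsub>B\<^esub> ?v)" by simp
  qed
  then show ?thesis using u v uE by metis
qed

text \<open>The unit is the sum of the \<open>idem l\<close>, each of the form \<open>u E v\<close>.
  The set \<open>T\<close> is only asked to be additive, which suits both a two-sided ideal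
  containing \<open>E\<close> and the annihilator of a vector.\<close>

lemma one_in_additive_closure:
  fixes T :: "'k::field_char_0 schur set"
  assumes \<nu>: "young \<nu> = {id}" and zero: "\<zero>\<^bsub>B\<^esub> \<in> T"
    and add: "\<And>a b. a \<in> T \<Longrightarrow> b \<in> T \<Longrightarrow> a \<oplus>\<^bsub>B\<^esub> b \<in> T"
    and mult: "\<And>u v. u \<in> carrier B \<Longrightarrow> v \<in> carrier B \<Longrightarrow> u \<otimes>\<^bsub>B\<^esub> E \<otimes>\<^bsub>B\<^esub> v \<in> T"
  shows "\<one>\<^bsub>B\<^esub> \<in> T"
proof -
  have "diag F \<in> T" if "finite F" "F \<subseteq> \<Lambda>" for F
    using that
  proof (induction F rule: finite_induct)
    case empty
    then show ?case using zero by (simp add: diag_def B_simps)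
  next
    case (insert l F)
    have "\<exists>u\<in>carrier B. \<exists>v\<in>carrier B. idem l = u \<otimes>\<^bsub>B\<^esub> E \<otimes>\<^bsub>B\<^esub> (v :: 'k schur)"
      using insert.prems by (intro idem_factors \<nu>) auto
    then have "idem l \<in> T" using mult by auto
    moreover have "diag (insert l F) = (idem l \<oplus>\<^bsub>B\<^esub> diag F :: 'k schur)"
      using insert.hyps by (simp add: diag_def B_simps)
    ultimately show ?case using add insert by simp
  qed
  then show ?thesis using finite_compositions by (simp add: one_diag)
qed

lemma take_\<nu>: "i \<le> r \<Longrightarrow> take i \<nu> = replicate i 1"
  by (simp add: \<nu>_def take_replicate min_def)

lemma young_\<nu>: "young \<nu> = {id}"
proof
  show "{id} \<subseteq> young \<nu>" by simp
  show "young \<nu> \<subseteq> {id}"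
  proof
    fix \<sigma> assume \<sigma>: "\<sigma> \<in> young \<nu>"
    then have perm: "\<sigma> permutes {1..r}"
      using \<nu>_in by (auto simp: young_def sym_maps_def compositions_def)
    have "\<sigma> x = x" for x
    proof (cases "x \<in> {1..r}")
      case True
      then obtain i where i: "x = Suc i" "i < r" by (cases x) auto
      \<comment> \<open>Parts are counted from 0 and letters from 1, whence the shift.\<close>
      have "block \<nu> i = {Suc i}"
        using i take_\<nu>[of i] take_\<nu>[of "Suc i"] by (auto simp: block_def sum_list_replicate)
      moreover have "\<sigma> ` block \<nu> i = block \<nu> i"
        using \<sigma> i r_le_n by (simp add: young_def \<nu>_def)
      ultimately show ?thesis using i by simp
    next
      case False
      then show ?thesis using perm permutes_not_in by metis
    qed
    then show "\<sigma> \<in> {id}" by auto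
  qed
qed

lemma dcoset_\<nu>: "dcoset \<nu> \<alpha> \<nu> = {\<alpha>}"
  by (auto simp: dcoset_def young_\<nu>)

definition \<Phi> :: "'k::field_char_0 monalg \<Rightarrow> 'k schur" where
  "\<Phi> a = entry \<nu> \<nu> a"

text \<open>The Young subgroup, the stabilizer and the double coset all have one element, so no
  rescaling takes place at the position \<open>(\<nu>, \<nu>)\<close>.\<close>

lemma wt_\<nu>: "wt \<nu> {\<alpha>} \<nu> = (1 :: 'k::field_char_0)"
proof -
  have "stab X \<nu> \<beta> \<nu> = {id}" for \<beta>
    by (cases X) (auto simp: young_\<nu>)
  then show ?thesis by (simp add: wt_def stab_num_def young_\<nu>)
qed

lemma \<Phi>_eq: "\<Phi> a (l, D, m) = (if l = \<nu> \<and> m = \<nu> \<and> D \<in> dcosets S \<nu> \<nu> then a (rep D) else 0)"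
  by (auto simp: \<Phi>_def entry_def dcosets_def dcoset_\<nu> wt_\<nu>)

lemma \<Psi>_\<Phi>:
  assumes "a \<in> carrier (monoid_algebra S)"
  shows "\<Psi> (\<Phi> a) = matrix_unit \<nu> \<nu> a"
  unfolding \<Phi>_def by (rule \<Psi>_entry[OF \<nu>_in \<nu>_in]) (use assms in \<open>auto simp: young_\<nu>\<close>)

lemma \<Phi>_closed: "\<Phi> a \<in> carrier B"
  unfolding \<Phi>_def by (rule entry_closed[OF \<nu>_in \<nu>_in])

definition EBE :: "'k::field_char_0 schur set" where
  "EBE = {c \<in> carrier B. E \<otimes>\<^bsub>B\<^esub> c = c \<and> c \<otimes>\<^bsub>B\<^esub> E = c}"

lemma \<Phi>_in_EBE: "\<Phi> a \<in> EBE"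
proof -
  have "E \<otimes>\<^bsub>B\<^esub> \<Phi> a = \<Phi> a" "\<Phi> a \<otimes>\<^bsub>B\<^esub> E = \<Phi> a"
    unfolding E_left[OF \<Phi>_closed] E_right[OF \<Phi>_closed] by (auto simp: \<Phi>_eq)
  then show ?thesis by (simp add: EBE_def \<Phi>_closed)
qed

lemma \<Phi>_mult:
  assumes "a \<in> carrier (monoid_algebra S)" "b \<in> carrier (monoid_algebra S)"
  shows "\<Phi> (conv S a b) = \<Phi> a \<otimes>\<^bsub>B\<^esub> \<Phi> b"
proof (rule \<Psi>_inj[OF \<Phi>_closed])
  interpret B: ring "B :: ('a, 'a schur) module" by (rule B_ring)
  show "\<Phi> a \<otimes>\<^bsub>B\<^esub> \<Phi> b \<in> carrier B" by (intro B.m_closed \<Phi>_closed)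
  have "conv S a b \<in> carrier (monoid_algebra S)" by simp
  then show "\<Psi> (\<Phi> (conv S a b)) = \<Psi> (\<Phi> a \<otimes>\<^bsub>B\<^esub> \<Phi> b)"
    by (simp only: \<Psi>_mult \<Psi>_\<Phi> assms matmul_matrix_unit[OF \<nu>_in])
qed

lemma \<Phi>_add: "\<Phi> (\<lambda>\<gamma>. a \<gamma> + b \<gamma>) = (\<lambda>x. \<Phi> a x + \<Phi> b x)"
  by (rule ext) (auto simp: \<Phi>_eq split_paired_all)

lemma \<Phi>_smult: "\<Phi> (\<lambda>\<gamma>. c * a \<gamma>) = (\<lambda>x. c * \<Phi> a x)"
  by (rule ext) (auto simp: \<Phi>_eq split_paired_all)

lemma \<Phi>_one: "\<Phi> (basis_map id) = (E :: 'k::field_char_0 schur)"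
proof (rule \<Psi>_inj[OF \<Phi>_closed E_closed])
  have car: "(basis_map id :: 'k monalg) \<in> carrier (monoid_algebra S)"
    using id_in by (auto simp: basis_map_def)
  have avg: "avg \<nu> = (basis_map id :: 'k monalg)"
    by (auto simp: avg_def young_\<nu> basis_map_def)
  show "\<Psi> (\<Phi> (basis_map id)) = \<Psi> (E :: 'k schur)"
    unfolding \<Psi>_\<Phi>[OF car] E_diag
    by (intro ext) (auto simp: \<Psi>_diag \<nu>_in matrix_unit_def avg)
qed

text \<open>Multiplication by \<open>E\<close> on both sides leaves only the position
  \<open>(\<nu>, \<nu>)\<close>; a corner element is therefore the image of its matrix entry
  there.\<close>

lemma \<Phi>_bij: "bij_betw \<Phi> (carrier (monoid_algebra S :: ('k::field_char_0, 'k monalg) module)) EBE"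
  unfolding bij_betw_def
proof
  show "inj_on \<Phi> (carrier (monoid_algebra S :: ('k, 'k monalg) module))"
  proof (rule inj_onI)
    fix a b :: "'k monalg"
    assume *: "a \<in> carrier (monoid_algebra S)" "b \<in> carrier (monoid_algebra S)" "\<Phi> a = \<Phi> b"
    then have "matrix_unit \<nu> \<nu> a \<nu> \<nu> = matrix_unit \<nu> \<nu> b \<nu> \<nu>" using \<Psi>_\<Phi> by metis
    then show "a = b" by (simp add: matrix_unit_def)
  qed
  show "\<Phi> ` carrier (monoid_algebra S :: ('k, 'k monalg) module) = EBE"
  proof safe
    fix c :: "'k schur" assume "c \<in> EBE"
    then have c: "c \<in> carrier B" "E \<otimes>\<^bsub>B\<^esub> c = c" "c \<otimes>\<^bsub>B\<^esub> E = c" by (auto simp: EBE_def)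
    have car: "\<Psi> c \<nu> \<nu> \<in> carrier (monoid_algebra S)" by (simp add: \<Psi>_outside)
    have zero: "c (l, D, m) = 0" if "l \<noteq> \<nu> \<or> m \<noteq> \<nu>" for l D m
      using that fun_cong[OF c(2)[unfolded E_left[OF c(1)]], of "(l, D, m)"]
        fun_cong[OF c(3)[unfolded E_right[OF c(1)]], of "(l, D, m)"] by auto
    have "\<Phi> (\<Psi> c \<nu> \<nu>) = c"
    proof (rule \<Psi>_inj[OF \<Phi>_closed c(1)])
      show "\<Psi> (\<Phi> (\<Psi> c \<nu> \<nu>)) = \<Psi> c"
        unfolding \<Psi>_\<Phi>[OF car] by (intro ext) (auto simp: matrix_unit_def \<Psi>_def zero)
    qed
    then show "c \<in> \<Phi> ` carrier (monoid_algebra S)" using car by (metis image_eqI)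
  qed (rule \<Phi>_in_EBE)
qed

section \<open>The lexicographic order and the idempotents of the levels\<close>

lemma sorted_\<nu>: "sorted_wrt (\<ge>) \<nu>"
proof -
  have "sorted_wrt (\<ge>) (replicate k x)" for k and x :: nat by (induction k) auto
  then show ?thesis by (auto simp: \<nu>_def sorted_wrt_append)
qed

text \<open>Suppose \<open>p\<close> is smaller at the first difference. There \<open>\<nu>\<close>
  has a 1 and \<open>p\<close> a 0, and since \<open>p\<close> decreases it vanishes from that place
  on. Its sum is then the number of preceding ones, which is less than \<open>r\<close>.\<close>

lemma \<nu>_lex_least:
  assumes p: "length p = n" "sum_list p = r" "sorted_wrt (\<ge>) p" and ne: "p \<noteq> \<nu>"
  shows "(\<nu>, p) \<in> lex less_than"
proof -
  have len: "length \<nu> = n" using \<nu>_in by (simp add: compositions_def)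
  obtain q a p' b \<nu>' where q: "a \<noteq> b" "p = q @ [a] @ p'" "\<nu> = q @ [b] @ \<nu>'"
    using same_length_different[OF ne] p(1) len by auto
  have "b < a"
  proof (rule ccontr)
    assume "\<not> b < a"
    with q(1) have ab: "a < b" by simp
    let ?i = "length q"
    have b: "b = \<nu> ! ?i" using q(3) by simp
    have "?i < n" using len arg_cong[OF q(3), of length] by simp
    then have "\<nu> ! ?i = (if ?i < r then 1 else 0)" by (simp add: \<nu>_def nth_append)
    with ab b have i: "?i < r" and "b = 1" by (simp_all split: if_splits)
    with ab have a: "a = 0" by simp
    have "x = 0" if "x \<in> set p'" for x
      using p(3) that a unfolding q(2) by (auto simp: sorted_wrt_append)
    then have "sum_list p' = 0" by (simp add: sum_list_eq_0_iff)
    moreover have "sum_list p = sum_list q + a + sum_list p'" by (simp add: q(2))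
    ultimately have "sum_list q = r" using p(2) a by linarith
    moreover have "q = replicate ?i 1" using q(3) take_\<nu>[of ?i] i by simp
    from arg_cong[OF this, of sum_list] have "sum_list q = ?i"
      by (simp only: sum_list_replicate mult_1_right of_nat_id)
    ultimately show False using i by simp
  qed
  then show ?thesis
    unfolding lex_conv using q p(1) len by (auto intro!: exI[of _ q])
qed

lemma plus_part_partition: "sorted_wrt (\<ge>) l \<Longrightarrow> plus_part l = l"
proof -
  assume "sorted_wrt (\<ge>) l"
  then have "sorted (rev l)" by (simp add: sorted_wrt_rev)
  then have "sort l = rev l" by (intro properties_for_sort) auto
  then show ?thesis by (simp add: plus_part_def)
qed

lemma plus_part_props:
  assumes "l \<in> \<Lambda>"
  shows "length (plus_part l) = n" "sum_list (plus_part l) = r" "sorted_wrt (\<ge>) (plus_part l)"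
proof -
  have "mset (plus_part l) = mset l" by (simp add: plus_part_def)
  then show "length (plus_part l) = n" "sum_list (plus_part l) = r"
    using assms by (auto simp: compositions_def plus_part_def sum_mset_sum_list[symmetric])
  show "sorted_wrt (\<ge>) (plus_part l)" by (simp add: plus_part_def sorted_wrt_rev)
qed

lemma not_less_\<nu>: "l \<in> \<Lambda> \<Longrightarrow> \<not> comp_less l \<nu>"
proof
  assume l: "l \<in> \<Lambda>" and "comp_less l \<nu>"
  then have less: "(plus_part l, \<nu>) \<in> lex less_than"
    by (simp add: comp_less_def plus_part_partition[OF sorted_\<nu>])
  have as: "asym (lex less_than)"
    by (rule asym_lex) (simp add: asym_less_than)
  show False
  proof (cases "plus_part l = \<nu>")
    case True
    then show ?thesis using less asymD[OF as, of \<nu> \<nu>] by simp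
  next
    case False
    then show ?thesis using \<nu>_lex_least[OF plus_part_props[OF l]] less as by (meson asymD)
  qed
qed

lemma \<nu>_less: "l \<in> partitions n r \<Longrightarrow> l \<noteq> \<nu> \<Longrightarrow> comp_less \<nu> l"
  unfolding comp_less_def plus_part_partition[OF sorted_\<nu>]
  using \<nu>_lex_least by (simp add: partitions_def compositions_def plus_part_partition)

lemma e_below_diag: "e_below n r l = diag {m \<in> \<Lambda>. comp_less m l}"
  by (simp add: e_below_def diag_def)

lemma e_below_\<nu>: "e_below n r \<nu> = \<zero>\<^bsub>B\<^esub>"
proof -
  have none: "{m \<in> \<Lambda>. comp_less m \<nu>} = {}" using not_less_\<nu> by blast
  show ?thesis unfolding e_below_diag none by (simp add: diag_def B_simps)
qed

lemma e_upto_\<nu>: "e_upto n r \<nu> = diag {m \<in> \<Lambda>. comp_equiv m \<nu>}"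
  unfolding e_upto_def e_below_\<nu> by (simp add: diag_def B_simps)

lemma E_e_upto: "E \<otimes>\<^bsub>B\<^esub> e_upto n r \<nu> = E"
  unfolding e_upto_\<nu> by (rule E_mult_diag) (auto simp: \<nu>_in comp_equiv_def)

text \<open>As \<open>\<nu>\<close> lies below \<open>l\<close>, the product
  \<open>E e_below\<close> is \<open>E\<close>; so the ideal contains the full idempotent
  \<open>E\<close>, hence 1.\<close>

lemma ideal_below:
  assumes l: "l \<in> partitions n r" "l \<noteq> \<nu>"
  shows "Idl\<^bsub>B\<^esub> {e_below n r l} = carrier (B :: ('k::field_char_0, 'k schur) module)"
proof -
  interpret B: ring "B :: ('k, 'k schur) module" by (rule B_ring)
  let ?F = "{m \<in> \<Lambda>. comp_less m l}"
  have e: "e_below n r l \<in> carrier (B :: ('k, 'k schur) module)"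
    unfolding e_below_diag by (rule diag_closed) auto
  interpret I: ideal "Idl\<^bsub>B\<^esub> {e_below n r l}" "B :: ('k, 'k schur) module"
    using e by (intro B.genideal_ideal) auto
  have "e_below n r l \<in> Idl\<^bsub>B\<^esub> {e_below n r l :: 'k schur}"
    using e by (intro B.genideal_self') auto
  then have "E \<otimes>\<^bsub>B\<^esub> e_below n r l \<in> Idl\<^bsub>B\<^esub> {e_below n r l :: 'k schur}"
    using E_closed by (rule I.I_l_closed)
  moreover have "E \<otimes>\<^bsub>B\<^esub> e_below n r l = (E :: 'k schur)"
    unfolding e_below_diag using \<nu>_in \<nu>_less[OF l] by (intro E_mult_diag) auto
  ultimately have E_in: "E \<in> Idl\<^bsub>B\<^esub> {e_below n r l :: 'k schur}" by simp
  have "\<one>\<^bsub>B\<^esub> \<in> Idl\<^bsub>B\<^esub> {e_below n r l :: 'k schur}"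
    by (rule one_in_additive_closure[OF young_\<nu>])
      (auto intro: I.I_l_closed I.I_r_closed E_in)
  then show ?thesis by (rule I.one_imp_carrier)
qed

section \<open>The algebras attached to the levels\<close>

lemma corner_simps [simp]:
  "monoid.mult (corner A e) = monoid.mult A" "one (corner A e) = e" "zero (corner A e) = zero A"
  "add (corner A e) = add A" "smult (corner A e) = smult A"
  by (simp_all add: corner_def)

lemma corner_carrier_eq:
  assumes "e \<in> carrier B" "e \<otimes>\<^bsub>B\<^esub> e = (e :: 'k::field_char_0 schur)"
  shows "carrier (corner B e) = {c \<in> carrier B. e \<otimes>\<^bsub>B\<^esub> c = c \<and> c \<otimes>\<^bsub>B\<^esub> e = c}"
proof -
  interpret B: ring "B :: ('k, 'k schur) module" by (rule B_ring)
  show ?thesis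
  proof safe
    fix c assume "c \<in> carrier (corner B e)"
    then obtain b where b: "b \<in> carrier B" "c = e \<otimes>\<^bsub>B\<^esub> b \<otimes>\<^bsub>B\<^esub> e" by (auto simp: corner_def)
    show "c \<in> carrier B" using b assms by (metis B.m_closed)
    show "e \<otimes>\<^bsub>B\<^esub> c = c" using b assms by (metis B.m_assoc B.m_closed)
    show "c \<otimes>\<^bsub>B\<^esub> e = c" using b assms by (metis B.m_assoc B.m_closed)
  next
    fix c assume "c \<in> carrier B" "e \<otimes>\<^bsub>B\<^esub> c = c" "c \<otimes>\<^bsub>B\<^esub> e = c"
    then show "c \<in> carrier (corner B e)" unfolding corner_def by simp metis
  qed
qed

text \<open>By \<open>ideal_below\<close> the corner is divided by itself, so its only coset is the
  zero coset.\<close>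

lemma level_algebra_trivial:
  assumes l: "l \<in> partitions n r" "l \<noteq> \<nu>"
  shows "carrier (level_algebra B n r l) =
    {\<zero>\<^bsub>level_algebra (B :: ('k::field_char_0, 'k schur) module) n r l\<^esub>}"
proof -
  interpret B: ring "B :: ('k, 'k schur) module" by (rule B_ring)
  have l': "l \<in> \<Lambda>" using l by (simp add: partitions_def)
  have d: "idem l = (diag {l} :: 'k schur)" by (simp add: diag_def)
  have e: "idem l \<in> carrier (B :: ('k, 'k schur) module)"
    using diag_closed[of "{l}"] l' by (simp add: d)
  have ee: "idem l \<otimes>\<^bsub>B\<^esub> idem l = (idem l :: 'k schur)"
  proof -
    have "diag {l} \<otimes>\<^bsub>B\<^esub> idem l = (\<lambda>x. if fst x \<in> {l} then idem l x else 0 :: 'k)"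
      by (rule diag_left) (use l' e in auto)
    also have "\<dots> = idem l" by (auto simp: idem_def)
    finally show ?thesis by (simp add: d)
  qed
  let ?A = "corner (B :: ('k, 'k schur) module) (idem l)"
  note A = corner_carrier_eq[OF e ee]
  have AB: "x \<in> carrier B" if "x \<in> carrier ?A" for x using that A by auto
  have J: "carrier ?A \<inter> Idl\<^bsub>B\<^esub> {e_below n r l} = carrier ?A"
    unfolding ideal_below[OF l] using AB by auto
  have plus: "x \<oplus>\<^bsub>B\<^esub> y \<in> carrier ?A" if "x \<in> carrier ?A" "y \<in> carrier ?A" for x y
    using that e unfolding A by (simp add: B.l_distr B.r_distr)
  have minus: "x \<ominus>\<^bsub>B\<^esub> y \<in> carrier ?A" if "x \<in> carrier ?A" "y \<in> carrier ?A" for x y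
    using that e unfolding A by (simp add: a_minus_def B.l_distr B.r_distr B.l_minus B.r_minus)
  have coset: "carrier ?A +>\<^bsub>?A\<^esub> x = carrier ?A" if x: "x \<in> carrier ?A" for x
  proof
    show "carrier ?A +>\<^bsub>?A\<^esub> x \<subseteq> carrier ?A"
      using x plus by (auto simp: a_r_coset_def r_coset_def)
    show "carrier ?A \<subseteq> carrier ?A +>\<^bsub>?A\<^esub> x"
    proof
      fix y assume y: "y \<in> carrier ?A"
      then have "(y \<ominus>\<^bsub>B\<^esub> x) \<oplus>\<^bsub>B\<^esub> x = y"
        using x AB by (simp add: a_minus_def B.a_assoc B.l_neg)
      then show "y \<in> carrier ?A +>\<^bsub>?A\<^esub> x"
        using minus[OF y x] by (force simp: a_r_coset_def r_coset_def)
    qed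
  qed
  have ne: "carrier ?A \<noteq> {}" using e ee A by auto
  show ?thesis
    unfolding level_algebra_def quot_algebra_def J
    using coset ne by (auto simp: FactRing_def A_RCOSETS_def' )
qed

text \<open>No composition lies below \<open>\<nu>\<close>, so the ideal is zero and the quotient is
  the corner itself, with each element wrapped in a singleton coset.\<close>

lemma level_algebra_\<nu>:
  defines "C \<equiv> level_algebra (B :: ('k::field_char_0, 'k schur) module) n r \<nu>"
  shows "carrier C = (\<lambda>c. {c}) ` EBE" "one C = {E}" "zero C = {\<zero>\<^bsub>B\<^esub>}"
    and "\<And>c d. c \<in> EBE \<Longrightarrow> d \<in> EBE \<Longrightarrow> {c} \<otimes>\<^bsub>C\<^esub> {d} = {c \<otimes>\<^bsub>B\<^esub> d}"
    and "\<And>c d. {c} \<oplus>\<^bsub>C\<^esub> {d} = {c \<oplus>\<^bsub>B\<^esub> d}"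
    and "\<And>k c. k \<odot>\<^bsub>C\<^esub> {c} = {k \<odot>\<^bsub>B\<^esub> c}"
proof -
  interpret B: ring "B :: ('k, 'k schur) module" by (rule B_ring)
  let ?A = "corner (B :: ('k, 'k schur) module) E"
  have A: "carrier ?A = EBE"
    unfolding EBE_def by (rule corner_carrier_eq[OF E_closed E_E])
  have "\<zero>\<^bsub>B\<^esub> \<in> (EBE :: 'k schur set)"
    unfolding EBE_def using E_closed[where 'k = 'k] by simp
  then have J: "carrier ?A \<inter> Idl\<^bsub>B\<^esub> {e_below n r \<nu>} = {\<zero>\<^bsub>B\<^esub>}"
    unfolding e_below_\<nu> A B.genideal_zero by auto
  have coset: "{\<zero>\<^bsub>B\<^esub>} +>\<^bsub>?A\<^esub> x = {x}" for x
    by (simp add: a_r_coset_def r_coset_def B_simps)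
  note defs = C_def level_algebra_def quot_algebra_def J FactRing_def
  show "carrier C = (\<lambda>c. {c}) ` EBE" unfolding defs by (auto simp: A_RCOSETS_def' coset A)
  show "one C = {E}" unfolding defs by (simp add: coset)
  show "zero C = {\<zero>\<^bsub>B\<^esub>}" unfolding defs by simp
  show "{c} \<otimes>\<^bsub>C\<^esub> {d} = {c \<otimes>\<^bsub>B\<^esub> d}" if "c \<in> EBE" "d \<in> EBE" for c d
    unfolding defs by (simp add: rcoset_mult_def coset)
  show "{c} \<oplus>\<^bsub>C\<^esub> {d} = {c \<oplus>\<^bsub>B\<^esub> d}" for c d
    unfolding defs by (simp add: set_add_def set_mult_def)
  show "k \<odot>\<^bsub>C\<^esub> {c} = {k \<odot>\<^bsub>B\<^esub> c}" for k c
    unfolding defs by (simp add: coset)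
qed

lemma \<Phi>_iso:
  "(\<lambda>a. {\<Phi> a}) \<in> algebra_iso (monoid_algebra S) (level_algebra (B :: ('k::field_char_0, 'k schur) module) n r \<nu>)"
proof -
  have "bij_betw (\<lambda>c. {c}) EBE ((\<lambda>c. {c}) ` (EBE :: 'k schur set))"
    by (intro bij_betw_imageI) (auto intro: inj_onI)
  from bij_betw_trans[OF \<Phi>_bij this] show ?thesis
    unfolding algebra_iso_def ring_iso_def ring_hom_def
    by (simp add: \<Phi>_in_EBE Pi_iff level_algebra_\<nu> \<Phi>_mult \<Phi>_one \<Phi>_add \<Phi>_smult B_simps comp_def)
qed

end

section \<open>Irreducible modules of the Schur algebra and of the monoid algebra\<close>

context schur_level
begin

abbreviation kS :: "('k::field_char_0, 'k monalg) module" where "kS \<equiv> monoid_algebra S"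

definition lift :: "('k::field_char_0 monalg \<Rightarrow> 'k schur set) \<Rightarrow> 'k monalg \<Rightarrow> 'k schur" where
  "lift \<phi> b = the_elem (\<phi> b)"

definition unlift :: "('k::field_char_0 monalg \<Rightarrow> 'k schur set) \<Rightarrow> 'k schur \<Rightarrow> 'k monalg" where
  "unlift \<phi> = inv_into (carrier kS) (lift \<phi>)"

context
  fixes \<phi> :: "'k::field_char_0 monalg \<Rightarrow> 'k schur set"
  assumes \<phi>: "\<phi> \<in> algebra_iso kS (level_algebra B n r \<nu>)"
begin

lemma \<phi>_lift: "b \<in> carrier kS \<Longrightarrow> \<phi> b = {lift \<phi> b}"
  and lift_in: "b \<in> carrier kS \<Longrightarrow> lift \<phi> b \<in> EBE"
proof -
  assume "b \<in> carrier kS"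
  then have "\<phi> b \<in> carrier (level_algebra B n r \<nu>)"
    using \<phi> by (auto simp: algebra_iso_def ring_iso_def ring_hom_def)
  then obtain c where "c \<in> EBE" "\<phi> b = {c}" by (auto simp: level_algebra_\<nu>)
  then show "\<phi> b = {lift \<phi> b}" "lift \<phi> b \<in> EBE" by (simp_all add: lift_def)
qed

lemma lift_bij: "bij_betw (lift \<phi>) (carrier kS) EBE"
proof -
  have bij: "bij_betw \<phi> (carrier kS) ((\<lambda>c. {c}) ` EBE)"
    using \<phi> by (simp only: algebra_iso_def ring_iso_def level_algebra_\<nu> mem_Collect_eq)
  have "bij_betw the_elem ((\<lambda>c. {c}) ` (EBE :: 'k schur set)) EBE"
    by (intro bij_betwI[where g = "\<lambda>c. {c}"]) auto
  from bij_betw_trans[OF bij this] show ?thesis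
    by (rule bij_betw_cong[THEN iffD1, rotated]) (simp add: lift_def)
qed

lemma corner_retract_lift: "corner_retract B kS E (lift \<phi>) (unlift \<phi>)"
proof -
  interpret B: ring "B :: ('k, 'k schur) module" by (rule B_ring)
  interpret A: ring "kS :: ('k, 'k monalg) module" by (rule monoid_algebra_ring)
  have hom: "\<phi> \<in> ring_hom kS (level_algebra B n r \<nu>)"
    using \<phi> by (simp add: algebra_iso_def ring_iso_def)
  have g_add: "lift \<phi> (b \<oplus>\<^bsub>kS\<^esub> c) = lift \<phi> b \<oplus>\<^bsub>B\<^esub> lift \<phi> c"
    if "b \<in> carrier kS" "c \<in> carrier kS" for b c
    using ring_hom_add[OF hom that] \<phi>_lift[OF that(1)] \<phi>_lift[OF that(2)]
      \<phi>_lift[OF A.a_closed[OF that]] by (simp only: level_algebra_\<nu>) simp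
  have g_mult: "lift \<phi> (b \<otimes>\<^bsub>kS\<^esub> c) = lift \<phi> b \<otimes>\<^bsub>B\<^esub> lift \<phi> c"
    if "b \<in> carrier kS" "c \<in> carrier kS" for b c
    using ring_hom_mult[OF hom that] \<phi>_lift[OF that(1)] \<phi>_lift[OF that(2)]
      \<phi>_lift[OF A.m_closed[OF that]] level_algebra_\<nu>(4)[OF lift_in[OF that(1)] lift_in[OF that(2)]]
    by (metis the_elem_eq)
  have g_one: "lift \<phi> \<one>\<^bsub>kS\<^esub> = E"
    using ring_hom_one[OF hom] \<phi>_lift[OF A.one_closed] level_algebra_\<nu>(2) by (metis the_elem_eq)
  have p: "unlift \<phi> c \<in> carrier kS" "lift \<phi> (unlift \<phi> c) = c" if "c \<in> EBE" for c
    using lift_bij that unfolding unlift_def bij_betw_def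
    by (metis inv_into_into, metis f_inv_into_f)
  have pg: "unlift \<phi> (lift \<phi> b) = b" if "b \<in> carrier kS" for b
    using lift_bij that unfolding unlift_def by (simp add: bij_betw_def)
  have EBE_I: "c \<in> EBE" if "c \<in> carrier B" "E \<otimes>\<^bsub>B\<^esub> c = c" "c \<otimes>\<^bsub>B\<^esub> E = c" for c :: "'k schur"
    using that by (simp add: EBE_def)
  have EBE_D: "c \<in> carrier B" "E \<otimes>\<^bsub>B\<^esub> c = c" "c \<otimes>\<^bsub>B\<^esub> E = c" if "c \<in> EBE" for c :: "'k schur"
    using that by (simp_all add: EBE_def)
  show ?thesis
  proof (intro corner_retract.intro corner_retract_axioms.intro B_ring monoid_algebra_ring E_closed E_E)
    fix b c :: "'k monalg" assume b: "b \<in> carrier kS"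
    show "lift \<phi> b \<in> carrier B" "E \<otimes>\<^bsub>B\<^esub> lift \<phi> b = lift \<phi> b" "lift \<phi> b \<otimes>\<^bsub>B\<^esub> E = lift \<phi> b"
      "unlift \<phi> (lift \<phi> b) = b"
      using EBE_D[OF lift_in[OF b]] pg[OF b] by simp_all
    assume c: "c \<in> carrier kS"
    show "lift \<phi> (b \<oplus>\<^bsub>kS\<^esub> c) = lift \<phi> b \<oplus>\<^bsub>B\<^esub> lift \<phi> c" using b c by (rule g_add)
    show "lift \<phi> (b \<otimes>\<^bsub>kS\<^esub> c) = lift \<phi> b \<otimes>\<^bsub>B\<^esub> lift \<phi> c" using b c by (rule g_mult)
  next
    show "lift \<phi> \<one>\<^bsub>kS\<^esub> = E" by (rule g_one)
  next
    fix a assume a: "a \<in> carrier B" "E \<otimes>\<^bsub>B\<^esub> a = a" "a \<otimes>\<^bsub>B\<^esub> E = (a :: 'k schur)"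
    note pa = p[OF EBE_I[OF a]]
    show "unlift \<phi> a \<in> carrier kS" by (rule pa(1))
    fix a' assume a': "a' \<in> carrier B" "E \<otimes>\<^bsub>B\<^esub> a' = a'" "a' \<otimes>\<^bsub>B\<^esub> E = (a' :: 'k schur)"
    note pa' = p[OF EBE_I[OF a']]
    show "unlift \<phi> (a \<oplus>\<^bsub>B\<^esub> a') = unlift \<phi> a \<oplus>\<^bsub>kS\<^esub> unlift \<phi> a'"
      using g_add[OF pa(1) pa'(1)] pg[OF A.a_closed[OF pa(1) pa'(1)]] pa(2) pa'(2) by metis
    show "unlift \<phi> (a \<otimes>\<^bsub>B\<^esub> a') = unlift \<phi> a \<otimes>\<^bsub>kS\<^esub> unlift \<phi> a'"
      using g_mult[OF pa(1) pa'(1)] pg[OF A.m_closed[OF pa(1) pa'(1)]] pa(2) pa'(2) by metis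
  qed
qed

definition act :: "('k schur, 'v) module \<Rightarrow> 'k monalg \<Rightarrow> 'v \<Rightarrow> 'v" where
  "act I b x = (SOME c. c \<in> \<phi> b) \<odot>\<^bsub>I\<^esub> x"

lemma act_lift: "b \<in> carrier kS \<Longrightarrow> act I b x = lift \<phi> b \<odot>\<^bsub>I\<^esub> x"
  using \<phi>_lift by (simp add: act_def)

lemma pullback_level_module:
  "pullback \<phi> (level_module \<nu> I) = with_action I ((\<lambda>x. E \<odot>\<^bsub>I\<^esub> x) ` carrier I) (act I)"
  by (simp add: pullback_def level_module_def with_action_def act_def[abs_def])

lemma corner_module_lift:
  assumes "left_module B I"
  shows "corner_module B kS E (lift \<phi>) (unlift \<phi>) I (act I)"
  by (intro corner_module.intro corner_module_axioms.intro corner_retract_lift assms act_lift)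

text \<open>Here the retraction is the inverse of \<open>lift\<close>, so its kernel on the corner
  is zero and the condition holds for every module.\<close>

lemma admissible_lift:
  assumes I: "left_module B I"
  shows "corner_retract.admissible B kS E (unlift \<phi>) I"
proof -
  interpret corner_module B kS E "lift \<phi>" "unlift \<phi>" I "act I"
    using I by (rule corner_module_lift)
  show ?thesis
    unfolding admissible_def
  proof (intro allI impI)
    fix a x assume a: "in_corner a" and pa: "unlift \<phi> a = \<zero>\<^bsub>kS\<^esub>" and x: "x \<in> corner_carrier I"
    have "a \<in> EBE" using a unfolding EBE_def in_corner_def by blast
    then have "a = lift \<phi> (unlift \<phi> a)"
      using lift_bij unfolding unlift_def bij_betw_def by (metis f_inv_into_f)
    also have "\<dots> = \<zero>\<^bsub>B\<^esub>"
    proof -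
      have "lift \<phi> \<zero>\<^bsub>kS\<^esub> = lift \<phi> \<zero>\<^bsub>kS\<^esub> \<oplus>\<^bsub>B\<^esub> lift \<phi> \<zero>\<^bsub>kS\<^esub>"
        using g_add[OF R'.zero_closed R'.zero_closed] R'.l_zero[OF R'.zero_closed] by metis
      then show ?thesis
        unfolding pa using g_closed[OF R'.zero_closed] by (metis R.add.r_cancel_one' R.zero_closed)
    qed
    finally show "a \<odot>\<^bsub>I\<^esub> x = \<zero>\<^bsub>I\<^esub>"
      using x by (simp only: M.smult_l_null corner_carrier_iff)
  qed
qed

end

text \<open>If \<open>E\<close> annihilated the module, the annihilator of a nonzero vector would
  contain every \<open>u E v\<close>, hence 1.\<close>

lemma E_nonzero:
  fixes I :: "('k::field_char_0 schur, 'v) module"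
  assumes irr: "irreducible_module B I"
  shows "\<exists>x\<in>carrier I. E \<odot>\<^bsub>I\<^esub> x \<noteq> \<zero>\<^bsub>I\<^esub>"
proof (rule ccontr)
  assume "\<not> ?thesis"
  then have zero: "E \<odot>\<^bsub>I\<^esub> x = \<zero>\<^bsub>I\<^esub>" if "x \<in> carrier I" for x using that by blast
  interpret I: left_module "B :: ('k, 'k schur) module" I
    using irr by (rule irreducible_module_left_module)
  obtain z where z: "z \<in> carrier I" "z \<noteq> \<zero>\<^bsub>I\<^esub>"
    using irr by (rule irreducible_module_nonzero)
  let ?T = "{a \<in> carrier B. a \<odot>\<^bsub>I\<^esub> z = \<zero>\<^bsub>I\<^esub>}"
  have "\<one>\<^bsub>B\<^esub> \<in> ?T"
  proof (rule one_in_additive_closure[OF young_\<nu>])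
    show "\<zero>\<^bsub>B\<^esub> \<in> ?T" using I.smult_l_null[OF z(1)] I.R.zero_closed by simp
    show "a \<oplus>\<^bsub>B\<^esub> b \<in> ?T" if "a \<in> ?T" "b \<in> ?T" for a b
      using that I.smult_l_distr[of a b z] I.R.a_closed[of a b] z(1) by simp
    show "u \<otimes>\<^bsub>B\<^esub> E \<otimes>\<^bsub>B\<^esub> v \<in> ?T" if u: "u \<in> carrier B" and v: "v \<in> carrier B" for u v
    proof -
      have uE: "u \<otimes>\<^bsub>B\<^esub> E \<in> carrier B" using u E_closed by (rule I.R.m_closed)
      have "(u \<otimes>\<^bsub>B\<^esub> E \<otimes>\<^bsub>B\<^esub> v) \<odot>\<^bsub>I\<^esub> z = u \<odot>\<^bsub>I\<^esub> (E \<odot>\<^bsub>I\<^esub> (v \<odot>\<^bsub>I\<^esub> z))"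
        using I.smult_assoc1[OF uE v z(1)] I.smult_assoc1[OF u E_closed I.smult_closed[OF v z(1)]]
        by simp
      also have "\<dots> = \<zero>\<^bsub>I\<^esub>"
        using zero[OF I.smult_closed[OF v z(1)]] I.smult_r_null[OF u] by simp
      finally show ?thesis using I.R.m_closed[OF uE v] by simp
    qed
  qed
  then show False using I.smult_one[OF z(1)] z(2) by simp
qed

text \<open>The idempotent below \<open>\<nu>\<close> is zero, and \<open>E e_upto = E\<close>
  transfers nontriviality from \<open>E\<close> to \<open>e_upto\<close>.\<close>

lemma at_level_\<nu>:
  fixes I :: "('k::field_char_0 schur, 'v) module"
  assumes irr: "irreducible_module B I"
  shows "at_level n r \<nu> I"
proof -
  interpret I: left_module "B :: ('k, 'k schur) module" I
    using irr by (rule irreducible_module_left_module)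
  obtain x where x: "x \<in> carrier I" "E \<odot>\<^bsub>I\<^esub> x \<noteq> \<zero>\<^bsub>I\<^esub>" using E_nonzero[OF irr] by blast
  have upto: "e_upto n r \<nu> \<in> carrier (B :: ('k, 'k schur) module)"
    unfolding e_upto_\<nu> by (rule diag_closed) auto
  have "E \<odot>\<^bsub>I\<^esub> (e_upto n r \<nu> \<odot>\<^bsub>I\<^esub> x) = E \<odot>\<^bsub>I\<^esub> x"
    using I.smult_assoc1[OF E_closed upto x(1)] by (simp add: E_e_upto)
  then have "e_upto n r \<nu> \<odot>\<^bsub>I\<^esub> x \<noteq> \<zero>\<^bsub>I\<^esub>"
    using x(2) I.smult_r_null[OF E_closed] by auto
  then show ?thesis
    unfolding at_level_def e_below_\<nu> using x(1) I.smult_l_null by blast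
qed

context
  fixes \<phi> :: "'k::field_char_0 monalg \<Rightarrow> 'k schur set"
  assumes \<phi>: "\<phi> \<in> algebra_iso kS (level_algebra B n r \<nu>)"
begin

lemma irreducible_pullback:
  assumes irr: "irreducible_module B I"
  shows "irreducible_module kS (pullback \<phi> (level_module \<nu> I))"
proof -
  have I: "left_module B I" using irr by (rule irreducible_module_left_module)
  interpret corner_module B kS E "lift \<phi>" "unlift \<phi>" I "act \<phi> I"
    using \<phi> I by (rule corner_module_lift)
  show ?thesis
    using corner_irreducible[OF irr admissible_lift[OF \<phi> I] E_nonzero[OF irr]]
    unfolding pullback_level_module[OF \<phi>] corner_carrier_def .
qed

lemma pullback_isomorphic_iff:
  assumes irr: "irreducible_module B I" "irreducible_module B I'"
  shows "module_isomorphic kS (pullback \<phi> (level_module \<nu> I)) (pullback \<phi> (level_module \<nu> I')) \<longleftrightarrow>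
    module_isomorphic B I I'"
proof -
  have I: "left_module B I" "left_module B I'"
    using irr by (simp_all add: irreducible_module_left_module)
  interpret corner_retract B kS E "lift \<phi>" "unlift \<phi>" using \<phi> by (rule corner_retract_lift)
  show ?thesis
    using corner_isomorphic_iff[OF corner_module_lift[OF \<phi> I(1)] corner_module_lift[OF \<phi> I(2)] irr
        admissible_lift[OF \<phi> I(1)] admissible_lift[OF \<phi> I(2)] E_nonzero[OF irr(1)]]
    unfolding pullback_level_module[OF \<phi>] corner_carrier_def .
qed

lemma ex_irreducible_pullback:
  fixes N :: "('k monalg, 'u) module"
  assumes irr: "irreducible_module kS N"
  shows "\<exists>I :: ('k schur, 'k schur set) module. irreducible_module B I \<and>
    module_isomorphic kS (pullback \<phi> (level_module \<nu> I)) N"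
proof -
  interpret corner_retract B kS E "lift \<phi>" "unlift \<phi>" using \<phi> by (rule corner_retract_lift)
  obtain I :: "('k schur, 'k schur set) module" where I: "irreducible_module B I"
    and iso: "\<And>act. \<forall>b\<in>carrier kS. \<forall>x\<in>corner_carrier I. act b x = lift \<phi> b \<odot>\<^bsub>I\<^esub> x \<Longrightarrow>
       module_isomorphic kS (with_action I (corner_carrier I) act) N"
    using irreducible_module_from_corner[OF irr] by blast
  have "module_isomorphic kS (pullback \<phi> (level_module \<nu> I)) N"
    unfolding pullback_level_module[OF \<phi>] corner_carrier_def[symmetric]
    by (rule iso) (intro ballI act_lift[OF \<phi>])
  with I show ?thesis by blast
qed

end

end

text \<open>Each correspondence is expressed by well-definedness, compatibility with isomorphism in
  both directions, and surjectivity up to isomorphism. The modules range over arbitrary carrier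
  types; the ones asserted to exist by surjectivity are quotients of the algebra by left ideals, so
  their vectors are sets of algebra elements.\<close>

theorem theorem6p1:
  fixes n r :: nat and S :: "(nat \<Rightarrow> nat) set" and X :: side
    and B :: "('k::field_char_0, 'k schur) module"
    and kS :: "('k, 'k monalg) module"
    and \<nu> :: "nat list"
  assumes "1 \<le> r" and "r \<le> n"
    and "sym_maps r \<subseteq> S" and "S \<subseteq> tau_bar r"
    and "\<And>\<alpha> \<beta>. \<alpha> \<in> S \<Longrightarrow> \<beta> \<in> S \<Longrightarrow> \<alpha> \<circ> \<beta> \<in> S"
    and B: "B = gen_schur X n r S"
    and kS: "kS = monoid_algebra S"
    and \<nu>: "\<nu> = replicate r 1 @ replicate (n - r) 0"
  shows
    "(\<exists>\<phi>. \<phi> \<in> algebra_iso kS (level_algebra B n r \<nu>)) \<and>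
     (\<forall>l\<in>partitions n r. l \<noteq> \<nu> \<longrightarrow>
        carrier (level_algebra B n r l) = {\<zero>\<^bsub>level_algebra B n r l\<^esub>}) \<and>
     (\<forall>I :: ('k schur, 'v) module. irreducible_module B I \<longrightarrow> at_level n r \<nu> I) \<and>
     (\<forall>\<phi> \<in> algebra_iso kS (level_algebra B n r \<nu>).
        (\<forall>I :: ('k schur, 'v) module. irreducible_module B I \<longrightarrow>
           irreducible_module kS (pullback \<phi> (level_module \<nu> I))) \<and>
        (\<forall>(I :: ('k schur, 'v) module) (I' :: ('k schur, 'w) module).
           irreducible_module B I \<and> irreducible_module B I' \<longrightarrow>
           (module_isomorphic kS (pullback \<phi> (level_module \<nu> I)) (pullback \<phi> (level_module \<nu> I'))
              \<longleftrightarrow> module_isomorphic B I I')) \<and>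
        (\<forall>N :: ('k monalg, 'u) module. irreducible_module kS N \<longrightarrow>
           (\<exists>I :: ('k schur, 'k schur set) module. irreducible_module B I \<and>
              module_isomorphic kS (pullback \<phi> (level_module \<nu> I)) N))) \<and>
     (\<forall>N :: ('k monalg, 'u) module. irreducible_module kS N \<longrightarrow>
        (\<exists>i\<in>rank r ` S. i \<le> r \<and> (\<exists>W :: ('k monalg, 'u) module.
           irreducible_module (monoid_algebra (sym_maps i) :: ('k, 'k monalg) module) W \<and>
           apex_corresponds r S N i W))) \<and>
     (\<forall>i\<in>rank r ` S. \<forall>W :: ('k monalg, 'w) module.
        irreducible_module (monoid_algebra (sym_maps i) :: ('k, 'k monalg) module) W \<longrightarrow>
        (\<exists>N :: ('k monalg, 'k monalg set) module.
           irreducible_module kS N \<and> apex_corresponds r S N i W)) \<and>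
     (\<forall>(N :: ('k monalg, 'u) module) (N' :: ('k monalg, 'x) module) i i'
        (W :: ('k monalg, 'w) module) (W' :: ('k monalg, 'y) module).
        irreducible_module kS N \<and> irreducible_module kS N' \<and>
        i \<in> rank r ` S \<and> i' \<in> rank r ` S \<and>
        irreducible_module (monoid_algebra (sym_maps i) :: ('k, 'k monalg) module) W \<and>
        irreducible_module (monoid_algebra (sym_maps i') :: ('k, 'k monalg) module) W' \<and>
        apex_corresponds r S N i W \<and> apex_corresponds r S N' i' W' \<longrightarrow>
        (module_isomorphic kS N N' \<longleftrightarrow>
         i = i' \<and> module_isomorphic (monoid_algebra (sym_maps i) :: ('k, 'k monalg) module) W W'))"
proof -
  interpret schur_level r S n X
    by unfold_locales (use assms in auto)
  have \<nu>': "\<nu> = schur_level.\<nu> r n" unfolding \<nu> \<nu>_def ..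
  show ?thesis
    unfolding B kS \<nu>'
    apply (intro conjI ballI allI impI; (elim conjE)?)
    subgoal using \<Phi>_iso by blast
    subgoal by (rule level_algebra_trivial)
    subgoal by (rule at_level_\<nu>)
    subgoal by (rule irreducible_pullback)
    subgoal by (rule pullback_isomorphic_iff)
    subgoal by (rule ex_irreducible_pullback)
    subgoal by (rule irreducible_has_apex)
    subgoal by (rule ex_irreducible_with_apex)
    subgoal by (rule apex_isomorphic_iff)
    done
qed

end
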